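(* Let $n\ge1$ and let $R$ be any ring such that $(\mathcal{GF}(R),\mathcal{F}(R))$ is a left $n$-cotorsion pair in $\mathrm{Mod}(R)$. Then the following conditions are equivalent. (a) $m:=\sup\{\mathrm{Gid}(N^{++}/N):N\in\mathrm{Mod}(R^{\mathrm{op}})\}<\infty$. (b) $(\mathcal{I}(R^{\mathrm{op}}),\mathcal{GI}(R^{\mathrm{op}}))$ is a right $(k+1)$-cotorsion pair in $\mathrm{Mod}(R^{\mathrm{op}})$ for some integer $k\ge1$. Moreover, if any of the previous conditions holds true, one can take $k=\max\{n,m\}$.
   Context: $R$ is an associative ring with identity; $\mathrm{Mod}(R)$ is the category of left $R$-modules and $\mathrm{Mod}(R^{\mathrm{op}})$ that of right $R$-modules. $\mathcal{F}(R)$: flat modules. $\mathcal{GF}(R)$: Gorenstein flat modules, i.e. $Z_0(F)$ for an exact complex $F$ of flat left $R$-modules with $E\otimes_RF$ exact for every injective right $R$-module $E$. For a ring $S$, $\mathcal{I}(S)$: injective left $S$-modules; $\mathcal{GI}(S)$: Gorenstein injective left $S$-modules, i.e. cycles of exact complexes $I$ of injective $S$-modules with $\mathrm{Hom}_S(E,I)$ exact for every injective $E$. $M^+=\mathrm{Hom}_{\mathbb{Z}}(M,\mathbb{Q}/\mathbb{Z})$ is the Pontryagin dual, exchanging left and right modules; $N$ is regarded as a submodule of $N^{++}$ via the canonical evaluation map. For a class $\mathcal{X}$, $\mathcal{X}^\wedge_k$ (resp. $\mathcal{X}^\vee_k$) is the class of modules $C$ with an exact sequence $0\to X_k\to\cdots\to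 X_0\to C\to0$ (resp. $0\to C\to X_0\to\cdots\to X_k\to0$) of length at most $k$ with terms in $\mathcal{X}$. $\mathrm{Gid}(N)$ is the smallest $k$ with $N\in\mathcal{GI}(R^{\mathrm{op}})^\vee_k$ ($\infty$ if none). Left $n$-cotorsion pair $(\mathcal{A},\mathcal{B})$: $\mathcal{A}$ is closed under direct summands; $\mathrm{Ext}^i(A,B)=0$ for all $A\in\mathcal{A}$, $B\in\mathcal{B}$, $1\le i\le n$; every module $C$ fits in $0\to K\to A\to C\to0$ exact with $A\in\mathcal{A}$, $K\in\mathcal{B}^\wedge_{n-1}$. Right $n$-cotorsion pair: $\mathcal{B}$ is closed under direct summands; the same Ext vanishing; every $C$ fits in $0\to C\to B\to L\to0$ exact with $B\in\mathcal{B}$, $L\in\mathcal{A}^\vee_{n-1}$. *)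

theory Defs
  imports
    "HOL-Algebra.Module"
    "HOL-Algebra.AbelCoset"
    "HOL-Algebra.Free_Abelian_Groups"
    "HOL-Algebra.Elementary_Groups"
    "HOL-Library.Equipollence"
    "HOL-Library.Extended_Nat"
begin

section \<open>Size\<close>

text \<open>
  HOL cannot quantify over the modules of all types. As usual we work relative to a universe:
  a type \<open>'u\<close> is fixed, a set is \<^emph>\<open>small\<close> if its cardinality is less than that
  of \<open>'u\<close>, and the module categories consist of the modules with small carrier contained in
  \<open>'u\<close>. We only ask that the small sets include \<open>\<nat>\<close> and are closed under power
  sets and countable unions. This holds whenever the cardinality of \<open>'u\<close> is inaccessible
  (Grothendieck universes), and already when it is an uncountable strong limit cardinal of uncountable
  cofinality.
\<close>

definition universe_type :: "'u itself \<Rightarrow> bool" where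
  "universe_type _ \<longleftrightarrow>
     (UNIV :: nat set) \<prec> (UNIV :: 'u set) \<and>
     (\<forall>A :: 'u set. A \<prec> (UNIV :: 'u set) \<longrightarrow> Pow A \<prec> (UNIV :: 'u set)) \<and>
     (\<forall>A :: nat \<Rightarrow> 'u set.
        (\<forall>i. A i \<prec> (UNIV :: 'u set)) \<longrightarrow> (\<Union>i. A i) \<prec> (UNIV :: 'u set))"


section \<open>Modules over a not necessarily commutative ring\<close>

text \<open>
  The library's locale \<open>module\<close> requires a commutative ring, so we keep its record type but
  restate its axioms. The fields \<open>mult\<close> and \<open>one\<close> of the record carry no meaning.
\<close>

locale lmodule = R?: ring R + M?: abelian_group M
  for R :: "('r, 'x) ring_scheme" (structure) and M :: "('r, 'a) module" (structure) +
  assumes smult_closed: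
      "\<lbrakk>a \<in> carrier R; x \<in> carrier M\<rbrakk> \<Longrightarrow> a \<odot>\<^bsub>M\<^esub> x \<in> carrier M"
    and smult_l_distr:
      "\<lbrakk>a \<in> carrier R; b \<in> carrier R; x \<in> carrier M\<rbrakk> \<Longrightarrow>
        (a \<oplus>\<^bsub>R\<^esub> b) \<odot>\<^bsub>M\<^esub> x = a \<odot>\<^bsub>M\<^esub> x \<oplus>\<^bsub>M\<^esub> b \<odot>\<^bsub>M\<^esub> x"
    and smult_r_distr:
      "\<lbrakk>a \<in> carrier R; x \<in> carrier M; y \<in> carrier M\<rbrakk> \<Longrightarrow>
        a \<odot>\<^bsub>M\<^esub> (x \<oplus>\<^bsub>M\<^esub> y) = a \<odot>\<^bsub>M\<^esub> x \<oplus>\<^bsub>M\<^esub> a \<odot>\<^bsub>M\<^esub> y"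
    and smult_assoc1:
      "\<lbrakk>a \<in> carrier R; b \<in> carrier R; x \<in> carrier M\<rbrakk> \<Longrightarrow>
        (a \<otimes>\<^bsub>R\<^esub> b) \<odot>\<^bsub>M\<^esub> x = a \<odot>\<^bsub>M\<^esub> (b \<odot>\<^bsub>M\<^esub> x)"
    and smult_one:
      "x \<in> carrier M \<Longrightarrow> \<one>\<^bsub>R\<^esub> \<odot>\<^bsub>M\<^esub> x = x"

definition op_ring :: "('r, 'x) ring_scheme \<Rightarrow> ('r, 'x) ring_scheme" where
  "op_ring R = R\<lparr>mult := \<lambda>a b. b \<otimes>\<^bsub>R\<^esub> a\<rparr>"

text \<open>
  Right \<open>R\<close>-modules are left modules over \<^term>\<open>op_ring R\<close>: for these,
  \<open>r \<odot> x\<close> stands for \<open>x r\<close>.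
\<close>

definition Mods :: "('r, 'x) ring_scheme \<Rightarrow> ('r, 'u) module set" where
  "Mods R = {M. lmodule R M \<and> carrier M \<prec> (UNIV :: 'u set)}"

definition mod_hom ::
  "('r, 'x) ring_scheme \<Rightarrow> ('r, 'a) module \<Rightarrow> ('r, 'b) module \<Rightarrow> ('a \<Rightarrow> 'b) set" where
  "mod_hom R M N =
     {f \<in> carrier M \<rightarrow> carrier N.
        (\<forall>x\<in>carrier M. \<forall>y\<in>carrier M. f (x \<oplus>\<^bsub>M\<^esub> y) = f x \<oplus>\<^bsub>N\<^esub> f y) \<and>
        (\<forall>r\<in>carrier R. \<forall>x\<in>carrier M. f (r \<odot>\<^bsub>M\<^esub> x) = r \<odot>\<^bsub>N\<^esub> f x)}"

definition mod_iso ::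
  "('r, 'x) ring_scheme \<Rightarrow> ('r, 'a) module \<Rightarrow> ('r, 'b) module \<Rightarrow> bool" where
  "mod_iso R M N \<longleftrightarrow> (\<exists>f\<in>mod_hom R M N. bij_betw f (carrier M) (carrier N))"

definition direct_sum :: "('r, 'a) module \<Rightarrow> ('r, 'b) module \<Rightarrow> ('r, 'a \<times> 'b) module" where
  "direct_sum M N =
     \<lparr>carrier = carrier M \<times> carrier N, mult = undefined, one = undefined,
      ring.zero = (\<zero>\<^bsub>M\<^esub>, \<zero>\<^bsub>N\<^esub>),
      ring.add = (\<lambda>(x, y) (x', y'). (x \<oplus>\<^bsub>M\<^esub> x', y \<oplus>\<^bsub>N\<^esub> y')),
      smult = (\<lambda>r (x, y). (r \<odot>\<^bsub>M\<^esub> x, r \<odot>\<^bsub>N\<^esub> y))\<rparr>"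

definition quotient_module :: "('r, 'a) module \<Rightarrow> 'a set \<Rightarrow> ('r, 'a set) module" where
  "quotient_module M K =
     \<lparr>carrier = a_rcosets\<^bsub>M\<^esub> K, mult = undefined, one = undefined,
      ring.zero = K, ring.add = set_add M,
      smult = (\<lambda>r X. K <+>\<^bsub>M\<^esub> ((\<lambda>x. r \<odot>\<^bsub>M\<^esub> x) ` X))\<rparr>"

definition exact_at ::
  "('r, 'x) ring_scheme \<Rightarrow> ('r, 'a) module \<Rightarrow> ('a \<Rightarrow> 'b) \<Rightarrow> ('r, 'b) module \<Rightarrow> ('b \<Rightarrow> 'c) \<Rightarrow>
   ('r, 'c) module \<Rightarrow> bool" where
  "exact_at R A f B g C \<longleftrightarrow>
     f \<in> mod_hom R A B \<and> g \<in> mod_hom R B C \<and> f ` carrier A = a_kernel B C g"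

definition short_exact ::
  "('r, 'x) ring_scheme \<Rightarrow> ('r, 'a) module \<Rightarrow> ('a \<Rightarrow> 'b) \<Rightarrow> ('r, 'b) module \<Rightarrow> ('b \<Rightarrow> 'c) \<Rightarrow>
   ('r, 'c) module \<Rightarrow> bool" where
  "short_exact R A f B g C \<longleftrightarrow>
     inj_on f (carrier A) \<and> exact_at R A f B g C \<and> g ` carrier B = carrier C"

definition group_exact_at ::
  "'a monoid \<Rightarrow> ('a \<Rightarrow> 'b) \<Rightarrow> 'b monoid \<Rightarrow> ('b \<Rightarrow> 'c) \<Rightarrow> 'c monoid \<Rightarrow> bool" where
  "group_exact_at A f B g C \<longleftrightarrow>
     f \<in> hom A B \<and> g \<in> hom B C \<and> f ` carrier A = kernel B C g"


section \<open>Groups of homomorphisms and tensor products\<close>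

definition hom_group ::
  "('r, 'x) ring_scheme \<Rightarrow> ('r, 'a) module \<Rightarrow> ('r, 'b) module \<Rightarrow> ('a \<Rightarrow> 'b) monoid" where
  "hom_group R A B =
     \<lparr>carrier = mod_hom R A B \<inter> extensional (carrier A),
      mult = (\<lambda>f g. \<lambda>x\<in>carrier A. f x \<oplus>\<^bsub>B\<^esub> g x),
      one = (\<lambda>x\<in>carrier A. \<zero>\<^bsub>B\<^esub>)\<rparr>"

text \<open>The maps \<open>Hom(A, B) \<rightarrow> Hom(A, C)\<close> and \<open>Hom(A, B) \<rightarrow> Hom(A', B)\<close>
  induced by \<open>d : B \<rightarrow> C\<close> and \<open>d : A' \<rightarrow> A\<close>.\<close>

definition hom_post :: "('r, 'a) module \<Rightarrow> ('b \<Rightarrow> 'c) \<Rightarrow> ('a \<Rightarrow> 'b) \<Rightarrow> ('a \<Rightarrow> 'c)" where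
  "hom_post A d = (\<lambda>f. \<lambda>x\<in>carrier A. d (f x))"

definition hom_pre :: "('r, 'a) module \<Rightarrow> ('a \<Rightarrow> 'b) \<Rightarrow> ('b \<Rightarrow> 'c) \<Rightarrow> ('a \<Rightarrow> 'c)" where
  "hom_pre A' d = (\<lambda>f. \<lambda>x\<in>carrier A'. f (d x))"

definition tensor_rels ::
  "('r, 'x) ring_scheme \<Rightarrow> ('r, 'e) module \<Rightarrow> ('r, 'f) module \<Rightarrow> ('e \<times> 'f \<Rightarrow>\<^sub>0 int) set" where
  "tensor_rels R E F =
     generate (free_Abelian_group (carrier E \<times> carrier F))
       ({frag_of (e \<oplus>\<^bsub>E\<^esub> e', x) - frag_of (e, x) - frag_of (e', x) | e e' x.
           e \<in> carrier E \<and> e' \<in> carrier E \<and> x \<in> carrier F} \<union>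
        {frag_of (e, x \<oplus>\<^bsub>F\<^esub> x') - frag_of (e, x) - frag_of (e, x') | e x x'.
           e \<in> carrier E \<and> x \<in> carrier F \<and> x' \<in> carrier F} \<union>
        {frag_of (r \<odot>\<^bsub>E\<^esub> e, x) - frag_of (e, r \<odot>\<^bsub>F\<^esub> x) | r e x.
           r \<in> carrier R \<and> e \<in> carrier E \<and> x \<in> carrier F})"

text \<open>\<open>E \<otimes>\<^sub>R F\<close> for a right module \<open>E\<close> (a module over \<^term>\<open>op_ring R\<close>)
  and a left module \<open>F\<close>.\<close>

definition tensor ::
  "('r, 'x) ring_scheme \<Rightarrow> ('r, 'e) module \<Rightarrow> ('r, 'f) module \<Rightarrow> ('e \<times> 'f \<Rightarrow>\<^sub>0 int) set monoid"
  where
  "tensor R E F = free_Abelian_group (carrier E \<times> carrier F) Mod tensor_rels R E F"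

text \<open>The map \<open>g \<otimes> h : E \<otimes> F \<rightarrow> E' \<otimes> F'\<close>; its first three arguments
  determine the target. A coset is mapped to the coset of the images of its elements.\<close>

definition tensor_map ::
  "('r, 'x) ring_scheme \<Rightarrow> ('r, 'e2) module \<Rightarrow> ('r, 'f2) module \<Rightarrow> ('e \<Rightarrow> 'e2) \<Rightarrow> ('f \<Rightarrow> 'f2) \<Rightarrow>
   ('e \<times> 'f \<Rightarrow>\<^sub>0 int) set \<Rightarrow> ('e2 \<times> 'f2 \<Rightarrow>\<^sub>0 int) set" where
  "tensor_map R E' F' g h = (\<lambda>X.
     tensor_rels R E' F' <#>\<^bsub>free_Abelian_group (carrier E' \<times> carrier F')\<^esub>
       (frag_extend (\<lambda>(e, x). frag_of (g e, h x)) ` X))"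


section \<open>Classes of modules\<close>

definition Inj_mods :: "('r, 'x) ring_scheme \<Rightarrow> ('r, 'u) module set" where
  "Inj_mods R = {E \<in> Mods R.
     \<forall>A\<in>(Mods R :: ('r, 'u) module set). \<forall>B\<in>(Mods R :: ('r, 'u) module set).
       \<forall>i\<in>mod_hom R A B. \<forall>f\<in>mod_hom R A E. inj_on i (carrier A) \<longrightarrow>
         (\<exists>g\<in>mod_hom R B E. \<forall>x\<in>carrier A. g (i x) = f x)}"

definition Proj_mods :: "('r, 'x) ring_scheme \<Rightarrow> ('r, 'u) module set" where
  "Proj_mods R = {P \<in> Mods R.
     \<forall>A\<in>(Mods R :: ('r, 'u) module set). \<forall>B\<in>(Mods R :: ('r, 'u) module set).
       \<forall>p\<in>mod_hom R A B. \<forall>f\<in>mod_hom R P B. p ` carrier A = carrier B \<longrightarrow>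
         (\<exists>g\<in>mod_hom R P A. \<forall>x\<in>carrier P. p (g x) = f x)}"

definition Flat_mods :: "('r, 'x) ring_scheme \<Rightarrow> ('r, 'u) module set" where
  "Flat_mods R = {F \<in> Mods R.
     \<forall>A\<in>(Mods (op_ring R) :: ('r, 'u) module set).
     \<forall>B\<in>(Mods (op_ring R) :: ('r, 'u) module set).
       \<forall>i\<in>mod_hom (op_ring R) A B. inj_on i (carrier A) \<longrightarrow>
         inj_on (tensor_map R B F i id) (carrier (tensor R A F))}"

text \<open>Complexes indexed by the integers, with homological grading:
  \<open>d i : X i \<rightarrow> X (i - 1)\<close>.\<close>

definition exact_complex ::
  "('r, 'x) ring_scheme \<Rightarrow> (int \<Rightarrow> ('r, 'a) module) \<Rightarrow> (int \<Rightarrow> 'a \<Rightarrow> 'a) \<Rightarrow> bool" where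
  "exact_complex R X d \<longleftrightarrow>
     (\<forall>i. exact_at R (X (i + 1)) (d (i + 1)) (X i) (d i) (X (i - 1)))"

definition cycle_module ::
  "(int \<Rightarrow> ('r, 'a) module) \<Rightarrow> (int \<Rightarrow> 'a \<Rightarrow> 'a) \<Rightarrow> int \<Rightarrow> ('r, 'a) module" where
  "cycle_module X d i = (X i)\<lparr>carrier := a_kernel (X i) (X (i - 1)) (d i)\<rparr>"

definition GFlat_mods :: "('r, 'x) ring_scheme \<Rightarrow> ('r, 'u) module set" where
  "GFlat_mods R = {M \<in> Mods R.
     \<exists>F d. (\<forall>i. F i \<in> (Flat_mods R :: ('r, 'u) module set)) \<and> exact_complex R F d \<and>
       (\<forall>E\<in>(Inj_mods (op_ring R) :: ('r, 'u) module set). \<forall>i.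
          group_exact_at
            (tensor R E (F (i + 1))) (tensor_map R E (F i) id (d (i + 1)))
            (tensor R E (F i)) (tensor_map R E (F (i - 1)) id (d i))
            (tensor R E (F (i - 1)))) \<and>
       mod_iso R M (cycle_module F d 0)}"

definition GInj_mods :: "('r, 'x) ring_scheme \<Rightarrow> ('r, 'u) module set" where
  "GInj_mods R = {M \<in> Mods R.
     \<exists>I d. (\<forall>i. I i \<in> (Inj_mods R :: ('r, 'u) module set)) \<and> exact_complex R I d \<and>
       (\<forall>E\<in>(Inj_mods R :: ('r, 'u) module set). \<forall>i.
          group_exact_at
            (hom_group R E (I (i + 1))) (hom_post E (d (i + 1)))
            (hom_group R E (I i)) (hom_post E (d i))
            (hom_group R E (I (i - 1)))) \<and>
       mod_iso R M (cycle_module I d 0)}"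


section \<open>Ext\<close>

definition proj_resolution ::
  "('r, 'x) ring_scheme \<Rightarrow> ('r, 'u) module \<Rightarrow> (nat \<Rightarrow> ('r, 'u) module) \<Rightarrow> (nat \<Rightarrow> 'u \<Rightarrow> 'u) \<Rightarrow>
   ('u \<Rightarrow> 'u) \<Rightarrow> bool" where
  "proj_resolution R A P d \<epsilon> \<longleftrightarrow>
     (\<forall>i. P i \<in> Proj_mods R) \<and>
     \<epsilon> ` carrier (P 0) = carrier A \<and>
     exact_at R (P 1) (d 0) (P 0) \<epsilon> A \<and>
     (\<forall>i. exact_at R (P (i + 2)) (d (i + 1)) (P (i + 1)) (d i) (P i))"

text \<open>The \<open>i\<close>-th cohomology group of \<open>Hom(P, B)\<close>, for
  \<open>d i : P (i + 1) \<rightarrow> P i\<close>.\<close>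

definition hom_cohomology ::
  "('r, 'x) ring_scheme \<Rightarrow> (nat \<Rightarrow> ('r, 'a) module) \<Rightarrow> (nat \<Rightarrow> 'a \<Rightarrow> 'a) \<Rightarrow> nat \<Rightarrow>
   ('r, 'b) module \<Rightarrow> ('a \<Rightarrow> 'b) set monoid" where
  "hom_cohomology R P d i B =
     (hom_group R (P i) B)
       \<lparr>carrier := kernel (hom_group R (P i) B) (hom_group R (P (i + 1)) B)
                    (hom_pre (P (i + 1)) (d i))\<rparr>
     Mod (case i of
            0 \<Rightarrow> {one (hom_group R (P 0) B)}
          | Suc j \<Rightarrow> hom_pre (P (Suc j)) (d j) ` carrier (hom_group R (P j) B))"

definition Ext ::
  "('r, 'x) ring_scheme \<Rightarrow> nat \<Rightarrow> ('r, 'u) module \<Rightarrow> ('r, 'u) module \<Rightarrow> ('u \<Rightarrow> 'u) set monoid" where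
  "Ext R i A B =
     (let (P, d) = (SOME (P, d). \<exists>\<epsilon>. proj_resolution R A P d \<epsilon>)
      in hom_cohomology R P d i B)"


section \<open>Finite resolutions and cotorsion pairs\<close>

text \<open>\<open>\<X>\<^sup>\<and>\<^sub>k\<close> and \<open>\<X>\<^sup>\<or>\<^sub>k\<close>: the
  exact sequence ends in the zero module \<open>X (j + 1)\<close>, where \<open>j \<le> k\<close>. The module
  \<open>C\<close> need not live in \<open>'u\<close>, since this is applied to bidual modules.\<close>

definition resolved_by ::
  "('r, 'x) ring_scheme \<Rightarrow> ('r, 'u) module set \<Rightarrow> nat \<Rightarrow> ('r, 'c) module \<Rightarrow> bool" where
  "resolved_by R \<X> k C \<longleftrightarrow> lmodule R C \<and>
     (\<exists>j\<le>k. \<exists>X d \<epsilon>.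
        (\<forall>i\<le>j. X i \<in> \<X>) \<and>
        X (j + 1) \<in> Mods R \<and> carrier (X (j + 1)) = {\<zero>\<^bsub>X (j + 1)\<^esub>} \<and>
        \<epsilon> ` carrier (X 0) = carrier C \<and>
        exact_at R (X 1) (d 0) (X 0) \<epsilon> C \<and>
        (\<forall>i<j. exact_at R (X (i + 2)) (d (i + 1)) (X (i + 1)) (d i) (X i)))"

definition coresolved_by ::
  "('r, 'x) ring_scheme \<Rightarrow> ('r, 'u) module set \<Rightarrow> nat \<Rightarrow> ('r, 'c) module \<Rightarrow> bool" where
  "coresolved_by R \<X> k C \<longleftrightarrow> lmodule R C \<and>
     (\<exists>j\<le>k. \<exists>X d \<eta>.
        (\<forall>i\<le>j. X i \<in> \<X>) \<and>
        X (j + 1) \<in> Mods R \<and> carrier (X (j + 1)) = {\<zero>\<^bsub>X (j + 1)\<^esub>} \<and>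
        inj_on \<eta> (carrier C) \<and>
        exact_at R C \<eta> (X 0) (d 0) (X 1) \<and>
        (\<forall>i<j. exact_at R (X i) (d i) (X (i + 1)) (d (i + 1)) (X (i + 2))))"

definition summand_closed :: "('r, 'x) ring_scheme \<Rightarrow> ('r, 'u) module set \<Rightarrow> bool" where
  "summand_closed R \<X> \<longleftrightarrow>
     (\<forall>M\<in>\<X>. \<forall>N\<in>(Mods R :: ('r, 'u) module set). \<forall>N'\<in>(Mods R :: ('r, 'u) module set).
        mod_iso R M (direct_sum N N') \<longrightarrow> N \<in> \<X>)"

definition left_cotorsion_pair ::
  "('r, 'x) ring_scheme \<Rightarrow> nat \<Rightarrow> ('r, 'u) module set \<Rightarrow> ('r, 'u) module set \<Rightarrow> bool" where
  "left_cotorsion_pair R n \<A> \<B> \<longleftrightarrow>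
     summand_closed R \<A> \<and>
     (\<forall>A\<in>\<A>. \<forall>B\<in>\<B>. \<forall>i. 1 \<le> i \<and> i \<le> n \<longrightarrow> trivial_group (Ext R i A B)) \<and>
     (\<forall>C\<in>(Mods R :: ('r, 'u) module set).
        \<exists>A\<in>\<A>. \<exists>K\<in>(Mods R :: ('r, 'u) module set). \<exists>f g.
          resolved_by R \<B> (n - 1) K \<and> short_exact R K f A g C)"

definition right_cotorsion_pair ::
  "('r, 'x) ring_scheme \<Rightarrow> nat \<Rightarrow> ('r, 'u) module set \<Rightarrow> ('r, 'u) module set \<Rightarrow> bool" where
  "right_cotorsion_pair R n \<A> \<B> \<longleftrightarrow>
     summand_closed R \<B> \<and>
     (\<forall>A\<in>\<A>. \<forall>B\<in>\<B>. \<forall>i. 1 \<le> i \<and> i \<le> n \<longrightarrow> trivial_group (Ext R i A B)) \<and>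
     (\<forall>C\<in>(Mods R :: ('r, 'u) module set).
        \<exists>B\<in>\<B>. \<exists>L\<in>(Mods R :: ('r, 'u) module set). \<exists>f g.
          coresolved_by R \<A> (n - 1) L \<and> short_exact R C f B g L)"

text \<open>The infimum of the empty set is \<open>\<infinity>\<close>.\<close>

definition Gid :: "'u itself \<Rightarrow> ('r, 'x) ring_scheme \<Rightarrow> ('r, 'c) module \<Rightarrow> enat" where
  "Gid _ R N = Inf {enat k | k. coresolved_by R (GInj_mods R :: ('r, 'u) module set) k N}"


section \<open>Pontryagin duals\<close>

definition QmodZ :: "rat set monoid" where
  "QmodZ = \<lparr>carrier = (UNIV :: rat set), mult = (+), one = 0\<rparr> Mod \<int>"

text \<open>For an \<open>R\<close>-module \<open>M\<close> this is a module over \<^term>\<open>op_ring R\<close>.\<close>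

definition dual :: "('r, 'a) module \<Rightarrow> ('r, 'a \<Rightarrow> rat set) module" where
  "dual M =
     \<lparr>carrier = hom (add_monoid M) QmodZ \<inter> extensional (carrier M),
      mult = undefined, one = undefined,
      ring.zero = (\<lambda>x\<in>carrier M. \<one>\<^bsub>QmodZ\<^esub>),
      ring.add = (\<lambda>f g. \<lambda>x\<in>carrier M. f x \<otimes>\<^bsub>QmodZ\<^esub> g x),
      smult = (\<lambda>r f. \<lambda>x\<in>carrier M. f (r \<odot>\<^bsub>M\<^esub> x))\<rparr>"

definition bidual_eval :: "('r, 'a) module \<Rightarrow> 'a \<Rightarrow> ('a \<Rightarrow> rat set) \<Rightarrow> rat set" where
  "bidual_eval N x = (\<lambda>f\<in>carrier (dual N). f x)"

definition bidual_quotient ::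
  "('r, 'a) module \<Rightarrow> ('r, (('a \<Rightarrow> rat set) \<Rightarrow> rat set) set) module" where
  "bidual_quotient N = quotient_module (dual (dual N)) (bidual_eval N ` carrier N)"

definition sup_Gid_bidual_quotient :: "'u itself \<Rightarrow> ('r, 'x) ring_scheme \<Rightarrow> enat" where
  "sup_Gid_bidual_quotient T R =
     (SUP N \<in> (Mods (op_ring R) :: ('r, 'u) module set). Gid T (op_ring R) (bidual_quotient N))"

end

theory Submission
  imports Defs
begin

text \<open>
  Write \<open>S\<close> for \<open>op_ring R\<close>. The Gorenstein injective \<open>S\<close>-modules form the largest class whose
  members \<open>M\<close> satisfy \<open>Ext\<^sup>1(E, M) = 0\<close> for all injective \<open>E\<close>, embed into an injective module with
  cokernel in the class, and are quotients of an injective module with kernel in the class. This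
  coinductive description gives closure under extensions and direct summands, and it identifies the
  duals of Gorenstein flat modules as Gorenstein injective.

  For a right module \<open>N\<close>, dualizing \<open>0 \<rightarrow> K \<rightarrow> A \<rightarrow> N\<^sup>+ \<rightarrow> 0\<close> with \<open>A\<close> Gorenstein flat and \<open>K\<close> of flat
  dimension less than \<open>n\<close> gives \<open>0 \<rightarrow> N\<^sup>+\<^sup>+ \<rightarrow> A\<^sup>+ \<rightarrow> K\<^sup>+ \<rightarrow> 0\<close> with \<open>A\<^sup>+\<close> Gorenstein injective
  and \<open>K\<^sup>+\<close> of injective dimension less than \<open>n\<close>. Hence \<open>A\<^sup>+/N\<close> is an extension of \<open>K\<^sup>+\<close> by
  \<open>N\<^sup>+\<^sup>+/N\<close>, so \<open>Gid(N) \<le> k + 1\<close> for \<open>k = max n m\<close>, and a module with this property embeds into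
  a Gorenstein injective one with cokernel of injective dimension at most \<open>k\<close>. Conversely, such
  embeddings bound \<open>Gid\<close> of every module, in particular of the \<open>N\<^sup>+\<^sup>+/N\<close>.
\<close>

section \<open>Small sets\<close>

text \<open>Two features shape the proof. \<open>Mods\<close> consists of modules with carrier in
  the fixed type \<open>'u\<close>, while quotients, duals and biduals have sets or functions as
  elements. So constructions are made up to isomorphism, exact sequences are transported to copies,
  and pullbacks and direct sums are described by elements. Moreover \<open>Ext\<close> is computed
  from one chosen projective resolution. Long exact sequences are avoided by showing directly that,
  for any projective resolution of an injective module, cocycles with Gorenstein injective values
  are coboundaries. This holds in every positive degree, so only the approximations restrict k.

  Passing from \<open>A^+/N\<close> to N costs one embedding into a Gorenstein injective module;
  this is the 1 in k + 1. The embedding with cokernel of injective dimension at most k is then a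
  dual Auslander-Buchweitz approximation, built from two pullbacks. Duality rests on Q/Z being
  injective as an abelian group: it makes dualization exact, embeds N into its bidual, and allows
  maps from E to \<open>F^+\<close> to be extended as characters of
  \<open>E \<otimes> F\<close>.\<close>

lemma lesspoll_UNIV_reflect:
  fixes A :: "'a set"
  assumes "A \<prec> (UNIV :: 'u set)"
  obtains B :: "'u set" where "A \<approx> B" "B \<prec> (UNIV :: 'u set)"
proof -
  from assms obtain f :: "'a \<Rightarrow> 'u" where f: "inj_on f A"
    unfolding lesspoll_def lepoll_def by blast
  then have "A \<approx> f ` A"
    by (simp add: eqpoll_sym inj_on_image_eqpoll_self)
  with that assms show thesis
    by (meson eq_lesspoll_trans eqpoll_sym)
qed

text \<open>\<open>universe_type\<close> speaks only of subsets of \<open>'u\<close> itself, so a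
  small set of another type is first replaced by an equipollent subset of \<open>'u\<close>.\<close>

lemma small_Pow:
  fixes A :: "'a set"
  assumes U: "universe_type TYPE('u)" and A: "A \<prec> (UNIV :: 'u set)"
  shows "Pow A \<prec> (UNIV :: 'u set)"
proof -
  from A obtain B :: "'u set" where B: "A \<approx> B" "B \<prec> (UNIV :: 'u set)"
    by (rule lesspoll_UNIV_reflect)
  from B(1) obtain f where f: "bij_betw f A B"
    unfolding eqpoll_def by blast
  then have "bij_betw (image f) (Pow A) (Pow B)"
    by (rule bij_betw_Pow)
  then have "Pow A \<approx> Pow B"
    unfolding eqpoll_def by blast
  with B(2) U show ?thesis
    unfolding universe_type_def by (meson eq_lesspoll_trans)
qed

text \<open>Products are not among the closure conditions of \<open>universe_type\<close>. Unless
  both factors are finite, the larger one C is infinite, and then C x C is equipollent to C.\<close>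

lemma small_Times:
  fixes A :: "'a set" and B :: "'b set"
  assumes U: "universe_type TYPE('u)"
    and A: "A \<prec> (UNIV :: 'u set)" and B: "B \<prec> (UNIV :: 'u set)"
  shows "A \<times> B \<prec> (UNIV :: 'u set)"
proof (cases "finite A \<and> finite B")
  case True
  have "infinite (UNIV :: 'u set)"
    using U unfolding universe_type_def
    by (metis infinite_le_lepoll lesspoll_imp_lepoll)
  then show ?thesis using True
    by (simp add: finite_lesspoll_infinite)
next
  case False
  from A obtain A' :: "'u set" where A': "A \<approx> A'" "A' \<prec> (UNIV :: 'u set)"
    by (rule lesspoll_UNIV_reflect)
  from B obtain B' :: "'u set" where B': "B \<approx> B'" "B' \<prec> (UNIV :: 'u set)"
    by (rule lesspoll_UNIV_reflect)
  have "A' \<lesssim> B' \<or> B' \<lesssim> A'"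
    unfolding lepoll_def card_of_ordLeq by (intro ordLeq_total card_of_Well_order)
  then have "\<exists>C :: 'u set. A \<lesssim> C \<and> B \<lesssim> C \<and> C \<prec> (UNIV :: 'u set)"
    using A' B' by (meson eqpoll_imp_lepoll lepoll_trans)
  then obtain C :: "'u set" where C: "A \<lesssim> C" "B \<lesssim> C" "C \<prec> (UNIV :: 'u set)"
    by blast
  have "infinite C"
    using C False by (meson finite_surj lepoll_iff)
  then have "C \<times> C \<approx> C"
    by (simp add: card_of_Times_same_infinite eqpoll_iff_card_of_ordIso)
  moreover have "A \<times> B \<lesssim> C \<times> C"
    using C by (intro times_lepoll_mono)
  ultimately show ?thesis
    using C(3) by (meson lepoll_trans2 lesspoll_trans1)
qed

text \<open>Functions inject into the power set of A x B by their graphs. This bounds the size of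
  dual modules and of free modules.\<close>

lemma small_PiE:
  fixes A :: "'a set" and B :: "'b set"
  assumes U: "universe_type TYPE('u)"
    and A: "A \<prec> (UNIV :: 'u set)" and B: "B \<prec> (UNIV :: 'u set)"
  shows "(A \<rightarrow>\<^sub>E B) \<prec> (UNIV :: 'u set)"
proof -
  have "inj_on (\<lambda>f. {(x, f x) | x. x \<in> A}) (A \<rightarrow>\<^sub>E B)"
  proof (rule inj_onI)
    fix f g
    assume fg: "f \<in> A \<rightarrow>\<^sub>E B" "g \<in> A \<rightarrow>\<^sub>E B" "{(x, f x) | x. x \<in> A} = {(x, g x) | x. x \<in> A}"
    have "f x = g x" if "x \<in> A" for x
      using fg(3) that by blast
    with fg show "f = g" by (meson PiE_ext)
  qed
  moreover have "(\<lambda>f. {(x, f x) | x. x \<in> A}) ` (A \<rightarrow>\<^sub>E B) \<subseteq> Pow (A \<times> B)"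
    by auto
  ultimately have "(A \<rightarrow>\<^sub>E B) \<lesssim> Pow (A \<times> B)"
    unfolding lepoll_def by blast
  with small_Pow[OF U small_Times[OF U A B]] show ?thesis
    by (rule lesspoll_trans1[rotated])
qed

lemma small_nat: "universe_type TYPE('u) \<Longrightarrow> (UNIV :: nat set) \<prec> (UNIV :: 'u set)"
  by (simp add: universe_type_def)

lemma small_countable:
  assumes "universe_type TYPE('u)" "countable A"
  shows "A \<prec> (UNIV :: 'u set)"
proof -
  from assms(2) have "A \<lesssim> (UNIV :: nat set)"
    unfolding countable_def lepoll_def by blast
  with small_nat[OF assms(1)] show ?thesis
    by (rule lesspoll_trans1[rotated])
qed


section \<open>Modules and homomorphisms\<close>

lemma lmoduleI:
  assumes "ring R" "abelian_group M"
    and "\<And>a x. \<lbrakk>a \<in> carrier R; x \<in> carrier M\<rbrakk> \<Longrightarrow> a \<odot>\<^bsub>M\<^esub> x \<in> carrier M"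
    and "\<And>a b x. \<lbrakk>a \<in> carrier R; b \<in> carrier R; x \<in> carrier M\<rbrakk> \<Longrightarrow>
        (a \<oplus>\<^bsub>R\<^esub> b) \<odot>\<^bsub>M\<^esub> x = a \<odot>\<^bsub>M\<^esub> x \<oplus>\<^bsub>M\<^esub> b \<odot>\<^bsub>M\<^esub> x"
    and "\<And>a x y. \<lbrakk>a \<in> carrier R; x \<in> carrier M; y \<in> carrier M\<rbrakk> \<Longrightarrow>
        a \<odot>\<^bsub>M\<^esub> (x \<oplus>\<^bsub>M\<^esub> y) = a \<odot>\<^bsub>M\<^esub> x \<oplus>\<^bsub>M\<^esub> a \<odot>\<^bsub>M\<^esub> y"
    and "\<And>a b x. \<lbrakk>a \<in> carrier R; b \<in> carrier R; x \<in> carrier M\<rbrakk> \<Longrightarrow>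
        (a \<otimes>\<^bsub>R\<^esub> b) \<odot>\<^bsub>M\<^esub> x = a \<odot>\<^bsub>M\<^esub> (b \<odot>\<^bsub>M\<^esub> x)"
    and "\<And>x. x \<in> carrier M \<Longrightarrow> \<one>\<^bsub>R\<^esub> \<odot>\<^bsub>M\<^esub> x = x"
  shows "lmodule R M"
  using assms by (simp add: lmodule_def lmodule_axioms_def)

lemma lmodule_abelian_group: "lmodule R M \<Longrightarrow> abelian_group M"
  by (simp add: lmodule_def)

lemma (in lmodule) smult_zero [simp]:
  assumes "a \<in> carrier R" shows "a \<odot>\<^bsub>M\<^esub> \<zero>\<^bsub>M\<^esub> = \<zero>\<^bsub>M\<^esub>"
proof -
  have "a \<odot>\<^bsub>M\<^esub> \<zero>\<^bsub>M\<^esub> \<oplus>\<^bsub>M\<^esub> a \<odot>\<^bsub>M\<^esub> \<zero>\<^bsub>M\<^esub> = a \<odot>\<^bsub>M\<^esub> \<zero>\<^bsub>M\<^esub>"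
    using smult_r_distr[OF assms M.zero_closed M.zero_closed] by simp
  then show ?thesis
    using assms smult_closed M.add.r_cancel_one by blast
qed

lemma (in lmodule) smult_lzero [simp]:
  assumes "x \<in> carrier M" shows "\<zero>\<^bsub>R\<^esub> \<odot>\<^bsub>M\<^esub> x = \<zero>\<^bsub>M\<^esub>"
proof -
  have "\<zero>\<^bsub>R\<^esub> \<odot>\<^bsub>M\<^esub> x \<oplus>\<^bsub>M\<^esub> \<zero>\<^bsub>R\<^esub> \<odot>\<^bsub>M\<^esub> x = \<zero>\<^bsub>R\<^esub> \<odot>\<^bsub>M\<^esub> x"
    using smult_l_distr[OF R.zero_closed R.zero_closed assms] by simp
  then show ?thesis
    using assms smult_closed M.add.r_cancel_one R.zero_closed by blast
qed

lemma (in lmodule) smult_minus: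
  assumes "a \<in> carrier R" "x \<in> carrier M"
  shows "a \<odot>\<^bsub>M\<^esub> (\<ominus>\<^bsub>M\<^esub> x) = \<ominus>\<^bsub>M\<^esub> (a \<odot>\<^bsub>M\<^esub> x)"
proof -
  have "a \<odot>\<^bsub>M\<^esub> (\<ominus>\<^bsub>M\<^esub> x) \<oplus>\<^bsub>M\<^esub> a \<odot>\<^bsub>M\<^esub> x = \<zero>\<^bsub>M\<^esub>"
    using assms by (simp flip: smult_r_distr add: M.l_neg)
  then show ?thesis
    using assms M.minus_equality smult_closed by (metis M.a_inv_closed)
qed

text \<open>Negation as a scalar action: a subset closed under scalars is then closed under
  negation.\<close>

lemma (in lmodule) smult_minus_one:
  assumes "x \<in> carrier M"
  shows "(\<ominus>\<^bsub>R\<^esub> \<one>\<^bsub>R\<^esub>) \<odot>\<^bsub>M\<^esub> x = \<ominus>\<^bsub>M\<^esub> x"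
proof -
  have "(\<ominus>\<^bsub>R\<^esub> \<one>\<^bsub>R\<^esub>) \<odot>\<^bsub>M\<^esub> x \<oplus>\<^bsub>M\<^esub> \<one>\<^bsub>R\<^esub> \<odot>\<^bsub>M\<^esub> x = \<zero>\<^bsub>M\<^esub>"
    using assms by (simp flip: smult_l_distr add: R.l_neg)
  then show ?thesis
    using assms M.minus_equality smult_closed smult_one by (metis R.a_inv_closed R.one_closed)
qed

lemma mod_homI:
  assumes "\<And>x. x \<in> carrier M \<Longrightarrow> f x \<in> carrier N"
    and "\<And>x y. \<lbrakk>x \<in> carrier M; y \<in> carrier M\<rbrakk> \<Longrightarrow> f (x \<oplus>\<^bsub>M\<^esub> y) = f x \<oplus>\<^bsub>N\<^esub> f y"
    and "\<And>r x. \<lbrakk>r \<in> carrier R; x \<in> carrier M\<rbrakk> \<Longrightarrow> f (r \<odot>\<^bsub>M\<^esub> x) = r \<odot>\<^bsub>N\<^esub> f x"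
  shows "f \<in> mod_hom R M N"
  using assms by (auto simp: mod_hom_def)

lemma mod_hom_closed: "\<lbrakk>f \<in> mod_hom R M N; x \<in> carrier M\<rbrakk> \<Longrightarrow> f x \<in> carrier N"
  and mod_hom_add: "\<lbrakk>f \<in> mod_hom R M N; x \<in> carrier M; y \<in> carrier M\<rbrakk> \<Longrightarrow>
        f (x \<oplus>\<^bsub>M\<^esub> y) = f x \<oplus>\<^bsub>N\<^esub> f y"
  and mod_hom_smult: "\<lbrakk>f \<in> mod_hom R M N; r \<in> carrier R; x \<in> carrier M\<rbrakk> \<Longrightarrow>
        f (r \<odot>\<^bsub>M\<^esub> x) = r \<odot>\<^bsub>N\<^esub> f x"
  by (auto simp: mod_hom_def)

lemma mod_hom_group_hom:
  assumes "abelian_group M" "abelian_group N" "f \<in> mod_hom R M N"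
  shows "group_hom (add_monoid M) (add_monoid N) f"
  using assms
  by (simp add: group_hom_def group_hom_axioms_def abelian_group.a_group hom_def mod_hom_def)

lemma mod_hom_zero:
  assumes "abelian_group M" "abelian_group N" "f \<in> mod_hom R M N"
  shows "f \<zero>\<^bsub>M\<^esub> = \<zero>\<^bsub>N\<^esub>"
  using group_hom.hom_one[OF mod_hom_group_hom[OF assms]] by simp

lemma mod_hom_a_inv:
  assumes "abelian_group M" "abelian_group N" "f \<in> mod_hom R M N" "x \<in> carrier M"
  shows "f (\<ominus>\<^bsub>M\<^esub> x) = \<ominus>\<^bsub>N\<^esub> f x"
  using group_hom.hom_inv[OF mod_hom_group_hom[OF assms(1-3)]] assms(4)
  by (simp add: a_inv_def)

lemma mod_hom_minus:
  assumes "abelian_group M" "abelian_group N" "f \<in> mod_hom R M N" "x \<in> carrier M" "y \<in> carrier M"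
  shows "f (x \<ominus>\<^bsub>M\<^esub> y) = f x \<ominus>\<^bsub>N\<^esub> f y"
  using assms
  by (simp add: a_minus_def mod_hom_add[OF assms(3)] mod_hom_a_inv abelian_group.a_inv_closed)

lemma mod_hom_comp:
  assumes "f \<in> mod_hom R A B" "g \<in> mod_hom R B C"
  shows "(\<lambda>x. g (f x)) \<in> mod_hom R A C"
  using assms by (auto intro!: mod_homI simp: mod_hom_closed mod_hom_add mod_hom_smult)

lemma mod_hom_id: "(\<lambda>x. x) \<in> mod_hom R A A"
  by (auto simp: mod_hom_def)

lemma mod_hom_const_zero:
  assumes "lmodule R B"
  shows "(\<lambda>x. \<zero>\<^bsub>B\<^esub>) \<in> mod_hom R A B"
proof -
  interpret B: lmodule R B by fact
  show ?thesis by (auto intro!: mod_homI)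
qed

lemma mod_hom_diff:
  assumes "lmodule R B" "f \<in> mod_hom R A B" "g \<in> mod_hom R A B"
  shows "(\<lambda>x. f x \<ominus>\<^bsub>B\<^esub> g x) \<in> mod_hom R A B"
proof -
  interpret B: lmodule R B by fact
  show ?thesis using assms(2,3)
    by (auto intro!: mod_homI
        simp: mod_hom_closed mod_hom_add mod_hom_smult a_minus_def B.smult_r_distr B.smult_minus
          B.M.minus_add B.M.a_ac)
qed

lemma mod_hom_plus:
  assumes "lmodule R B" "f \<in> mod_hom R A B" "g \<in> mod_hom R A B"
  shows "(\<lambda>x. f x \<oplus>\<^bsub>B\<^esub> g x) \<in> mod_hom R A B"
proof -
  interpret B: lmodule R B by fact
  show ?thesis using assms(2,3)
    by (auto intro!: mod_homI
        simp: mod_hom_closed mod_hom_add mod_hom_smult B.smult_r_distr B.M.a_ac)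
qed

text \<open>Many homomorphisms below are determined by a condition on x and its image rather than by
  a formula. Uniqueness of the image makes any pointwise choice additive and linear.\<close>

lemma mod_hom_from_rel:
  assumes "\<And>x. x \<in> carrier A \<Longrightarrow> \<exists>y\<in>carrier B. P x y"
    and "\<And>x y y'. \<lbrakk>x \<in> carrier A; y \<in> carrier B; y' \<in> carrier B; P x y; P x y'\<rbrakk> \<Longrightarrow> y = y'"
    and "\<And>x x' y y'. \<lbrakk>x \<in> carrier A; x' \<in> carrier A; y \<in> carrier B; y' \<in> carrier B; P x y; P x' y'\<rbrakk>
          \<Longrightarrow> P (x \<oplus>\<^bsub>A\<^esub> x') (y \<oplus>\<^bsub>B\<^esub> y')"
    and "\<And>r x y. \<lbrakk>r \<in> carrier R; x \<in> carrier A; y \<in> carrier B; P x y\<rbrakk>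
          \<Longrightarrow> P (r \<odot>\<^bsub>A\<^esub> x) (r \<odot>\<^bsub>B\<^esub> y)"
    and A: "lmodule R A" and B: "lmodule R B"
  shows "\<exists>h\<in>mod_hom R A B. \<forall>x\<in>carrier A. P x (h x)"
proof -
  interpret A: lmodule R A by fact
  interpret B: lmodule R B by fact
  obtain h where h: "\<And>x. x \<in> carrier A \<Longrightarrow> h x \<in> carrier B \<and> P x (h x)"
    using assms(1) by metis
  have "h \<in> mod_hom R A B"
  proof (rule mod_homI)
    show "h (x \<oplus>\<^bsub>A\<^esub> y) = h x \<oplus>\<^bsub>B\<^esub> h y" if "x \<in> carrier A" "y \<in> carrier A" for x y
      using that h assms(2,3) by (meson A.M.add.m_closed B.M.add.m_closed)
    show "h (r \<odot>\<^bsub>A\<^esub> x) = r \<odot>\<^bsub>B\<^esub> h x" if "r \<in> carrier R" "x \<in> carrier A" for r x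
      using that h assms(2,4) by (meson A.smult_closed B.smult_closed)
  qed (use h in auto)
  with h show ?thesis by auto
qed

subsection \<open>Isomorphic copies, submodules and quotients\<close>

text \<open>The module axioms are equations together with the existence of inverses, and all of them
  pass to the image of a map that respects the operations. Copies and quotients obtain their module
  structure in this way.\<close>

lemma lmodule_surj_image:
  assumes M: "lmodule R M" and f: "f ` carrier M = carrier N"
    and add: "\<And>x y. \<lbrakk>x \<in> carrier M; y \<in> carrier M\<rbrakk> \<Longrightarrow> f (x \<oplus>\<^bsub>M\<^esub> y) = f x \<oplus>\<^bsub>N\<^esub> f y"
    and zero: "f \<zero>\<^bsub>M\<^esub> = \<zero>\<^bsub>N\<^esub>"
    and smult: "\<And>r x. \<lbrakk>r \<in> carrier R; x \<in> carrier M\<rbrakk> \<Longrightarrow> f (r \<odot>\<^bsub>M\<^esub> x) = r \<odot>\<^bsub>N\<^esub> f x"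
  shows "lmodule R N"
proof -
  interpret M: lmodule R M by fact
  have N: "carrier N = f ` carrier M"
    using f by simp
  have "abelian_group N"
  proof (rule abelian_groupI)
    show "\<exists>y\<in>carrier N. y \<oplus>\<^bsub>N\<^esub> x = \<zero>\<^bsub>N\<^esub>" if "x \<in> carrier N" for x
    proof -
      from that obtain a where a: "a \<in> carrier M" "x = f a" using N by auto
      then have "f (\<ominus>\<^bsub>M\<^esub> a) \<oplus>\<^bsub>N\<^esub> x = \<zero>\<^bsub>N\<^esub>"
        by (simp flip: add zero add: M.M.l_neg)
      with a N show ?thesis by blast
    qed
  qed (auto simp: N add[symmetric] zero[symmetric] M.M.a_ac)
  then show ?thesis
    by (rule lmoduleI[OF M.R.ring_axioms])
      (auto simp: N add[symmetric] smult[symmetric] M.smult_closed M.smult_l_distr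
        M.smult_r_distr M.smult_assoc1 M.smult_one)
qed

lemma mod_iso_sym:
  assumes "lmodule R M" "mod_iso R M N"
  shows "mod_iso R N M"
proof -
  interpret M: lmodule R M by fact
  obtain f where f: "f \<in> mod_hom R M N" "bij_betw f (carrier M) (carrier N)"
    using assms(2) by (auto simp: mod_iso_def)
  let ?g = "inv_into (carrier M) f"
  have gf: "?g (f x) = x" if "x \<in> carrier M" for x
    using f(2) that by (simp add: bij_betw_def)
  have N: "carrier N = f ` carrier M"
    using f by (simp add: bij_betw_def)
  have "?g \<in> mod_hom R N M"
    by (rule mod_homI) (auto simp: N gf M.smult_closed
        mod_hom_add[OF f(1), symmetric] mod_hom_smult[OF f(1), symmetric])
  moreover have "bij_betw ?g (carrier N) (carrier M)"
    using f(2) by (rule bij_betw_inv_into)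
  ultimately show ?thesis by (auto simp: mod_iso_def)
qed

text \<open>Transport of structure along an injection of the carrier into \<open>'u\<close>. It
  brings duals, quotients, pullbacks and free modules back into \<open>Mods R\<close>.\<close>

lemma ex_small_copy:
  fixes M :: "('r, 'a) module"
  assumes M: "lmodule R M" and sm: "carrier M \<prec> (UNIV :: 'u set)"
  shows "\<exists>N\<in>(Mods R :: ('r, 'u) module set). mod_iso R M N"
proof -
  interpret M: lmodule R M by fact
  from sm obtain f :: "'a \<Rightarrow> 'u" where f: "inj_on f (carrier M)"
    unfolding lesspoll_def lepoll_def by blast
  let ?g = "inv_into (carrier M) f"
  define N :: "('r, 'u) module" where "N =
    \<lparr>carrier = f ` carrier M, mult = undefined, one = undefined,
      ring.zero = f \<zero>\<^bsub>M\<^esub>, ring.add = (\<lambda>x y. f (?g x \<oplus>\<^bsub>M\<^esub> ?g y)),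
      smult = (\<lambda>r x. f (r \<odot>\<^bsub>M\<^esub> ?g x))\<rparr>"
  have bij: "bij_betw f (carrier M) (carrier N)"
    using f by (simp add: N_def bij_betw_def)
  have "lmodule R N"
    by (rule lmodule_surj_image[OF M]) (auto simp: N_def f)
  moreover have "carrier N \<prec> (UNIV :: 'u set)"
    using sm f by (simp add: N_def)
  moreover have "f \<in> mod_hom R M N"
    by (rule mod_homI) (auto simp: N_def f)
  ultimately show ?thesis using bij
    by (auto simp: Mods_def mod_iso_def)
qed

lemma lmodule_submodule:
  assumes M: "lmodule R M" and K: "K \<subseteq> carrier M" "\<zero>\<^bsub>M\<^esub> \<in> K"
    and add: "\<And>x y. \<lbrakk>x \<in> K; y \<in> K\<rbrakk> \<Longrightarrow> x \<oplus>\<^bsub>M\<^esub> y \<in> K"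
    and smult: "\<And>r x. \<lbrakk>r \<in> carrier R; x \<in> K\<rbrakk> \<Longrightarrow> r \<odot>\<^bsub>M\<^esub> x \<in> K"
  shows "lmodule R (M\<lparr>carrier := K\<rparr>)"
proof -
  interpret M: lmodule R M by fact
  have [simp]: "x \<in> carrier M" if "x \<in> K" for x using that K by auto
  have "abelian_group (M\<lparr>carrier := K\<rparr>)"
  proof (rule abelian_groupI)
    fix x assume "x \<in> carrier (M\<lparr>carrier := K\<rparr>)"
    then have x: "x \<in> K" by simp
    then have "(\<ominus>\<^bsub>R\<^esub> \<one>\<^bsub>R\<^esub>) \<odot>\<^bsub>M\<^esub> x \<in> K" by (simp add: smult)
    with x have "\<ominus>\<^bsub>M\<^esub> x \<in> K" by (simp add: M.smult_minus_one)
    with x show "\<exists>y\<in>carrier (M\<lparr>carrier := K\<rparr>). y \<oplus>\<^bsub>M\<lparr>carrier := K\<rparr>\<^esub> x = \<zero>\<^bsub>M\<lparr>carrier := K\<rparr>\<^esub>"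
      by (intro bexI[of _ "\<ominus>\<^bsub>M\<^esub> x"]) (simp_all add: M.M.l_neg)
  qed (simp_all add: add K M.M.a_ac)
  then show ?thesis
    by (rule lmoduleI[OF M.R.ring_axioms])
      (simp_all add: smult M.smult_l_distr M.smult_r_distr M.smult_assoc1 M.smult_one)
qed

lemma a_kernel_iff: "x \<in> a_kernel A B f \<longleftrightarrow> x \<in> carrier A \<and> f x = \<zero>\<^bsub>B\<^esub>"
  by (simp add: a_kernel_def kernel_def)

lemma lmodule_kernel:
  assumes A: "lmodule R A" and B: "lmodule R B" and f: "f \<in> mod_hom R A B"
  shows "lmodule R (A\<lparr>carrier := a_kernel A B f\<rparr>)"
proof -
  interpret A: lmodule R A by fact
  interpret B: lmodule R B by fact
  have [simp]: "f \<zero>\<^bsub>A\<^esub> = \<zero>\<^bsub>B\<^esub>"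
    using mod_hom_zero[OF A.M.abelian_group_axioms B.M.abelian_group_axioms f] .
  show ?thesis
    by (rule lmodule_submodule[OF A])
      (auto simp: a_kernel_iff mod_hom_add[OF f] mod_hom_smult[OF f] A.smult_closed)
qed

lemma lmodule_image:
  assumes A: "lmodule R A" and B: "lmodule R B" and f: "f \<in> mod_hom R A B"
  shows "lmodule R (B\<lparr>carrier := f ` carrier A\<rparr>)"
proof -
  interpret A: lmodule R A by fact
  interpret B: lmodule R B by fact
  have "\<zero>\<^bsub>B\<^esub> \<in> f ` carrier A"
    using mod_hom_zero[OF A.M.abelian_group_axioms B.M.abelian_group_axioms f]
    by (metis A.M.zero_closed imageI)
  then show ?thesis
    by (intro lmodule_submodule[OF B])
      (auto simp: mod_hom_closed[OF f] mod_hom_add[OF f, symmetric] mod_hom_smult[OF f, symmetric]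
        A.smult_closed)
qed

lemma lmodule_direct_sum:
  assumes A: "lmodule R A" and B: "lmodule R B"
  shows "lmodule R (direct_sum A B)"
proof -
  interpret A: lmodule R A by fact
  interpret B: lmodule R B by fact
  have "abelian_group (direct_sum A B)"
  proof (rule abelian_groupI)
    fix x assume "x \<in> carrier (direct_sum A B)"
    then show "\<exists>y\<in>carrier (direct_sum A B). y \<oplus>\<^bsub>direct_sum A B\<^esub> x = \<zero>\<^bsub>direct_sum A B\<^esub>"
      by (intro bexI[of _ "(\<ominus>\<^bsub>A\<^esub> fst x, \<ominus>\<^bsub>B\<^esub> snd x)"])
        (auto simp: direct_sum_def A.M.l_neg B.M.l_neg)
  qed (auto simp: direct_sum_def A.M.a_ac B.M.a_ac)
  then show ?thesis
    by (rule lmoduleI[OF A.R.ring_axioms])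
      (auto simp: direct_sum_def A.smult_closed A.smult_l_distr A.smult_r_distr A.smult_assoc1
        A.smult_one B.smult_closed B.smult_l_distr B.smult_r_distr B.smult_assoc1 B.smult_one)
qed

lemma lmodule_quotient:
  assumes M: "lmodule R M" and KM: "K \<subseteq> carrier M" and K: "lmodule R (M\<lparr>carrier := K\<rparr>)"
  shows "lmodule R (quotient_module M K)" (is ?L)
    and "(\<lambda>x. K +>\<^bsub>M\<^esub> x) \<in> mod_hom R M (quotient_module M K)" (is ?H)
    and "(\<lambda>x. K +>\<^bsub>M\<^esub> x) ` carrier M = carrier (quotient_module M K)" (is ?S)
    and "a_kernel M (quotient_module M K) (\<lambda>x. K +>\<^bsub>M\<^esub> x) = K" (is ?K)
proof -
  interpret M: lmodule R M by fact
  interpret K: lmodule R "M\<lparr>carrier := K\<rparr>" by fact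
  have zK: "\<zero>\<^bsub>M\<^esub> \<in> K"
    using K.M.zero_closed by simp
  have addK: "x \<oplus>\<^bsub>M\<^esub> y \<in> K" if "x \<in> K" "y \<in> K" for x y
    using K.M.a_closed that by simp
  have smK: "r \<odot>\<^bsub>M\<^esub> x \<in> K" if "x \<in> K" "r \<in> carrier R" for r x
    using K.smult_closed that by simp
  have negK: "\<ominus>\<^bsub>M\<^esub> x \<in> K" if "x \<in> K" for x
    using smK[OF that, of "\<ominus>\<^bsub>R\<^esub> \<one>\<^bsub>R\<^esub>"] that KM by (auto simp: M.smult_minus_one)
  interpret K': abelian_subgroup K M
  proof (rule abelian_subgroupI3)
    show "additive_subgroup K M"
      using KM zK addK negK
      by (intro additive_subgroupI subgroup.intro) (auto simp flip: a_inv_def)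
  qed (rule M.M.abelian_group_axioms)
  \<comment> \<open>The elementwise multiple of a coset may be smaller than a coset; the summand K
    in \<open>quotient_module\<close> fills it up.\<close>
  have sm: "K <+>\<^bsub>M\<^esub> ((\<lambda>x. r \<odot>\<^bsub>M\<^esub> x) ` (K +>\<^bsub>M\<^esub> x)) = K +>\<^bsub>M\<^esub> (r \<odot>\<^bsub>M\<^esub> x)"
    if rx: "r \<in> carrier R" "x \<in> carrier M" for r x
  proof (intro equalityI subsetI)
    fix y assume "y \<in> K <+>\<^bsub>M\<^esub> ((\<lambda>x. r \<odot>\<^bsub>M\<^esub> x) ` (K +>\<^bsub>M\<^esub> x))"
    then obtain k k' where k: "k \<in> K" "k' \<in> K" "y = k \<oplus>\<^bsub>M\<^esub> r \<odot>\<^bsub>M\<^esub> (k' \<oplus>\<^bsub>M\<^esub> x)"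
      by (auto simp: set_add_def' a_r_coset_def')
    then have "y = (k \<oplus>\<^bsub>M\<^esub> r \<odot>\<^bsub>M\<^esub> k') \<oplus>\<^bsub>M\<^esub> r \<odot>\<^bsub>M\<^esub> x"
      using rx KM by (simp add: subset_iff M.smult_r_distr M.smult_closed M.M.a_assoc)
    then show "y \<in> K +>\<^bsub>M\<^esub> (r \<odot>\<^bsub>M\<^esub> x)"
      using k rx by (auto simp: a_r_coset_def' intro!: addK smK)
  next
    fix y assume "y \<in> K +>\<^bsub>M\<^esub> (r \<odot>\<^bsub>M\<^esub> x)"
    then obtain k where "k \<in> K" "y = k \<oplus>\<^bsub>M\<^esub> r \<odot>\<^bsub>M\<^esub> (\<zero>\<^bsub>M\<^esub> \<oplus>\<^bsub>M\<^esub> x)"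
      using rx by (auto simp: a_r_coset_def')
    then show "y \<in> K <+>\<^bsub>M\<^esub> ((\<lambda>x. r \<odot>\<^bsub>M\<^esub> x) ` (K +>\<^bsub>M\<^esub> x))"
      using zK unfolding set_add_def' a_r_coset_def' by blast
  qed
  show S: ?S
    by (auto simp: quotient_module_def A_RCOSETS_def')
  show ?L
    by (rule lmodule_surj_image[OF M S])
      (auto simp: quotient_module_def K'.a_rcos_sum sm K'.a_rcos_const zK)
  show ?H
    using S by (intro mod_homI) (auto simp: quotient_module_def K'.a_rcos_sum sm)
  show ?K
    using KM by (auto simp: a_kernel_iff quotient_module_def K'.a_rcos_const intro: K'.a_rcos_self)
      (metis K'.a_rcos_self)
qed

section \<open>Exact sequences\<close>

lemma (in abelian_group) minus_eq_zero_iff: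
  assumes "x \<in> carrier G" "y \<in> carrier G"
  shows "x \<ominus> y = \<zero> \<longleftrightarrow> x = y"
proof
  assume "x \<ominus> y = \<zero>"
  then have "\<ominus> (\<ominus> y) = x"
    using assms by (intro minus_equality) (auto simp: a_minus_def)
  with assms show "x = y" by simp
qed (use assms in \<open>simp add: a_minus_def r_neg\<close>)

lemma mod_hom_inj_onI:
  assumes "lmodule R A" "lmodule R B" "f \<in> mod_hom R A B"
    and "\<And>x. \<lbrakk>x \<in> carrier A; f x = \<zero>\<^bsub>B\<^esub>\<rbrakk> \<Longrightarrow> x = \<zero>\<^bsub>A\<^esub>"
  shows "inj_on f (carrier A)"
proof -
  interpret A: lmodule R A by fact
  interpret B: lmodule R B by fact
  show ?thesis
  proof (rule inj_onI)
    fix x y assume xy: "x \<in> carrier A" "y \<in> carrier A" "f x = f y"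
    then have "f (x \<ominus>\<^bsub>A\<^esub> y) = \<zero>\<^bsub>B\<^esub>"
      using mod_hom_minus[OF A.M.abelian_group_axioms B.M.abelian_group_axioms assms(3)]
        mod_hom_closed[OF assms(3)] by (simp add: B.M.r_neg a_minus_def)
    with assms(4) xy have "x \<ominus>\<^bsub>A\<^esub> y = \<zero>\<^bsub>A\<^esub>"
      by simp
    with xy show "x = y"
      by (simp add: A.M.minus_eq_zero_iff)
  qed
qed

lemma short_exactI:
  assumes "f \<in> mod_hom R A B" "g \<in> mod_hom R B C"
    and "inj_on f (carrier A)"
    and "\<And>x. x \<in> carrier A \<Longrightarrow> g (f x) = \<zero>\<^bsub>C\<^esub>"
    and "\<And>y. \<lbrakk>y \<in> carrier B; g y = \<zero>\<^bsub>C\<^esub>\<rbrakk> \<Longrightarrow> \<exists>x\<in>carrier A. y = f x"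
    and "\<And>z. z \<in> carrier C \<Longrightarrow> \<exists>y\<in>carrier B. z = g y"
  shows "short_exact R A f B g C"
  using assms unfolding short_exact_def exact_at_def
  by (auto simp: a_kernel_iff mod_hom_closed image_iff)

lemma short_exactD:
  assumes "short_exact R A f B g C"
  shows "f \<in> mod_hom R A B" "g \<in> mod_hom R B C" "inj_on f (carrier A)"
    and "\<And>x. x \<in> carrier A \<Longrightarrow> g (f x) = \<zero>\<^bsub>C\<^esub>"
    and "\<And>y. \<lbrakk>y \<in> carrier B; g y = \<zero>\<^bsub>C\<^esub>\<rbrakk> \<Longrightarrow> \<exists>x\<in>carrier A. y = f x"
    and "\<And>z. z \<in> carrier C \<Longrightarrow> \<exists>y\<in>carrier B. z = g y"
proof -
  note * = assms[unfolded short_exact_def exact_at_def]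
  show "f \<in> mod_hom R A B" "g \<in> mod_hom R B C" "inj_on f (carrier A)"
    using * by auto
  have im: "f ` carrier A = a_kernel B C g"
    using * by blast
  show "g (f x) = \<zero>\<^bsub>C\<^esub>" if "x \<in> carrier A" for x
  proof -
    have "f x \<in> a_kernel B C g" using that im by blast
    then show ?thesis by (simp add: a_kernel_iff)
  qed
  show "\<exists>x\<in>carrier A. y = f x" if "y \<in> carrier B" "g y = \<zero>\<^bsub>C\<^esub>" for y
  proof -
    have "y \<in> a_kernel B C g" using that by (simp add: a_kernel_iff)
    then show ?thesis using im by blast
  qed
  show "\<exists>y\<in>carrier B. z = g y" if "z \<in> carrier C" for z
    using * that by blast
qed

text \<open>Universal property of a cokernel: two preimages under g differ by an element of its
  kernel, so \<phi> does not see the choice.\<close>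

lemma factor_epi:
  assumes X: "lmodule R X" and Y: "lmodule R Y" and Z: "lmodule R Z"
    and g: "g \<in> mod_hom R X Y" and onto: "\<And>y. y \<in> carrier Y \<Longrightarrow> \<exists>x\<in>carrier X. y = g x"
    and \<phi>: "\<phi> \<in> mod_hom R X Z" and ker: "\<And>x. \<lbrakk>x \<in> carrier X; g x = \<zero>\<^bsub>Y\<^esub>\<rbrakk> \<Longrightarrow> \<phi> x = \<zero>\<^bsub>Z\<^esub>"
  shows "\<exists>\<psi>\<in>mod_hom R Y Z. \<forall>x\<in>carrier X. \<psi> (g x) = \<phi> x"
proof -
  interpret X: lmodule R X by fact
  interpret Y: lmodule R Y by fact
  interpret Z: lmodule R Z by fact
  have uniq: "\<phi> x = \<phi> x'" if "x \<in> carrier X" "x' \<in> carrier X" "g x = g x'" for x x'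
  proof -
    have "g (x \<ominus>\<^bsub>X\<^esub> x') = \<zero>\<^bsub>Y\<^esub>"
      using that mod_hom_minus[OF X.M.abelian_group_axioms Y.M.abelian_group_axioms g]
        mod_hom_closed[OF g] by (simp add: Y.M.r_neg a_minus_def)
    then have "\<phi> (x \<ominus>\<^bsub>X\<^esub> x') = \<zero>\<^bsub>Z\<^esub>"
      using that ker by simp
    then have "\<phi> x \<ominus>\<^bsub>Z\<^esub> \<phi> x' = \<zero>\<^bsub>Z\<^esub>"
      using that mod_hom_minus[OF X.M.abelian_group_axioms Z.M.abelian_group_axioms \<phi>] by simp
    then show ?thesis
      using that mod_hom_closed[OF \<phi>] by (simp add: Z.M.minus_eq_zero_iff)
  qed
  have "\<exists>h\<in>mod_hom R Y Z. \<forall>y\<in>carrier Y. \<exists>x\<in>carrier X. g x = y \<and> \<phi> x = h y"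
  proof (rule mod_hom_from_rel[OF _ _ _ _ Y Z])
    show "\<exists>z\<in>carrier Z. \<exists>x\<in>carrier X. g x = y \<and> \<phi> x = z" if "y \<in> carrier Y" for y
      using onto[OF that] mod_hom_closed[OF \<phi>] by blast
    show "\<exists>x\<in>carrier X. g x = y \<oplus>\<^bsub>Y\<^esub> y' \<and> \<phi> x = z \<oplus>\<^bsub>Z\<^esub> z'"
      if "\<exists>x\<in>carrier X. g x = y \<and> \<phi> x = z" "\<exists>x\<in>carrier X. g x = y' \<and> \<phi> x = z'" for y y' z z'
      using that mod_hom_add[OF g] mod_hom_add[OF \<phi>] X.M.a_closed by metis
    show "\<exists>x\<in>carrier X. g x = r \<odot>\<^bsub>Y\<^esub> y \<and> \<phi> x = r \<odot>\<^bsub>Z\<^esub> z"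
      if "r \<in> carrier R" "\<exists>x\<in>carrier X. g x = y \<and> \<phi> x = z" for r y z
      using that mod_hom_smult[OF g] mod_hom_smult[OF \<phi>] X.smult_closed by metis
    show "z = z'" if "\<exists>x\<in>carrier X. g x = y \<and> \<phi> x = z" "\<exists>x\<in>carrier X. g x = y \<and> \<phi> x = z'"
      for y z z'
      using that uniq by metis
  qed
  then show ?thesis
    using uniq mod_hom_closed[OF g] by metis
qed

text \<open>Universal property of a kernel: as f is injective, a map with values in the image of f
  corestricts to A.\<close>

lemma factor_mono:
  assumes X: "lmodule R X" and A: "lmodule R A"
    and f: "f \<in> mod_hom R A B" "inj_on f (carrier A)"
    and \<phi>: "\<phi> \<in> mod_hom R X B" and im: "\<And>x. x \<in> carrier X \<Longrightarrow> \<exists>a\<in>carrier A. \<phi> x = f a"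
  shows "\<exists>\<psi>\<in>mod_hom R X A. \<forall>x\<in>carrier X. f (\<psi> x) = \<phi> x"
proof -
  have "\<exists>h\<in>mod_hom R X A. \<forall>x\<in>carrier X. \<phi> x = f (h x)"
    by (rule mod_hom_from_rel[OF im _ _ _ X A])
      (auto simp: mod_hom_add[OF f(1)] mod_hom_add[OF \<phi>] mod_hom_smult[OF f(1)]
        mod_hom_smult[OF \<phi>] inj_onD[OF f(2)])
  then show ?thesis by metis
qed

text \<open>The universal property of pullbacks and products, in a form that sees P only through two
  jointly injective maps. It also applies to extensions that turn out to be pullbacks.\<close>

lemma ex_pairing:
  assumes X: "lmodule R X" and P: "lmodule R P"
    and p: "p \<in> mod_hom R P A" and q: "q \<in> mod_hom R P B"
    and pq: "\<And>x y. \<lbrakk>x \<in> carrier P; y \<in> carrier P; p x = p y; q x = q y\<rbrakk> \<Longrightarrow> x = y"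
    and u: "u \<in> mod_hom R X A" and v: "v \<in> mod_hom R X B"
    and ex: "\<And>x. x \<in> carrier X \<Longrightarrow> \<exists>z\<in>carrier P. p z = u x \<and> q z = v x"
  shows "\<exists>w\<in>mod_hom R X P. \<forall>x\<in>carrier X. p (w x) = u x \<and> q (w x) = v x"
  by (rule mod_hom_from_rel[OF ex _ _ _ X P])
    (auto simp: pq mod_hom_add[OF p] mod_hom_add[OF q] mod_hom_add[OF u] mod_hom_add[OF v]
      mod_hom_smult[OF p] mod_hom_smult[OF q] mod_hom_smult[OF u] mod_hom_smult[OF v])

text \<open>Third isomorphism theorem for A inside B inside X, with arbitrary models C, Y and Z of
  the quotients B/A, X/B and X/A. It recognizes a cokernel as an extension of two other
  cokernels.\<close>

lemma noether:
  assumes A: "lmodule R A" and B: "lmodule R B" and C: "lmodule R C" and X: "lmodule R X"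
    and Y: "lmodule R Y" and Z: "lmodule R Z"
    and s1: "short_exact R A f B g C" and s2: "short_exact R B h X k Y"
    and s3: "short_exact R A (\<lambda>x. h (f x)) X q Z"
  shows "\<exists>s t. short_exact R C s Z t Y \<and> (\<forall>x\<in>carrier B. s (g x) = q (h x)) \<and>
    (\<forall>x\<in>carrier X. t (q x) = k x)"
proof -
  interpret A: lmodule R A by fact
  interpret B: lmodule R B by fact
  interpret C: lmodule R C by fact
  interpret X: lmodule R X by fact
  interpret Z: lmodule R Z by fact
  note s1 = short_exactD[OF s1] and s2 = short_exactD[OF s2] and s3 = short_exactD[OF s3]
  have g0: "g \<zero>\<^bsub>B\<^esub> = \<zero>\<^bsub>C\<^esub>"
    by (rule mod_hom_zero[OF B.M.abelian_group_axioms C.M.abelian_group_axioms s1(2)])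
  have "\<exists>s\<in>mod_hom R C Z. \<forall>x\<in>carrier B. s (g x) = q (h x)"
    by (rule factor_epi[OF B C Z s1(2,6) mod_hom_comp[OF s2(1) s3(2)]])
      (auto dest!: s1(5) simp: s3(4))
  then obtain s where s: "s \<in> mod_hom R C Z" "\<And>x. x \<in> carrier B \<Longrightarrow> s (g x) = q (h x)"
    by blast
  have "\<exists>t\<in>mod_hom R Z Y. \<forall>x\<in>carrier X. t (q x) = k x"
    by (rule factor_epi[OF X Z Y s3(2,6) s2(2)])
      (auto dest!: s3(5) simp: s2(4) mod_hom_closed[OF s1(1)])
  then obtain t where t: "t \<in> mod_hom R Z Y" "\<And>x. x \<in> carrier X \<Longrightarrow> t (q x) = k x"
    by blast
  have "short_exact R C s Z t Y"
  proof (rule short_exactI[OF s(1) t(1)])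
    show "inj_on s (carrier C)"
    proof (rule mod_hom_inj_onI[OF C Z s(1)])
      fix z assume z: "z \<in> carrier C" "s z = \<zero>\<^bsub>Z\<^esub>"
      then obtain b where b: "b \<in> carrier B" "z = g b" using s1(6)[OF z(1)] by blast
      then have "q (h b) = \<zero>\<^bsub>Z\<^esub>" using z s(2) by simp
      then obtain a where "a \<in> carrier A" "h b = h (f a)"
        using s3(5) mod_hom_closed[OF s2(1)] b(1) by blast
      then have "b = f a" "a \<in> carrier A"
        using s2(3) b(1) mod_hom_closed[OF s1(1)] by (auto simp: inj_on_def)
      then show "z = \<zero>\<^bsub>C\<^esub>" using b s1(4) by simp
    qed
    show "t (s x) = \<zero>\<^bsub>Y\<^esub>" if "x \<in> carrier C" for x
      using s1(6)[OF that] s(2) t(2) s2(4) mod_hom_closed[OF s2(1)] by auto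
    show "\<exists>x\<in>carrier C. y = s x" if y: "y \<in> carrier Z" "t y = \<zero>\<^bsub>Y\<^esub>" for y
    proof -
      obtain x where x: "x \<in> carrier X" "y = q x" using s3(6)[OF y(1)] by blast
      then have "k x = \<zero>\<^bsub>Y\<^esub>" using y t(2) by simp
      then obtain b where b: "b \<in> carrier B" "x = h b" using s2(5)[OF x(1)] by blast
      then have "y = s (g b)" using x s(2) by simp
      with b mod_hom_closed[OF s1(2)] show ?thesis by blast
    qed
    show "\<exists>y\<in>carrier Z. z = t y" if z: "z \<in> carrier Y" for z
    proof -
      obtain x where "x \<in> carrier X" "z = k x" using s2(6)[OF z] by blast
      then have "z = t (q x)" "q x \<in> carrier Z" using t(2) mod_hom_closed[OF s3(2)] by auto
      then show ?thesis by blast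
    qed
  qed
  with s t show ?thesis by blast
qed

section \<open>Pullbacks of short exact sequences\<close>

text \<open>Stated by elements, so that any copy of the fibre product with carrier in
  \<open>'u\<close> qualifies. The last two clauses are surjectivity and injectivity of the
  comparison map to the fibre product.\<close>

definition pullback ::
  "('r, 'x) ring_scheme \<Rightarrow> ('r, 'p) module \<Rightarrow> ('p \<Rightarrow> 'a) \<Rightarrow> ('r, 'a) module \<Rightarrow> ('a \<Rightarrow> 'c) \<Rightarrow>
   ('p \<Rightarrow> 'b) \<Rightarrow> ('r, 'b) module \<Rightarrow> ('b \<Rightarrow> 'c) \<Rightarrow> bool" where
  "pullback R P p A g q B h \<longleftrightarrow> p \<in> mod_hom R P A \<and> q \<in> mod_hom R P B \<and>
    (\<forall>x\<in>carrier P. g (p x) = h (q x)) \<and>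
    (\<forall>a\<in>carrier A. \<forall>b\<in>carrier B. g a = h b \<longrightarrow> (\<exists>x\<in>carrier P. p x = a \<and> q x = b)) \<and>
    (\<forall>x\<in>carrier P. \<forall>y\<in>carrier P. p x = p y \<longrightarrow> q x = q y \<longrightarrow> x = y)"

lemma pullback_sym: "pullback R P p A g q B h \<Longrightarrow> pullback R P q B h p A g"
  unfolding pullback_def by metis

lemma pullbackD:
  assumes "pullback R P p A g q B h"
  shows "p \<in> mod_hom R P A" "q \<in> mod_hom R P B"
    and "\<And>x. x \<in> carrier P \<Longrightarrow> g (p x) = h (q x)"
    and "\<And>a b. \<lbrakk>a \<in> carrier A; b \<in> carrier B; g a = h b\<rbrakk> \<Longrightarrow> \<exists>x\<in>carrier P. p x = a \<and> q x = b"
    and "\<And>x y. \<lbrakk>x \<in> carrier P; y \<in> carrier P; p x = p y; q x = q y\<rbrakk> \<Longrightarrow> x = y"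
  using assms unfolding pullback_def by blast+

text \<open>The kernel of the base change q consists of the pairs (k x, 0), so it is a copy of the
  kernel of g; surjectivity of g passes to q.\<close>

lemma pullback_short_exact_kernel:
  assumes K: "lmodule R K" and A: "lmodule R A" and B: "lmodule R B" and C: "lmodule R C"
    and P: "lmodule R P" and pb: "pullback R P p A g q B h"
    and g: "short_exact R K k A g C" and h: "h \<in> mod_hom R B C"
  shows "\<exists>k'. short_exact R K k' P q B"
proof -
  interpret K: lmodule R K by fact
  interpret B: lmodule R B by fact
  interpret C: lmodule R C by fact
  interpret P: lmodule R P by fact
  note g = short_exactD[OF g] and pb = pullbackD[OF pb]
  have h0: "h \<zero>\<^bsub>B\<^esub> = \<zero>\<^bsub>C\<^esub>"
    by (rule mod_hom_zero[OF B.M.abelian_group_axioms C.M.abelian_group_axioms h])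
  have "\<exists>w\<in>mod_hom R K P. \<forall>x\<in>carrier K. p (w x) = k x \<and> q (w x) = \<zero>\<^bsub>B\<^esub>"
    by (rule ex_pairing[OF K P pb(1,2,5) g(1) mod_hom_const_zero[OF B] pb(4)])
      (auto simp: g(4) h0 mod_hom_closed[OF g(1)])
  then obtain w where w: "w \<in> mod_hom R K P"
    "\<And>x. x \<in> carrier K \<Longrightarrow> p (w x) = k x" "\<And>x. x \<in> carrier K \<Longrightarrow> q (w x) = \<zero>\<^bsub>B\<^esub>"
    by blast
  have "short_exact R K w P q B"
  proof (rule short_exactI[OF w(1) pb(2)])
    show "inj_on w (carrier K)"
      by (rule inj_onI) (metis w(2) g(3) inj_onD)
    show "\<exists>x\<in>carrier K. y = w x" if y: "y \<in> carrier P" "q y = \<zero>\<^bsub>B\<^esub>" for y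
    proof -
      have "g (p y) = \<zero>\<^bsub>C\<^esub>" using pb(3) y h0 by simp
      then obtain x where x: "x \<in> carrier K" "p y = k x"
        using g(5)[OF mod_hom_closed[OF pb(1) y(1)]] by blast
      then have "y = w x"
        using w y mod_hom_closed[OF w(1)] by (intro pb(5)) auto
      with x show ?thesis by blast
    qed
    show "\<exists>y\<in>carrier P. z = q y" if "z \<in> carrier B" for z
      using g(6)[of "h z"] pb(4)[of _ z] that mod_hom_closed[OF h] by metis
  qed (rule w)
  then show ?thesis by blast
qed

text \<open>As h is injective, P is the preimage of B under g. Hence A/P is C/B, which is E.\<close>

lemma pullback_short_exact_quotient:
  assumes P: "lmodule R P" and A: "lmodule R A" and B: "lmodule R B" and C: "lmodule R C"
    and E: "lmodule R E" and pb: "pullback R P p A g q B h"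
    and g: "g \<in> mod_hom R A C" "\<And>z. z \<in> carrier C \<Longrightarrow> \<exists>y\<in>carrier A. z = g y"
    and h: "short_exact R B h C e E"
  shows "short_exact R P p A (\<lambda>x. e (g x)) E"
proof -
  note h = short_exactD[OF h] and pb = pullbackD[OF pb]
  show ?thesis
  proof (rule short_exactI[OF pb(1) mod_hom_comp[OF g(1) h(2)]])
    show "inj_on p (carrier P)"
      by (rule inj_onI) (metis pb(2,3,5) h(3) inj_onD mod_hom_closed)
    show "e (g (p x)) = \<zero>\<^bsub>E\<^esub>" if "x \<in> carrier P" for x
      using pb(3) that h(4) mod_hom_closed[OF pb(2)] by simp
    show "\<exists>x\<in>carrier P. y = p x" if "y \<in> carrier A" "e (g y) = \<zero>\<^bsub>E\<^esub>" for y
      using h(5)[of "g y"] pb(4)[of y] that mod_hom_closed[OF g(1)] by metis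
    show "\<exists>y\<in>carrier A. z = e (g y)" if "z \<in> carrier E" for z
      using h(6)[OF that] g(2) by metis
  qed
qed

lemma short_exact_kernel:
  assumes "g \<in> mod_hom R B C" "\<And>z. z \<in> carrier C \<Longrightarrow> \<exists>y\<in>carrier B. z = g y"
  shows "short_exact R (B\<lparr>carrier := a_kernel B C g\<rparr>) (\<lambda>x. x) B g C"
  using assms by (intro short_exactI mod_homI)
    (auto simp: a_kernel_iff mod_hom_closed mod_hom_add mod_hom_smult)

lemma short_exact_id:
  assumes "lmodule R A" "lmodule R Z" "carrier Z = {\<zero>\<^bsub>Z\<^esub>}"
  shows "short_exact R A (\<lambda>x. x) A (\<lambda>x. \<zero>\<^bsub>Z\<^esub>) Z"
proof -
  interpret A: lmodule R A by fact
  show ?thesis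
    by (rule short_exactI[OF mod_hom_id mod_hom_const_zero[OF assms(2)]])
      (use assms(3) A.M.zero_closed in auto)
qed

section \<open>Transport of short exact sequences along isomorphisms\<close>

lemma short_exact_iso_left:
  assumes "lmodule R A" "lmodule R A'" "mod_iso R A' A" "short_exact R A f B g C"
  shows "\<exists>f'. short_exact R A' f' B g C"
proof -
  obtain \<theta> where \<theta>: "\<theta> \<in> mod_hom R A' A" "bij_betw \<theta> (carrier A') (carrier A)"
    using assms(3) by (auto simp: mod_iso_def)
  note s = short_exactD[OF assms(4)]
  have im: "\<theta> ` carrier A' = carrier A" and inj: "inj_on \<theta> (carrier A')"
    using \<theta>(2) by (auto simp: bij_betw_def)
  have "short_exact R A' (\<lambda>x. f (\<theta> x)) B g C"
  proof (rule short_exactI[OF mod_hom_comp[OF \<theta>(1) s(1)] s(2)])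
    show "inj_on (\<lambda>x. f (\<theta> x)) (carrier A')"
      using comp_inj_on[OF inj] s(3) im by (simp add: comp_def)
    show "\<exists>x\<in>carrier A'. y = f (\<theta> x)" if "y \<in> carrier B" "g y = \<zero>\<^bsub>C\<^esub>" for y
      using s(5)[OF that] im by (metis imageE)
  qed (use s mod_hom_closed[OF \<theta>(1)] in auto)
  then show ?thesis by blast
qed

lemma short_exact_iso_right:
  assumes C: "lmodule R C" "lmodule R C'" "mod_iso R C C'" and s: "short_exact R A f B g C"
  shows "\<exists>g'. short_exact R A f B g' C'"
proof -
  obtain \<theta> where \<theta>: "\<theta> \<in> mod_hom R C C'" "bij_betw \<theta> (carrier C) (carrier C')"
    using assms(3) by (auto simp: mod_iso_def)
  note s = short_exactD[OF s]
  interpret C: lmodule R C by fact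
  interpret C': lmodule R C' by fact
  have im: "\<theta> ` carrier C = carrier C'" and inj: "inj_on \<theta> (carrier C)"
    using \<theta>(2) by (auto simp: bij_betw_def)
  have 0: "\<theta> \<zero>\<^bsub>C\<^esub> = \<zero>\<^bsub>C'\<^esub>"
    by (rule mod_hom_zero[OF C.M.abelian_group_axioms C'.M.abelian_group_axioms \<theta>(1)])
  have "short_exact R A f B (\<lambda>x. \<theta> (g x)) C'"
  proof (rule short_exactI[OF s(1) mod_hom_comp[OF s(2) \<theta>(1)] s(3)])
    show "\<exists>x\<in>carrier A. y = f x" if "y \<in> carrier B" "\<theta> (g y) = \<zero>\<^bsub>C'\<^esub>" for y
      using that s(5)[of y] 0 inj_onD[OF inj, of "g y" "\<zero>\<^bsub>C\<^esub>"] mod_hom_closed[OF s(2)] by simp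
    show "\<exists>y\<in>carrier B. z = \<theta> (g y)" if "z \<in> carrier C'" for z
      using that im s(6) by (metis imageE)
  qed (simp add: s 0)
  then show ?thesis by blast
qed

lemma short_exact_iso_mid:
  assumes B: "lmodule R B" "lmodule R B'" "mod_iso R B B'" and s: "short_exact R A f B g C"
  shows "\<exists>f' g'. short_exact R A f' B' g' C"
proof -
  obtain \<theta> where \<theta>: "\<theta> \<in> mod_hom R B B'" "bij_betw \<theta> (carrier B) (carrier B')"
    using assms(3) by (auto simp: mod_iso_def)
  note s = short_exactD[OF s]
  have im: "\<theta> ` carrier B = carrier B'" and inj: "inj_on \<theta> (carrier B)"
    using \<theta>(2) by (auto simp: bij_betw_def)
  have "\<exists>\<psi>\<in>mod_hom R B' B. \<forall>x\<in>carrier B'. \<theta> (\<psi> x) = x"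
    by (rule factor_mono[OF B(2,1) \<theta>(1) inj mod_hom_id]) (use im in auto)
  then obtain \<psi> where \<psi>: "\<psi> \<in> mod_hom R B' B" "\<And>x. x \<in> carrier B' \<Longrightarrow> \<theta> (\<psi> x) = x"
    by blast
  have \<psi>\<theta>: "\<psi> (\<theta> x) = x" if "x \<in> carrier B" for x
    using that \<psi> inj mod_hom_closed[OF \<theta>(1)] mod_hom_closed[OF \<psi>(1)] by (simp add: inj_onD)
  have "short_exact R A (\<lambda>x. \<theta> (f x)) B' (\<lambda>x. g (\<psi> x)) C"
  proof (rule short_exactI[OF mod_hom_comp[OF s(1) \<theta>(1)] mod_hom_comp[OF \<psi>(1) s(2)]])
    show "inj_on (\<lambda>x. \<theta> (f x)) (carrier A)"
      by (rule inj_onI) (metis \<psi>\<theta> s(1,3) mod_hom_closed inj_onD)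
    show "g (\<psi> (\<theta> (f x))) = \<zero>\<^bsub>C\<^esub>" if "x \<in> carrier A" for x
      using that s mod_hom_closed[OF s(1)] by (simp add: \<psi>\<theta>)
    show "\<exists>x\<in>carrier A. y = \<theta> (f x)" if "y \<in> carrier B'" "g (\<psi> y) = \<zero>\<^bsub>C\<^esub>" for y
      using that s(5)[of "\<psi> y"] \<psi> mod_hom_closed[OF \<psi>(1)] by metis
    show "\<exists>y\<in>carrier B'. z = g (\<psi> y)" if "z \<in> carrier C" for z
      using s(6)[OF that] \<psi>\<theta> mod_hom_closed[OF \<theta>(1)] by metis
  qed
  then show ?thesis by blast
qed


section \<open>The category of small modules\<close>

text \<open>Interpreted later for two rings, at \<open>R\<close> for left modules and at
  \<open>op_ring R\<close> for right modules. \<open>U\<close> names the type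
  \<open>'u\<close>.\<close>

locale small_modules =
  fixes S :: "('r, 'x) ring_scheme" and U :: "'u itself"
  assumes universe: "universe_type TYPE('u)"
    and ring: "ring S"
    and small_ring: "carrier S \<prec> (UNIV :: 'u set)"
begin

abbreviation mods :: "('r, 'u) module set" where "mods \<equiv> Mods S"
abbreviation injs :: "('r, 'u) module set" where "injs \<equiv> Inj_mods S"
abbreviation gis :: "('r, 'u) module set" where "gis \<equiv> GInj_mods S"
abbreviation ses where "ses \<equiv> short_exact S"

lemma mods_lmodule: "M \<in> mods \<Longrightarrow> lmodule S M"
  by (simp add: Mods_def)

lemma mods_abelian_group: "M \<in> mods \<Longrightarrow> abelian_group M"
  by (rule lmodule_abelian_group[OF mods_lmodule])

lemma injs_mods: "M \<in> injs \<Longrightarrow> M \<in> mods"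
  by (simp add: Inj_mods_def)

lemma gis_mods: "M \<in> gis \<Longrightarrow> M \<in> mods"
  by (simp add: GInj_mods_def)

lemma hom_zero: "\<lbrakk>f \<in> mod_hom S A B; A \<in> mods; B \<in> mods\<rbrakk> \<Longrightarrow> f \<zero>\<^bsub>A\<^esub> = \<zero>\<^bsub>B\<^esub>"
  by (intro mod_hom_zero mods_abelian_group)

lemma hom_minus: "\<lbrakk>f \<in> mod_hom S A B; A \<in> mods; B \<in> mods; x \<in> carrier A; y \<in> carrier A\<rbrakk> \<Longrightarrow>
    f (x \<ominus>\<^bsub>A\<^esub> y) = f x \<ominus>\<^bsub>B\<^esub> f y"
  by (intro mod_hom_minus mods_abelian_group)

lemma mods_zero_closed: "A \<in> mods \<Longrightarrow> \<zero>\<^bsub>A\<^esub> \<in> carrier A"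
  by (simp add: abelian_group.axioms(1) abelian_monoid.zero_closed mods_abelian_group)

lemma mods_minus_closed:
  "\<lbrakk>A \<in> mods; x \<in> carrier A; y \<in> carrier A\<rbrakk> \<Longrightarrow> x \<ominus>\<^bsub>A\<^esub> y \<in> carrier A"
  by (simp add: abelian_group.minus_closed mods_abelian_group)

lemma mods_minus_eq_zero:
  "\<lbrakk>A \<in> mods; x \<in> carrier A; y \<in> carrier A\<rbrakk> \<Longrightarrow> x \<ominus>\<^bsub>A\<^esub> y = \<zero>\<^bsub>A\<^esub> \<longleftrightarrow> x = y"
  by (simp add: abelian_group.minus_eq_zero_iff mods_abelian_group)

lemma ex_copy:
  assumes "lmodule S M" "carrier M \<prec> (UNIV :: 'u set)"
  obtains N where "N \<in> mods" "mod_iso S M N"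
  using ex_small_copy[OF assms] by blast

lemma submodule_mods:
  assumes "M \<in> mods" "K \<subseteq> carrier M" "lmodule S (M\<lparr>carrier := K\<rparr>)"
  shows "M\<lparr>carrier := K\<rparr> \<in> mods"
  using assms lesspoll_trans1[OF subset_imp_lepoll[OF assms(2)]] by (auto simp: Mods_def)

lemma kernel_mods:
  assumes "B \<in> mods" "C \<in> mods" "g \<in> mod_hom S B C"
  shows "B\<lparr>carrier := a_kernel B C g\<rparr> \<in> mods"
  using assms by (intro submodule_mods lmodule_kernel mods_lmodule) (auto simp: a_kernel_iff)

lemma ex_kernel:
  assumes "B \<in> mods" "C \<in> mods" "g \<in> mod_hom S B C" "\<And>z. z \<in> carrier C \<Longrightarrow> \<exists>y\<in>carrier B. z = g y"
  obtains K f where "K \<in> mods" "ses K f B g C"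
  using kernel_mods[OF assms(1-3)] short_exact_kernel[OF assms(3,4)] by blast

lemma zero_module:
  obtains Z where "Z \<in> mods" "carrier Z = {\<zero>\<^bsub>Z\<^esub>}"
proof -
  obtain z :: 'u where True by simp
  define Z :: "('r, 'u) module" where "Z = \<lparr>carrier = {z}, mult = undefined, one = undefined,
    ring.zero = z, ring.add = (\<lambda>x y. z), smult = (\<lambda>r x. z)\<rparr>"
  have "abelian_group Z"
    by (rule abelian_groupI) (auto simp: Z_def)
  then have "lmodule S Z"
    by (rule lmoduleI[OF ring]) (auto simp: Z_def)
  moreover have "carrier Z \<prec> (UNIV :: 'u set)"
    by (intro small_countable[OF universe]) (simp add: Z_def)
  ultimately show thesis
    by (intro that[of Z]) (auto simp: Mods_def Z_def)
qed

text \<open>The quotient has cosets as elements; it is replaced by a copy in \<open>'u\<close> and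
  the sequence is transported to this copy.\<close>

lemma ex_cokernel:
  assumes A: "A \<in> mods" and B: "B \<in> mods" and f: "f \<in> mod_hom S A B" "inj_on f (carrier A)"
  obtains C g where "C \<in> mods" "ses A f B g C"
proof -
  let ?K = "f ` carrier A"
  let ?Q = "quotient_module B ?K"
  have K: "?K \<subseteq> carrier B" using mod_hom_closed[OF f(1)] by auto
  note q = lmodule_quotient[OF mods_lmodule[OF B] K
      lmodule_image[OF mods_lmodule[OF A] mods_lmodule[OF B] f(1)]]
  have "ses A f B (\<lambda>x. ?K +>\<^bsub>B\<^esub> x) ?Q"
    using f q by (simp add: short_exact_def exact_at_def)
  moreover have "carrier ?Q \<prec> (UNIV :: 'u set)"
    using B q(3) image_lepoll lesspoll_trans1 unfolding Mods_def
    by (metis (no_types, lifting) mem_Collect_eq)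
  then obtain C where "C \<in> mods" "mod_iso S ?Q C"
    using ex_copy[OF q(1)] by blast
  ultimately show thesis
    using that short_exact_iso_right[OF q(1)] mods_lmodule by metis
qed

lemma ex_pullback:
  assumes A: "A \<in> mods" and B: "B \<in> mods" and C: "C \<in> mods"
    and g: "g \<in> mod_hom S A C" and h: "h \<in> mod_hom S B C"
  obtains P p q where "P \<in> mods" "pullback S P p A g q B h"
proof -
  let ?K = "{(a, b). a \<in> carrier A \<and> b \<in> carrier B \<and> g a = h b}"
  interpret A: lmodule S A by (rule mods_lmodule[OF A])
  interpret B: lmodule S B by (rule mods_lmodule[OF B])
  let ?P = "(direct_sum A B)\<lparr>carrier := ?K\<rparr>"
  have "lmodule S ?P"
    by (rule lmodule_submodule[OF lmodule_direct_sum])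
      (auto simp: A.lmodule_axioms B.lmodule_axioms direct_sum_def hom_zero[OF g A C]
        hom_zero[OF h B C] mod_hom_add[OF g] mod_hom_add[OF h] mod_hom_smult[OF g]
        mod_hom_smult[OF h] A.smult_closed B.smult_closed)
  moreover have "carrier ?P \<prec> (UNIV :: 'u set)"
  proof -
    have "carrier ?P \<lesssim> carrier A \<times> carrier B"
      by (intro subset_imp_lepoll) auto
    with small_Times[OF universe, of "carrier A" "carrier B"] A B show ?thesis
      unfolding Mods_def by (blast intro: lesspoll_trans1)
  qed
  ultimately obtain P where P: "P \<in> mods" "mod_iso S ?P P"
    by (rule ex_copy)
  have "mod_iso S P ?P"
    by (rule mod_iso_sym) fact+
  then obtain \<theta> where \<theta>: "\<theta> \<in> mod_hom S P ?P" "bij_betw \<theta> (carrier P) ?K"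
    by (auto simp: mod_iso_def)
  have 1: "fst \<in> mod_hom S ?P A" "snd \<in> mod_hom S ?P B"
    by (auto intro!: mod_homI simp: direct_sum_def)
  have "pullback S P (\<lambda>x. fst (\<theta> x)) A g (\<lambda>x. snd (\<theta> x)) B h"
    unfolding pullback_def
  proof (intro conjI ballI impI)
    fix a b assume "a \<in> carrier A" "b \<in> carrier B" "g a = h b"
    then have "(a, b) \<in> \<theta> ` carrier P"
      using \<theta>(2) by (simp add: bij_betw_def)
    then show "\<exists>x\<in>carrier P. fst (\<theta> x) = a \<and> snd (\<theta> x) = b" by (metis fst_conv imageE snd_conv)
  next
    fix x assume "x \<in> carrier P"
    then have "\<theta> x \<in> ?K" by (rule bspec[OF bij_betwE[OF \<theta>(2)]])
    then show "g (fst (\<theta> x)) = h (snd (\<theta> x))" by auto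
  next
    fix x y assume "x \<in> carrier P" "y \<in> carrier P" "fst (\<theta> x) = fst (\<theta> y)" "snd (\<theta> x) = snd (\<theta> y)"
    then show "x = y"
      using \<theta>(2) by (auto simp: bij_betw_def inj_on_def prod_eq_iff)
  qed (rule mod_hom_comp[OF \<theta>(1)], rule 1)+
  with P show thesis using that by blast
qed

text \<open>A direct sum given by its two projections, that is, a pullback over 0. The isomorphism
  in \<open>summand_closed\<close> is rephrased in this form, which stays inside
  \<open>'u\<close>.\<close>

definition biprod ::
  "('r, 'u) module \<Rightarrow> ('u \<Rightarrow> 'u) \<Rightarrow> ('r, 'u) module \<Rightarrow> ('u \<Rightarrow> 'u) \<Rightarrow> ('r, 'u) module \<Rightarrow> bool" where
  "biprod P p A q B \<longleftrightarrow> p \<in> mod_hom S P A \<and> q \<in> mod_hom S P B \<and>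
    (\<forall>a\<in>carrier A. \<forall>b\<in>carrier B. \<exists>x\<in>carrier P. p x = a \<and> q x = b) \<and>
    (\<forall>x\<in>carrier P. \<forall>y\<in>carrier P. p x = p y \<longrightarrow> q x = q y \<longrightarrow> x = y)"

lemma biprodD:
  assumes "biprod P p A q B"
  shows "p \<in> mod_hom S P A" "q \<in> mod_hom S P B"
    and "\<And>a b. \<lbrakk>a \<in> carrier A; b \<in> carrier B\<rbrakk> \<Longrightarrow> \<exists>x\<in>carrier P. p x = a \<and> q x = b"
    and "\<And>x y. \<lbrakk>x \<in> carrier P; y \<in> carrier P; p x = p y; q x = q y\<rbrakk> \<Longrightarrow> x = y"
  using assms unfolding biprod_def by blast+

lemma ex_biprod:
  assumes "A \<in> mods" "B \<in> mods"
  obtains P p q where "P \<in> mods" "biprod P p A q B"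
proof -
  obtain Z where Z: "Z \<in> mods" by (rule zero_module)
  note z = mod_hom_const_zero[OF mods_lmodule[OF Z]]
  obtain P p q where "P \<in> mods" "pullback S P p A (\<lambda>_. \<zero>\<^bsub>Z\<^esub>) q B (\<lambda>_. \<zero>\<^bsub>Z\<^esub>)"
    by (rule ex_pullback[OF assms Z z z])
  then show thesis
    by (intro that[of P p q]) (auto simp: biprod_def pullback_def)
qed

lemma biprod_pairing:
  assumes "biprod P p A q B" "P \<in> mods" "X \<in> mods" "u \<in> mod_hom S X A" "v \<in> mod_hom S X B"
  shows "\<exists>w\<in>mod_hom S X P. \<forall>x\<in>carrier X. p (w x) = u x \<and> q (w x) = v x"
proof -
  note b = biprodD[OF assms(1)]
  show ?thesis
    using mods_lmodule[OF assms(3)] mods_lmodule[OF assms(2)] b(1,2,4) assms(4,5)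
    by (rule ex_pairing) (auto intro!: b(3) mod_hom_closed[OF assms(4)] mod_hom_closed[OF assms(5)])
qed


section \<open>Gorenstein injective modules\<close>

lemma inj_extend:
  assumes "J \<in> injs" "A \<in> mods" "B \<in> mods" "i \<in> mod_hom S A B" "inj_on i (carrier A)"
    "f \<in> mod_hom S A J"
  shows "\<exists>g\<in>mod_hom S B J. \<forall>x\<in>carrier A. g (i x) = f x"
  using assms unfolding Inj_mods_def by blast

text \<open>d may have a kernel: \<phi> first factors through the image of d, and injectivity of J
  extends it from this submodule to Y.\<close>

lemma inj_extend_ker:
  assumes J: "J \<in> injs" and X: "X \<in> mods" and Y: "Y \<in> mods" and d: "d \<in> mod_hom S X Y"
    and \<phi>: "\<phi> \<in> mod_hom S X J"
    and ker: "\<And>x. \<lbrakk>x \<in> carrier X; d x = \<zero>\<^bsub>Y\<^esub>\<rbrakk> \<Longrightarrow> \<phi> x = \<zero>\<^bsub>J\<^esub>"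
  shows "\<exists>\<psi>\<in>mod_hom S Y J. \<forall>x\<in>carrier X. \<psi> (d x) = \<phi> x"
proof -
  let ?I = "Y\<lparr>carrier := d ` carrier X\<rparr>"
  have im: "d ` carrier X \<subseteq> carrier Y" using mod_hom_closed[OF d] by auto
  have I: "?I \<in> mods"
    by (intro submodule_mods[OF Y im] lmodule_image mods_lmodule X Y d)
  have d': "d \<in> mod_hom S X ?I" and i: "(\<lambda>x. x) \<in> mod_hom S ?I Y"
    using im by (auto intro!: mod_homI simp: mod_hom_add[OF d] mod_hom_smult[OF d])
  have "\<exists>\<psi>\<in>mod_hom S ?I J. \<forall>x\<in>carrier X. \<psi> (d x) = \<phi> x"
    by (rule factor_epi[OF mods_lmodule[OF X] mods_lmodule[OF I] mods_lmodule[OF injs_mods[OF J]]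
          d' _ \<phi>]) (auto simp: ker)
  then obtain \<psi> where \<psi>: "\<psi> \<in> mod_hom S ?I J" "\<And>x. x \<in> carrier X \<Longrightarrow> \<psi> (d x) = \<phi> x"
    by blast
  obtain g where "g \<in> mod_hom S Y J" "\<And>x. x \<in> carrier ?I \<Longrightarrow> g x = \<psi> x"
    using inj_extend[OF J I Y i _ \<psi>(1)] by auto
  with \<psi>(2) show ?thesis by (intro bexI[of _ g]) auto
qed

lemma biprod_inj:
  assumes P: "P \<in> mods" and b: "biprod P p A q B" and A: "A \<in> injs" and B: "B \<in> injs"
  shows "P \<in> injs"
  unfolding Inj_mods_def
proof (intro CollectI conjI ballI impI P)
  fix X Y i f assume XY: "X \<in> mods" "Y \<in> mods" "i \<in> mod_hom S X Y" "f \<in> mod_hom S X P"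
    "inj_on i (carrier X)"
  note b' = biprodD[OF b]
  obtain u where u: "u \<in> mod_hom S Y A" "\<forall>x\<in>carrier X. u (i x) = p (f x)"
    using inj_extend[OF A XY(1-3,5) mod_hom_comp[OF XY(4) b'(1)]] by blast
  obtain v where v: "v \<in> mod_hom S Y B" "\<forall>x\<in>carrier X. v (i x) = q (f x)"
    using inj_extend[OF B XY(1-3,5) mod_hom_comp[OF XY(4) b'(2)]] by blast
  obtain w where w: "w \<in> mod_hom S Y P" "\<And>x. x \<in> carrier Y \<Longrightarrow> p (w x) = u x"
    "\<And>x. x \<in> carrier Y \<Longrightarrow> q (w x) = v x"
    using biprod_pairing[OF b P XY(2) u(1) v(1)] by blast
  have "w (i x) = f x" if "x \<in> carrier X" for x
    by (rule b'(4)) (use that in \<open>simp_all add: mod_hom_closed[OF XY(3)] mod_hom_closed[OF XY(4)]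
      mod_hom_closed[OF w(1)] u(2) v(2) w(2,3)\<close>)
  with w show "\<exists>g\<in>mod_hom S Y P. \<forall>x\<in>carrier X. g (i x) = f x" by blast
qed

lemma zero_inj:
  assumes "Z \<in> mods" "carrier Z = {\<zero>\<^bsub>Z\<^esub>}"
  shows "Z \<in> injs"
  unfolding Inj_mods_def using assms
  by (auto intro!: bexI[OF _ mod_hom_const_zero[OF mods_lmodule[OF assms(1)]]] dest: mod_hom_closed)

text \<open>In other words \<open>Ext\<^sup>1(E, M) = 0\<close> for all injective \<open>E\<close>.\<close>

definition inj_acyclic :: "('r, 'u) module \<Rightarrow> bool" where
  "inj_acyclic M \<longleftrightarrow> (\<forall>E\<in>injs. \<forall>X\<in>mods. \<forall>Y\<in>mods. \<forall>f g \<phi>.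
     ses M f X g Y \<longrightarrow> \<phi> \<in> mod_hom S E Y \<longrightarrow>
     (\<exists>\<psi>\<in>mod_hom S E X. \<forall>x\<in>carrier E. g (\<psi> x) = \<phi> x))"

lemma inj_acyclicD:
  assumes "inj_acyclic M" "ses M f X g Y" "E \<in> injs" "X \<in> mods" "Y \<in> mods" "\<phi> \<in> mod_hom S E Y"
  shows "\<exists>\<psi>\<in>mod_hom S E X. \<forall>x\<in>carrier E. g (\<psi> x) = \<phi> x"
  using assms unfolding inj_acyclic_def by blast

text \<open>With J injective, Ext^1(E, M) is the cokernel of Hom(E, J) -> Hom(E, M'). So lifting
  along one embedding suffices: any other extension X of Y by M is the pullback of b along a map Y
  -> M'.\<close>

lemma inj_acyclic_from_injective:
  assumes M: "M \<in> mods" and J: "J \<in> injs" and M': "M' \<in> mods" and s: "ses M a J b M'"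
    and lift: "\<And>E \<phi>. \<lbrakk>E \<in> injs; \<phi> \<in> mod_hom S E M'\<rbrakk> \<Longrightarrow>
        \<exists>\<psi>\<in>mod_hom S E J. \<forall>x\<in>carrier E. b (\<psi> x) = \<phi> x"
  shows "inj_acyclic M"
  unfolding inj_acyclic_def
proof (intro ballI allI impI)
  fix E X Y f g \<phi> assume E: "E \<in> injs" and X: "X \<in> mods" and Y: "Y \<in> mods"
    and s': "ses M f X g Y" and \<phi>: "\<phi> \<in> mod_hom S E Y"
  note s = short_exactD[OF s] and s' = short_exactD[OF s']
  have Jm: "J \<in> mods" using J by (rule injs_mods)
  note b0 = hom_zero[OF s(2) Jm M']
  obtain u where u: "u \<in> mod_hom S X J" "\<And>x. x \<in> carrier M \<Longrightarrow> u (f x) = a x"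
    using inj_extend[OF J M X s'(1,3) s(1)] by blast
  have "\<exists>v\<in>mod_hom S Y M'. \<forall>x\<in>carrier X. v (g x) = b (u x)"
    by (rule factor_epi[OF mods_lmodule[OF X] mods_lmodule[OF Y] mods_lmodule[OF M'] s'(2,6)
          mod_hom_comp[OF u(1) s(2)]]) (auto dest!: s'(5) simp: u(2) s(4))
  then obtain v where v: "v \<in> mod_hom S Y M'" "\<And>x. x \<in> carrier X \<Longrightarrow> v (g x) = b (u x)"
    by blast
  obtain l where l: "l \<in> mod_hom S E J" "\<And>x. x \<in> carrier E \<Longrightarrow> b (l x) = v (\<phi> x)"
    using lift[OF E mod_hom_comp[OF \<phi> v(1)]] by blast
  \<comment> \<open>This and the next fact express that X, with g and u, is the pullback of v : Y ->
    M' and b : J -> M'. Pairs determine elements, and every pair (\<phi> e, l e) is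
    realized.\<close>
  have gu: "x = y" if "x \<in> carrier X" "y \<in> carrier X" "g x = g y" "u x = u y" for x y
  proof -
    have "g (x \<ominus>\<^bsub>X\<^esub> y) = \<zero>\<^bsub>Y\<^esub>" "u (x \<ominus>\<^bsub>X\<^esub> y) = \<zero>\<^bsub>J\<^esub>"
      using that mod_hom_closed[OF s'(2)] mod_hom_closed[OF u(1)]
      by (auto simp: hom_minus[OF s'(2) X Y] hom_minus[OF u(1) X Jm] mods_minus_eq_zero Y Jm)
    moreover from this(1) obtain m where m: "m \<in> carrier M" "x \<ominus>\<^bsub>X\<^esub> y = f m"
      using s'(5)[OF mods_minus_closed[OF X \<open>x \<in> carrier X\<close> \<open>y \<in> carrier X\<close>]] by blast
    ultimately have "a m = \<zero>\<^bsub>J\<^esub>" using u(2) by simp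
    then have "m = \<zero>\<^bsub>M\<^esub>"
      using inj_onD[OF s(3)] hom_zero[OF s(1) M Jm] m mods_zero_closed[OF M] by metis
    then show "x = y"
      using m hom_zero[OF s'(1) M X] that X by (simp add: mods_minus_eq_zero)
  qed
  have ex: "\<exists>z\<in>carrier X. g z = \<phi> e \<and> u z = l e" if e: "e \<in> carrier E" for e
  proof -
    note \<phi>e = mod_hom_closed[OF \<phi> e] and le = mod_hom_closed[OF l(1) e]
    obtain x where x: "x \<in> carrier X" "\<phi> e = g x" using s'(6)[OF \<phi>e] by blast
    note ux = mod_hom_closed[OF u(1) x(1)]
    have "b (l e \<ominus>\<^bsub>J\<^esub> u x) = \<zero>\<^bsub>M'\<^esub>"
      using x le ux v(2)[OF x(1)] l(2)[OF e] mod_hom_closed[OF s(2)]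
      by (simp add: hom_minus[OF s(2) Jm M'] mods_minus_eq_zero[OF M'])
    then obtain m where m: "m \<in> carrier M" "l e \<ominus>\<^bsub>J\<^esub> u x = a m"
      using s(5)[OF mods_minus_closed[OF Jm le ux]] by blast
    interpret J: abelian_group J by (rule mods_abelian_group[OF Jm])
    interpret X: abelian_group X by (rule mods_abelian_group[OF X])
    interpret Y: abelian_group Y by (rule mods_abelian_group[OF Y])
    note fm = mod_hom_closed[OF s'(1) m(1)]
    have "g (f m \<oplus>\<^bsub>X\<^esub> x) = \<phi> e"
      using m x fm mod_hom_closed[OF s'(2)] by (simp add: mod_hom_add[OF s'(2)] s'(4))
    moreover have "u (f m \<oplus>\<^bsub>X\<^esub> x) = (l e \<ominus>\<^bsub>J\<^esub> u x) \<oplus>\<^bsub>J\<^esub> u x"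
      using m x fm by (simp add: mod_hom_add[OF u(1)] u(2))
    then have "u (f m \<oplus>\<^bsub>X\<^esub> x) = l e"
      using le ux by (simp add: a_minus_def J.a_assoc J.l_neg)
    ultimately show ?thesis using fm x(1) by blast
  qed
  have "\<exists>w\<in>mod_hom S E X. \<forall>x\<in>carrier E. g (w x) = \<phi> x \<and> u (w x) = l x"
    by (rule ex_pairing[OF mods_lmodule[OF injs_mods[OF E]] mods_lmodule[OF X] s'(2) u(1) gu
          \<phi> l(1) ex])
  then show "\<exists>\<psi>\<in>mod_hom S E X. \<forall>x\<in>carrier E. g (\<psi> x) = \<phi> x" by blast
qed

text \<open>The lift is made in two stages: from Y to Z = X/A, which is an extension of Y by C, and
  then from Z to X, an extension of Z by A.\<close>

lemma inj_acyclic_ext: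
  assumes A: "A \<in> mods" and B: "B \<in> mods" and C: "C \<in> mods" and s: "ses A f B g C"
    and "inj_acyclic A" "inj_acyclic C"
  shows "inj_acyclic B"
  unfolding inj_acyclic_def
proof (intro ballI allI impI)
  fix E X Y h k \<phi> assume E: "E \<in> injs" and X: "X \<in> mods" and Y: "Y \<in> mods"
    and s': "ses B h X k Y" and \<phi>: "\<phi> \<in> mod_hom S E Y"
  note sD = short_exactD[OF s] and s'D = short_exactD[OF s']
  have inj: "inj_on (\<lambda>x. h (f x)) (carrier A)"
    by (rule inj_onI) (metis sD(1,3) s'D(3) inj_onD mod_hom_closed)
  obtain Z q where Z: "Z \<in> mods" and q: "ses A (\<lambda>x. h (f x)) X q Z"
    by (rule ex_cokernel[OF A X mod_hom_comp[OF sD(1) s'D(1)] inj])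
  obtain s1 t where st: "ses C s1 Z t Y" "\<And>x. x \<in> carrier X \<Longrightarrow> t (q x) = k x"
    using noether[OF mods_lmodule[OF A] mods_lmodule[OF B] mods_lmodule[OF C] mods_lmodule[OF X]
        mods_lmodule[OF Y] mods_lmodule[OF Z] s s' q] by blast
  obtain \<psi> where \<psi>: "\<psi> \<in> mod_hom S E Z" "\<And>x. x \<in> carrier E \<Longrightarrow> t (\<psi> x) = \<phi> x"
    using inj_acyclicD[OF assms(6) st(1) E Z Y \<phi>] by blast
  obtain \<chi> where \<chi>: "\<chi> \<in> mod_hom S E X" "\<And>x. x \<in> carrier E \<Longrightarrow> q (\<chi> x) = \<psi> x"
    using inj_acyclicD[OF assms(5) q E X Z \<psi>(1)] by blast
  have "k (\<chi> x) = \<phi> x" if "x \<in> carrier E" for x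
    using st(2)[OF mod_hom_closed[OF \<chi>(1) that]] \<psi>(2)[OF that] \<chi>(2)[OF that] by simp
  with \<chi> show "\<exists>\<psi>\<in>mod_hom S E X. \<forall>x\<in>carrier E. k (\<psi> x) = \<phi> x" by blast
qed

text \<open>\<open>GI\<close> is the largest class with this closure property (lemmas \<open>gi_coinduct\<close>
  and \<open>gi_coclosed_gis\<close>), so complexes are not needed afterwards.\<close>

definition gi_coclosed :: "('r, 'u) module set \<Rightarrow> bool" where
  "gi_coclosed G \<longleftrightarrow> G \<subseteq> mods \<and> (\<forall>M\<in>G. inj_acyclic M \<and>
     (\<exists>J\<in>injs. \<exists>M'\<in>G. \<exists>f g. ses M f J g M') \<and>
     (\<exists>I\<in>injs. \<exists>K\<in>G. \<exists>f g. ses K f I g M))"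

section \<open>Gorenstein injective modules as a coinductive class\<close>

lemma hom_post_hom:
  assumes "lmodule S B" "lmodule S C" "d \<in> mod_hom S B C" "lmodule S A"
  shows "hom_post A d \<in> hom (hom_group S A B) (hom_group S A C)"
proof (rule homI)
  interpret A: lmodule S A by fact
  show "hom_post A d f \<in> carrier (hom_group S A C)" if "f \<in> carrier (hom_group S A B)" for f
    using that mod_hom_comp[OF _ assms(3), of f A]
    by (auto simp: hom_group_def hom_post_def mod_hom_def A.smult_closed)
  show "hom_post A d (f \<otimes>\<^bsub>hom_group S A B\<^esub> g)
      = hom_post A d f \<otimes>\<^bsub>hom_group S A C\<^esub> hom_post A d g"
    if "f \<in> carrier (hom_group S A B)" "g \<in> carrier (hom_group S A B)" for f g
    using that by (auto simp: hom_group_def hom_post_def fun_eq_iff restrict_def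
        mod_hom_add[OF assms(3)] mod_hom_closed)
qed

text \<open>Iterating the two sequences from M and splicing them gives an exact complex of
  injectives with M as cycle module in degree 0. Acyclicity of all cycles makes Hom(E, -) exact on
  it.\<close>

lemma gi_coinduct:
  assumes G: "gi_coclosed G"
  shows "G \<subseteq> gis"
proof
  fix M assume M: "M \<in> G"
  have "\<forall>M\<in>G. \<exists>M'. M' \<in> G \<and> (\<exists>J\<in>injs. \<exists>f g. ses M f J g M')"
    using G unfolding gi_coclosed_def by metis
  then obtain r where r: "\<And>M. M \<in> G \<Longrightarrow> r M \<in> G \<and> (\<exists>J\<in>injs. \<exists>f g. ses M f J g (r M))"
    by metis
  have "\<forall>M\<in>G. \<exists>K. K \<in> G \<and> (\<exists>J\<in>injs. \<exists>f g. ses K f J g M)"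
    using G unfolding gi_coclosed_def by metis
  then obtain l where l: "\<And>M. M \<in> G \<Longrightarrow> l M \<in> G \<and> (\<exists>J\<in>injs. \<exists>f g. ses (l M) f J g M)"
    by metis
  have rn: "(r ^^ n) M \<in> G" for n by (induction n) (auto simp: M r)
  have ln: "(l ^^ n) M \<in> G" for n by (induction n) (auto simp: M l)
  \<comment> \<open>\<open>Z i\<close> will be the cycles in degree i: cosyzygies of M for i < 0,
    syzygies for i > 0, and M itself for i = 0.\<close>
  define Z where "Z i = (if i \<le> 0 then (r ^^ nat (- i)) M else (l ^^ nat i) M)" for i :: int
  have ZG: "Z i \<in> G" for i by (simp add: Z_def rn ln)
  have "\<exists>J f g. J \<in> injs \<and> ses (Z i) f J g (Z (i - 1))" for i
  proof (cases "i \<le> 0")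
    case True
    then have "nat (- (i - 1)) = Suc (nat (- i))" by simp
    with True have "Z (i - 1) = r (Z i)" by (simp add: Z_def)
    with r[OF ZG] show ?thesis by metis
  next
    case False
    have "Z i = l (Z (i - 1))"
    proof (cases "i = 1")
      case False
      with \<open>\<not> i \<le> 0\<close> have "nat i = Suc (nat (i - 1))" "\<not> i - 1 \<le> 0" by auto
      then show ?thesis using \<open>\<not> i \<le> 0\<close> by (simp add: Z_def)
    qed (simp add: Z_def)
    with l[OF ZG] show ?thesis by metis
  qed
  then obtain J f g where J: "\<And>i. J i \<in> injs" and s: "\<And>i. ses (Z i) (f i) (J i) (g i) (Z (i - 1))"
    by metis
  have Zm: "Z i \<in> mods" and Za: "inj_acyclic (Z i)" for i
    using ZG G by (auto simp: gi_coclosed_def)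
  have Jm: "J i \<in> mods" for i using J by (rule injs_mods)
  note sD = short_exactD[OF s]
  \<comment> \<open>The differential passes through the cycles, onto \<open>Z (i - 1)\<close> by g
    and then into \<open>J (i - 1)\<close> by f. Its kernel is therefore the image of
    \<open>Z i\<close>.\<close>
  define d where "d i = (\<lambda>x. f (i - 1) (g i x))" for i
  have d: "d i \<in> mod_hom S (J i) (J (i - 1))" for i
    unfolding d_def by (rule mod_hom_comp[OF sD(2) sD(1)])
  have d0: "d i x = \<zero>\<^bsub>J (i - 1)\<^esub> \<longleftrightarrow> g i x = \<zero>\<^bsub>Z (i - 1)\<^esub>" if "x \<in> carrier (J i)" for i x
    unfolding d_def using inj_onD[OF sD(3)[of "i - 1"]] hom_zero[OF sD(1) Zm Jm]
      mods_zero_closed[OF Zm] mod_hom_closed[OF sD(2)] that by metis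
  have ker: "a_kernel (J i) (J (i - 1)) (d i) = f i ` carrier (Z i)" for i
  proof (intro equalityI subsetI)
    fix x assume "x \<in> a_kernel (J i) (J (i - 1)) (d i)"
    then have "x \<in> carrier (J i)" "g i x = \<zero>\<^bsub>Z (i - 1)\<^esub>" by (auto simp: a_kernel_iff d0)
    then show "x \<in> f i ` carrier (Z i)" using sD(5) by blast
  next
    fix x assume "x \<in> f i ` carrier (Z i)"
    then show "x \<in> a_kernel (J i) (J (i - 1)) (d i)"
      using sD(4) mod_hom_closed[OF sD(1)] by (auto simp: a_kernel_iff d0)
  qed
  have im: "g i ` carrier (J i) = carrier (Z (i - 1))" for i
    using s[of i] by (simp add: short_exact_def)
  have "exact_at S (J (i + 1)) (d (i + 1)) (J i) (d i) (J (i - 1))" for i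
  proof -
    have "d (i + 1) ` carrier (J (i + 1)) = f i ` g (i + 1) ` carrier (J (i + 1))"
      by (simp add: d_def image_image)
    then show ?thesis
      using d[of "i + 1"] d[of i] im[of "i + 1"] ker[of i] by (simp add: exact_at_def)
  qed
  then have ex: "exact_complex S J d" by (simp add: exact_complex_def)
  have hex: "group_exact_at (hom_group S E (J (i + 1))) (hom_post E (d (i + 1)))
      (hom_group S E (J i)) (hom_post E (d i)) (hom_group S E (J (i - 1)))" if E: "E \<in> injs" for E i
    unfolding group_exact_at_def
  proof (intro conjI equalityI subsetI)
    have El: "lmodule S E" by (intro mods_lmodule injs_mods E)
    interpret E: lmodule S E by fact
    show 1: "hom_post E (d (i + 1)) \<in> hom (hom_group S E (J (i + 1))) (hom_group S E (J i))"
      using hom_post_hom[OF mods_lmodule[OF Jm] mods_lmodule[OF Jm] d El, of "i + 1"] by simp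
    show 2: "hom_post E (d i) \<in> hom (hom_group S E (J i)) (hom_group S E (J (i - 1)))"
      by (rule hom_post_hom[OF mods_lmodule[OF Jm] mods_lmodule[OF Jm] d El])
    fix \<phi>
    {
      assume "\<phi> \<in> hom_post E (d (i + 1)) ` carrier (hom_group S E (J (i + 1)))"
      then obtain \<psi> where \<psi>: "\<psi> \<in> carrier (hom_group S E (J (i + 1)))" "\<phi> = hom_post E (d (i + 1)) \<psi>"
        by blast
      have "d i (d (i + 1) x) = \<zero>\<^bsub>J (i - 1)\<^esub>" if "x \<in> carrier (J (i + 1))" for x
      proof -
        have "d (i + 1) x \<in> f i ` carrier (Z i)"
          using that im[of "i + 1"] by (auto simp: d_def)
        then show ?thesis by (simp flip: ker add: a_kernel_iff)
      qed
      then have "hom_post E (d i) \<phi> = \<one>\<^bsub>hom_group S E (J (i - 1))\<^esub>"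
        using \<psi> by (auto simp: hom_post_def hom_group_def fun_eq_iff restrict_def mod_hom_closed)
      then show "\<phi> \<in> kernel (hom_group S E (J i)) (hom_group S E (J (i - 1))) (hom_post E (d i))"
        using \<psi> 1 by (auto simp: kernel_def hom_def)
    next
      assume "\<phi> \<in> kernel (hom_group S E (J i)) (hom_group S E (J (i - 1))) (hom_post E (d i))"
      then have \<phi>: "\<phi> \<in> mod_hom S E (J i)" "\<phi> \<in> extensional (carrier E)"
        and "hom_post E (d i) \<phi> = (\<lambda>x\<in>carrier E. \<zero>\<^bsub>J (i - 1)\<^esub>)"
        by (auto simp: kernel_def hom_group_def)
      then have k: "d i (\<phi> x) = \<zero>\<^bsub>J (i - 1)\<^esub>" if "x \<in> carrier E" for x
        using that unfolding hom_post_def by (metis restrict_apply')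
      \<comment> \<open>A cocycle takes values in the cycles \<open>Z i\<close>. It lifts to
        \<open>J (i + 1)\<close> because \<open>Z (i + 1)\<close>, the kernel of
        \<open>J (i + 1) -> Z i\<close>, is acyclic.\<close>
      have "\<exists>\<phi>'\<in>mod_hom S E (Z i). \<forall>x\<in>carrier E. f i (\<phi>' x) = \<phi> x"
      proof (rule factor_mono[OF El mods_lmodule[OF Zm] sD(1,3) \<phi>(1)])
        fix x assume x: "x \<in> carrier E"
        show "\<exists>a\<in>carrier (Z i). \<phi> x = f i a"
          using k[OF x] mod_hom_closed[OF \<phi>(1) x] by (intro sD(5)) (auto simp: d0)
      qed
      then obtain \<phi>' where \<phi>': "\<phi>' \<in> mod_hom S E (Z i)" "\<And>x. x \<in> carrier E \<Longrightarrow> f i (\<phi>' x) = \<phi> x"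
        by blast
      have s1: "ses (Z (i + 1)) (f (i + 1)) (J (i + 1)) (g (i + 1)) (Z i)"
        using s[of "i + 1"] by simp
      obtain \<psi> where \<psi>: "\<psi> \<in> mod_hom S E (J (i + 1))"
        "\<And>x. x \<in> carrier E \<Longrightarrow> g (i + 1) (\<psi> x) = \<phi>' x"
        using inj_acyclicD[OF Za s1 E Jm Zm \<phi>'(1)] by blast
      have "\<phi> = hom_post E (d (i + 1)) (restrict \<psi> (carrier E))"
        using \<phi>(2) \<psi>(2) \<phi>'(2)
        by (auto simp: hom_post_def d_def fun_eq_iff restrict_def extensional_def)
      moreover have "restrict \<psi> (carrier E) \<in> carrier (hom_group S E (J (i + 1)))"
        using \<psi>(1) by (auto simp: hom_group_def mod_hom_def E.smult_closed)
      ultimately show "\<phi> \<in> hom_post E (d (i + 1)) ` carrier (hom_group S E (J (i + 1)))" by blast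
    }
  qed
  have "f 0 \<in> mod_hom S M (cycle_module J d 0)"
  proof (rule mod_homI)
    have [simp]: "Z 0 = M" by (simp add: Z_def)
    show "f 0 x \<in> carrier (cycle_module J d 0)" if "x \<in> carrier M" for x
      using that ker[of 0] by (auto simp: cycle_module_def)
    show "f 0 (x \<oplus>\<^bsub>M\<^esub> y) = f 0 x \<oplus>\<^bsub>cycle_module J d 0\<^esub> f 0 y"
      if "x \<in> carrier M" "y \<in> carrier M" for x y
      using that mod_hom_add[OF sD(1)[of 0]] by (simp add: cycle_module_def)
    show "f 0 (r \<odot>\<^bsub>M\<^esub> x) = r \<odot>\<^bsub>cycle_module J d 0\<^esub> f 0 x"
      if "r \<in> carrier S" "x \<in> carrier M" for r x
      using that mod_hom_smult[OF sD(1)[of 0]] by (simp add: cycle_module_def)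
  qed
  moreover have "bij_betw (f 0) (carrier M) (carrier (cycle_module J d 0))"
    using ker[of 0] sD(3)[of 0] by (simp add: bij_betw_def cycle_module_def Z_def)
  ultimately have "mod_iso S M (cycle_module J d 0)" by (auto simp: mod_iso_def)
  moreover have "M \<in> mods" using M G by (auto simp: gi_coclosed_def)
  ultimately show "M \<in> gis"
    unfolding GInj_mods_def using J ex hex by blast
qed

definition gi_complex :: "(int \<Rightarrow> ('r, 'u) module) \<Rightarrow> (int \<Rightarrow> 'u \<Rightarrow> 'u) \<Rightarrow> bool" where
  "gi_complex J d \<longleftrightarrow> (\<forall>i. J i \<in> injs) \<and> exact_complex S J d \<and>
       (\<forall>E\<in>injs. \<forall>i. group_exact_at
            (hom_group S E (J (i + 1))) (hom_post E (d (i + 1)))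
            (hom_group S E (J i)) (hom_post E (d i))
            (hom_group S E (J (i - 1))))"

lemma gisI:
  assumes "M \<in> mods" "gi_complex J d" "mod_iso S M (cycle_module J d 0)"
  shows "M \<in> gis"
  using assms unfolding GInj_mods_def gi_complex_def
  by (intro CollectI conjI exI[of _ J] exI[of _ d]) auto

text \<open>\<open>GInj_mods\<close> only speaks of the cycles in degree 0; shifting makes every
  cycle module of the complex Gorenstein injective.\<close>

lemma gi_complex_shift:
  assumes "gi_complex J d"
  shows "gi_complex (\<lambda>j. J (j + i)) (\<lambda>j. d (j + i))"
proof -
  have [simp]: "j + 1 + i = (j + i) + 1" "j - 1 + i = (j + i) - 1" for j by auto
  show ?thesis using assms by (simp add: gi_complex_def exact_complex_def)
qed

lemma cycle_ses:
  assumes "exact_complex S J d" "\<And>i. lmodule S (J i)"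
  shows "ses (cycle_module J d (i + 1)) (\<lambda>x. x) (J (i + 1)) (d (i + 1)) (cycle_module J d i)"
proof -
  have e: "exact_at S (J (i + 1)) (d (i + 1)) (J i) (d i) (J (i - 1))" for i
    using assms(1) by (simp add: exact_complex_def)
  have d: "d i \<in> mod_hom S (J i) (J (i - 1))" for i
    using e by (auto simp: exact_at_def)
  have im: "d (i + 1) ` carrier (J (i + 1)) = a_kernel (J i) (J (i - 1)) (d i)"
    using e by (auto simp: exact_at_def)
  have "d (i + 1) \<in> mod_hom S (J (i + 1)) (cycle_module J d i)"
    using d[of "i + 1"] im by (auto simp: mod_hom_def cycle_module_def)
  from short_exact_kernel[OF this] im show ?thesis
    by (fastforce simp: cycle_module_def a_kernel_def kernel_def)
qed

text \<open>The cycles in degrees -1 and 1 are Gorenstein injective by shifting, and supply the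
  required cokernel and kernel. Acyclicity comes from exactness of Hom(E, -) in degree -1.\<close>

lemma gi_coclosed_gis: "gi_coclosed gis"
  unfolding gi_coclosed_def
proof (intro conjI ballI)
  show "gis \<subseteq> mods" using gis_mods by blast
  fix M assume M: "M \<in> gis"
  then obtain J d where J: "gi_complex J d" and iso: "mod_iso S M (cycle_module J d 0)"
    by (auto simp: GInj_mods_def gi_complex_def)
  have Ji: "J i \<in> injs" for i using J by (simp add: gi_complex_def)
  have Jm: "J i \<in> mods" for i using Ji by (rule injs_mods)
  have ex: "exact_complex S J d" using J by (simp add: gi_complex_def)
  have d: "d i \<in> mod_hom S (J i) (J (i - 1))" for i
    using ex by (auto simp: exact_complex_def exact_at_def)
  have Zm: "cycle_module J d i \<in> mods" for i
    unfolding cycle_module_def by (rule kernel_mods[OF Jm Jm d])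
  have Zg: "cycle_module J d i \<in> gis" for i
  proof -
    have "mod_iso S (cycle_module J d i) (cycle_module (\<lambda>j. J (j + i)) (\<lambda>j. d (j + i)) 0)"
      unfolding mod_iso_def
      by (rule bexI[of _ "\<lambda>x. x"]) (auto simp: cycle_module_def mod_hom_def bij_betw_def)
    then show ?thesis
      by (rule gisI[OF Zm gi_complex_shift[OF J]])
  qed
  note Mm = gis_mods[OF M]
  have iso': "mod_iso S (cycle_module J d 0) M"
    by (rule mod_iso_sym[OF mods_lmodule[OF Mm] iso])
  have s0: "ses (cycle_module J d 0) (\<lambda>x. x) (J 0) (d 0) (cycle_module J d (-1))"
    using cycle_ses[OF ex mods_lmodule[OF Jm], of "-1"] by simp
  have s1: "ses (cycle_module J d 1) (\<lambda>x. x) (J 1) (d 1) (cycle_module J d 0)"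
    using cycle_ses[OF ex mods_lmodule[OF Jm], of 0] by simp
  obtain f where f: "ses M f (J 0) (d 0) (cycle_module J d (-1))"
    using short_exact_iso_left[OF mods_lmodule[OF Zm] mods_lmodule[OF Mm] iso s0] by blast
  show "\<exists>J\<in>injs. \<exists>M'\<in>gis. \<exists>f g. ses M f J g M'" using f Ji Zg by blast
  obtain g where g: "ses (cycle_module J d 1) (\<lambda>x. x) (J 1) g M"
    using short_exact_iso_right[OF mods_lmodule[OF Zm] mods_lmodule[OF Mm] iso' s1] by blast
  show "\<exists>I\<in>injs. \<exists>K\<in>gis. \<exists>f g. ses K f I g M" using g Ji Zg by blast
  show "inj_acyclic M"
  proof (rule inj_acyclic_from_injective[OF Mm Ji Zm f])
    fix E \<phi> assume E: "E \<in> injs" and \<phi>: "\<phi> \<in> mod_hom S E (cycle_module J d (-1))"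
    interpret E: lmodule S E by (intro mods_lmodule injs_mods E)
    \<comment> \<open>\<open>hom_group\<close> contains only extensional functions, hence the
      restriction. A map into the cycles of degree -1 is a cocycle of Hom(E, J), so it comes from a
      map into \<open>J 0\<close>.\<close>
    let ?\<phi> = "restrict \<phi> (carrier E)"
    have "?\<phi> \<in> carrier (hom_group S E (J (-1)))"
      using \<phi> by (auto simp: hom_group_def mod_hom_def E.smult_closed cycle_module_def a_kernel_def kernel_def)
    moreover have "d (-1) (\<phi> x) = \<zero>\<^bsub>J (-2)\<^esub>" if "x \<in> carrier E" for x
      using mod_hom_closed[OF \<phi> that] by (simp add: cycle_module_def a_kernel_iff)
    ultimately have "?\<phi> \<in> kernel (hom_group S E (J (-1))) (hom_group S E (J (-2))) (hom_post E (d (-1)))"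
      by (auto simp: kernel_def hom_post_def hom_group_def fun_eq_iff restrict_def)
    moreover have "group_exact_at (hom_group S E (J (- 1 + 1))) (hom_post E (d (- 1 + 1)))
            (hom_group S E (J (- 1))) (hom_post E (d (- 1))) (hom_group S E (J (- 1 - 1)))"
      using J E unfolding gi_complex_def by blast
    ultimately have "?\<phi> \<in> hom_post E (d 0) ` carrier (hom_group S E (J 0))"
      by (simp add: group_exact_at_def)
    then obtain \<psi> where \<psi>: "\<psi> \<in> mod_hom S E (J 0)" "?\<phi> = hom_post E (d 0) \<psi>"
      by (auto simp: hom_group_def)
    have "d 0 (\<psi> x) = \<phi> x" if "x \<in> carrier E" for x
      using fun_cong[OF \<psi>(2), of x] that by (simp add: hom_post_def)
    with \<psi> show "\<exists>\<psi>\<in>mod_hom S E (J 0). \<forall>x\<in>carrier E. d 0 (\<psi> x) = \<phi> x" by blast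
  qed
qed


lemma gisD:
  assumes "M \<in> gis"
  shows "inj_acyclic M"
    and "\<exists>J\<in>injs. \<exists>M'\<in>gis. \<exists>f g. ses M f J g M'"
    and "\<exists>I\<in>injs. \<exists>K\<in>gis. \<exists>f g. ses K f I g M"
  using gi_coclosed_gis assms unfolding gi_coclosed_def by blast+

text \<open>Coinduction applied to the injectives themselves, with the sequences M -> M -> 0 and 0
  -> M -> M.\<close>

lemma injs_gis: "injs \<subseteq> gis"
proof (rule gi_coinduct)
  obtain Z where Z: "Z \<in> mods" "carrier Z = {\<zero>\<^bsub>Z\<^esub>}" by (rule zero_module)
  note Zi = zero_inj[OF Z]
  show "gi_coclosed injs"
    unfolding gi_coclosed_def
  proof (intro conjI ballI)
    show "injs \<subseteq> mods" using injs_mods by blast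
    fix M assume M: "M \<in> injs"
    note Mm = injs_mods[OF M]
    note s = short_exact_id[OF mods_lmodule[OF Mm] mods_lmodule[OF Z(1)] Z(2)]
    show "\<exists>J\<in>injs. \<exists>M'\<in>injs. \<exists>f g. ses M f J g M'"
      using s M Zi by blast
    have "ses Z (\<lambda>x. \<zero>\<^bsub>M\<^esub>) M (\<lambda>x. x) M"
      by (rule short_exactI[OF mod_hom_const_zero[OF mods_lmodule[OF Mm]] mod_hom_id])
        (use Z in auto)
    then show "\<exists>I\<in>injs. \<exists>K\<in>injs. \<exists>f g. ses K f I g M"
      using M Zi by blast
    show "inj_acyclic M"
    proof (rule inj_acyclic_from_injective[OF Mm M Z(1) s])
      fix E \<phi> assume "\<phi> \<in> mod_hom S E Z"
      then have "\<forall>x\<in>carrier E. \<zero>\<^bsub>Z\<^esub> = \<phi> x"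
        using mod_hom_closed Z(2) by fastforce
      then show "\<exists>\<psi>\<in>mod_hom S E M. \<forall>x\<in>carrier E. \<zero>\<^bsub>Z\<^esub> = \<phi> x"
        using mod_hom_const_zero[OF mods_lmodule[OF Mm]] by blast
    qed
  qed
qed

section \<open>Horseshoe lemmas with injective modules\<close>

text \<open>The usual horseshoe for injective coresolutions: the components of u are an extension h
  of a to B and the composite of g with c. The cokernel Y is an extension of the two given
  cokernels.\<close>

lemma horseshoe_right:
  assumes B: "B \<in> mods" and s: "ses A f B g C"
    and JA: "JA \<in> injs" and JC: "JC \<in> injs" and A': "A' \<in> mods" and C': "C' \<in> mods"
    and A: "A \<in> mods" and C: "C \<in> mods"
    and sA: "ses A a JA a' A'" and sC: "ses C c JC c' C'"
  shows "\<exists>J\<in>injs. \<exists>Y\<in>mods. \<exists>u \<pi> \<alpha> \<beta>. ses B u J \<pi> Y \<and> ses A' \<alpha> Y \<beta> C'"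
proof -
  note s = short_exactD[OF s] and sA = short_exactD[OF sA] and sC = short_exactD[OF sC]
  have JAm: "JA \<in> mods" and JCm: "JC \<in> mods" using JA JC by (auto intro: injs_mods)
  obtain h where h: "h \<in> mod_hom S B JA" "\<And>x. x \<in> carrier A \<Longrightarrow> h (f x) = a x"
    using inj_extend[OF JA A B s(1,3) sA(1)] by blast
  obtain J p q where J: "J \<in> mods" and b: "biprod J p JA q JC"
    by (rule ex_biprod[OF JAm JCm])
  have Ji: "J \<in> injs" by (rule biprod_inj[OF J b JA JC])
  note bD = biprodD[OF b]
  obtain u where u: "u \<in> mod_hom S B J" "\<And>x. x \<in> carrier B \<Longrightarrow> p (u x) = h x"
    "\<And>x. x \<in> carrier B \<Longrightarrow> q (u x) = c (g x)"
    using biprod_pairing[OF b J B h(1) mod_hom_comp[OF s(2) sC(1)]] by blast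
  obtain i where i: "i \<in> mod_hom S JA J" "\<And>x. x \<in> carrier JA \<Longrightarrow> p (i x) = x"
    "\<And>x. x \<in> carrier JA \<Longrightarrow> q (i x) = \<zero>\<^bsub>JC\<^esub>"
    using biprod_pairing[OF b J JAm mod_hom_id mod_hom_const_zero[OF mods_lmodule[OF JCm]]] by blast
  \<comment> \<open>The image of B meets the summand JA only in the image of A. Injectivity of u and
    of \<alpha> both follow from this.\<close>
  have ui: "\<exists>x\<in>carrier A. b = f x \<and> j = a x" if bj: "b \<in> carrier B" "j \<in> carrier JA" "u b = i j" for b j
  proof -
    have "c (g b) = \<zero>\<^bsub>JC\<^esub>" using u(3)[OF bj(1)] i(3)[OF bj(2)] bj(3) by simp
    then have "g b = \<zero>\<^bsub>C\<^esub>"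
      using inj_onD[OF sC(3)] mod_hom_closed[OF s(2) bj(1)] hom_zero[OF sC(1) C JCm]
        mods_zero_closed[OF C] by simp
    then obtain x where x: "x \<in> carrier A" "b = f x" using s(5)[OF bj(1)] by blast
    moreover have "h b = j" using u(2)[OF bj(1)] i(2)[OF bj(2)] bj(3) by simp
    ultimately show ?thesis using h(2) by blast
  qed
  have uinj: "inj_on u (carrier B)"
  proof (rule mod_hom_inj_onI[OF mods_lmodule[OF B] mods_lmodule[OF J] u(1)])
    fix x assume x: "x \<in> carrier B" "u x = \<zero>\<^bsub>J\<^esub>"
    then have "u x = i \<zero>\<^bsub>JA\<^esub>" using hom_zero[OF i(1) JAm J] by simp
    then obtain y where y: "y \<in> carrier A" "x = f y" "\<zero>\<^bsub>JA\<^esub> = a y"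
      using ui[OF x(1) mods_zero_closed[OF JAm]] by blast
    then have "y = \<zero>\<^bsub>A\<^esub>"
      using inj_onD[OF sA(3)] hom_zero[OF sA(1) A JAm] mods_zero_closed[OF A] by metis
    then show "x = \<zero>\<^bsub>B\<^esub>" using y(2) hom_zero[OF s(1) A B] by simp
  qed
  obtain Y \<pi> where Y: "Y \<in> mods" and sY: "ses B u J \<pi> Y"
    by (rule ex_cokernel[OF B J u(1) uinj])
  note sYD = short_exactD[OF sY]
  have "\<exists>\<alpha>\<in>mod_hom S A' Y. \<forall>x\<in>carrier JA. \<alpha> (a' x) = \<pi> (i x)"
  proof (rule factor_epi[OF mods_lmodule[OF JAm] mods_lmodule[OF A'] mods_lmodule[OF Y] sA(2,6)
        mod_hom_comp[OF i(1) sYD(2)]])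
    fix j assume j: "j \<in> carrier JA" "a' j = \<zero>\<^bsub>A'\<^esub>"
    then obtain x where x: "x \<in> carrier A" "j = a x" using sA(5)[OF j] by blast
    note fx = mod_hom_closed[OF s(1) x(1)]
    have "i j = u (f x)"
    proof (rule bD(4))
      show "p (i j) = p (u (f x))" using i(2)[OF j(1)] u(2)[OF fx] h(2)[OF x(1)] x(2) by simp
      show "q (i j) = q (u (f x))"
        using i(3)[OF j(1)] u(3)[OF fx] s(4)[OF x(1)] hom_zero[OF sC(1) C JCm] by simp
    qed (use mod_hom_closed[OF i(1) j(1)] mod_hom_closed[OF u(1) fx] in auto)
    then show "\<pi> (i j) = \<zero>\<^bsub>Y\<^esub>" using sYD(4)[OF fx] by simp
  qed
  then obtain \<alpha> where \<alpha>: "\<alpha> \<in> mod_hom S A' Y" "\<And>x. x \<in> carrier JA \<Longrightarrow> \<alpha> (a' x) = \<pi> (i x)"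
    by blast
  have "\<exists>\<beta>\<in>mod_hom S Y C'. \<forall>x\<in>carrier J. \<beta> (\<pi> x) = c' (q x)"
  proof (rule factor_epi[OF mods_lmodule[OF J] mods_lmodule[OF Y] mods_lmodule[OF C'] sYD(2,6)
        mod_hom_comp[OF bD(2) sC(2)]])
    fix x assume x: "x \<in> carrier J" "\<pi> x = \<zero>\<^bsub>Y\<^esub>"
    then obtain b where b: "b \<in> carrier B" "x = u b" using sYD(5)[OF x] by blast
    then show "c' (q x) = \<zero>\<^bsub>C'\<^esub>"
      using u(3)[OF b(1)] sC(4)[OF mod_hom_closed[OF s(2) b(1)]] by simp
  qed
  then obtain \<beta> where \<beta>: "\<beta> \<in> mod_hom S Y C'" "\<And>x. x \<in> carrier J \<Longrightarrow> \<beta> (\<pi> x) = c' (q x)"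
    by blast
  have "ses A' \<alpha> Y \<beta> C'"
  proof (rule short_exactI[OF \<alpha>(1) \<beta>(1)])
    show "inj_on \<alpha> (carrier A')"
    proof (rule mod_hom_inj_onI[OF mods_lmodule[OF A'] mods_lmodule[OF Y] \<alpha>(1)])
      fix x assume x: "x \<in> carrier A'" "\<alpha> x = \<zero>\<^bsub>Y\<^esub>"
      obtain j where j: "j \<in> carrier JA" "x = a' j" using sA(6)[OF x(1)] by blast
      then have "\<pi> (i j) = \<zero>\<^bsub>Y\<^esub>" using \<alpha>(2) x(2) by simp
      then obtain b where b: "b \<in> carrier B" "i j = u b"
        using sYD(5)[OF mod_hom_closed[OF i(1) j(1)]] by blast
      then obtain z where "z \<in> carrier A" "j = a z"
        using ui[OF b(1) j(1) b(2)[symmetric]] by blast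
      then show "x = \<zero>\<^bsub>A'\<^esub>" using j(2) sA(4) by simp
    qed
    show "\<beta> (\<alpha> x) = \<zero>\<^bsub>C'\<^esub>" if x: "x \<in> carrier A'" for x
    proof -
      obtain j where j: "j \<in> carrier JA" "x = a' j" using sA(6)[OF x] by blast
      then show ?thesis
        using \<alpha>(2)[OF j(1)] \<beta>(2)[OF mod_hom_closed[OF i(1) j(1)]] i(3)[OF j(1)]
          hom_zero[OF sC(2) JCm C'] by simp
    qed
    show "\<exists>x\<in>carrier A'. y = \<alpha> x" if y: "y \<in> carrier Y" "\<beta> y = \<zero>\<^bsub>C'\<^esub>" for y
    proof -
      obtain x where x: "x \<in> carrier J" "y = \<pi> x" using sYD(6)[OF y(1)] by blast
      note px = mod_hom_closed[OF bD(1) x(1)] and qx = mod_hom_closed[OF bD(2) x(1)]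
      have "c' (q x) = \<zero>\<^bsub>C'\<^esub>" using \<beta>(2)[OF x(1)] x(2) y(2) by simp
      then obtain z where z: "z \<in> carrier C" "q x = c z" using sC(5)[OF qx] by blast
      obtain b where b: "b \<in> carrier B" "z = g b" using s(6)[OF z(1)] by blast
      note ub = mod_hom_closed[OF u(1) b(1)]
      \<comment> \<open>Subtracting u b moves x into the summand JA without changing its image under
        \<pi>.\<close>
      let ?x = "x \<ominus>\<^bsub>J\<^esub> u b"
      have x': "?x \<in> carrier J" by (rule mods_minus_closed[OF J x(1) ub])
      have q0: "q ?x = \<zero>\<^bsub>JC\<^esub>"
        using z b u(3)[OF b(1)] qx mod_hom_closed[OF bD(2) ub]
        by (simp add: hom_minus[OF bD(2) J JCm x(1) ub] mods_minus_eq_zero[OF JCm])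
      note px' = mod_hom_closed[OF bD(1) x']
      have "?x = i (p ?x)"
        by (rule bD(4)) (simp_all add: x' px' i(2,3) q0 mod_hom_closed[OF i(1)])
      then have "\<pi> ?x = \<alpha> (a' (p ?x))" using \<alpha>(2)[OF px'] by simp
      moreover have "\<pi> ?x = y"
      proof -
        interpret Y: abelian_group Y by (rule mods_abelian_group[OF Y])
        show ?thesis
          using x sYD(4)[OF b(1)] mod_hom_closed[OF sYD(2) x(1)]
          by (simp add: hom_minus[OF sYD(2) J Y x(1) ub]) (simp add: a_minus_def)
      qed
      ultimately show ?thesis using mod_hom_closed[OF sA(2) px'] by blast
    qed
    show "\<exists>y\<in>carrier Y. z = \<beta> y" if z: "z \<in> carrier C'" for z
    proof -
      obtain w where w: "w \<in> carrier JC" "z = c' w" using sC(6)[OF z] by blast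
      obtain x where x: "x \<in> carrier J" "q x = w"
        using bD(3)[OF mods_zero_closed[OF JAm] w(1)] by blast
      then have "z = \<beta> (\<pi> x)" using \<beta>(2) w(2) by simp
      with mod_hom_closed[OF sYD(2) x(1)] show ?thesis by blast
    qed
  qed
  with sY Ji Y show ?thesis by blast
qed

text \<open>Injective modules take the part that projectives have in the usual horseshoe. The lift l
  of c' to B exists because A is \<open>inj_acyclic\<close>; together with the composite of a' and f
  it maps IA \<oplus> IC onto B.\<close>

lemma horseshoe_left:
  assumes A: "A \<in> mods" and B: "B \<in> mods" and C: "C \<in> mods" and s: "ses A f B g C"
    and IA: "IA \<in> injs" and IC: "IC \<in> injs" and KA: "KA \<in> mods" and KC: "KC \<in> mods"
    and sA: "ses KA a IA a' A" and sC: "ses KC c IC c' C" and acyc: "inj_acyclic A"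
  shows "\<exists>I\<in>injs. \<exists>K\<in>mods. \<exists>u v \<alpha> \<beta>. ses K u I v B \<and> ses KA \<alpha> K \<beta> KC"
proof -
  note sD = short_exactD[OF s] and sA = short_exactD[OF sA] and sC = short_exactD[OF sC]
  have IAm: "IA \<in> mods" and ICm: "IC \<in> mods" using IA IC by (auto intro: injs_mods)
  obtain l where l: "l \<in> mod_hom S IC B" "\<And>x. x \<in> carrier IC \<Longrightarrow> g (l x) = c' x"
    using inj_acyclicD[OF acyc s IC B C sC(2)] by blast
  obtain I p q where I: "I \<in> mods" and b: "biprod I p IA q IC"
    by (rule ex_biprod[OF IAm ICm])
  have Ii: "I \<in> injs" by (rule biprod_inj[OF I b IA IC])
  note bD = biprodD[OF b]
  interpret B: abelian_group B by (rule mods_abelian_group[OF B])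
  interpret C: abelian_group C by (rule mods_abelian_group[OF C])
  define v where "v x = f (a' (p x)) \<oplus>\<^bsub>B\<^esub> l (q x)" for x
  have v: "v \<in> mod_hom S I B"
    unfolding v_def
    by (intro mod_hom_plus[OF mods_lmodule[OF B]] mod_hom_comp[OF mod_hom_comp[OF bD(1) sA(2)] sD(1)]
        mod_hom_comp[OF bD(2) l(1)])
  have gv: "g (v x) = c' (q x)" if x: "x \<in> carrier I" for x
  proof -
    note px = mod_hom_closed[OF sA(2) mod_hom_closed[OF bD(1) x]] and qx = mod_hom_closed[OF bD(2) x]
    show ?thesis
      using sD(4)[OF px] l(2)[OF qx] mod_hom_closed[OF sC(2) qx]
      by (simp add: v_def mod_hom_add[OF sD(2) mod_hom_closed[OF sD(1) px] mod_hom_closed[OF l(1) qx]])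
  qed
  have onto: "\<exists>x\<in>carrier I. y = v x" if y: "y \<in> carrier B" for y
  proof -
    note gy = mod_hom_closed[OF sD(2) y]
    obtain w where w: "w \<in> carrier IC" "g y = c' w" using sC(6)[OF gy] by blast
    note lw = mod_hom_closed[OF l(1) w(1)]
    have "g (y \<ominus>\<^bsub>B\<^esub> l w) = \<zero>\<^bsub>C\<^esub>"
      using w l(2)[OF w(1)] gy mod_hom_closed[OF sD(2) lw]
      by (simp add: hom_minus[OF sD(2) B C y lw] mods_minus_eq_zero[OF C])
    then obtain z where z: "z \<in> carrier A" "y \<ominus>\<^bsub>B\<^esub> l w = f z"
      using sD(5)[OF mods_minus_closed[OF B y lw]] by blast
    obtain j where j: "j \<in> carrier IA" "z = a' j" using sA(6)[OF z(1)] by blast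
    obtain x where x: "x \<in> carrier I" "p x = j" "q x = w" using bD(3)[OF j(1) w(1)] by blast
    have "v x = (y \<ominus>\<^bsub>B\<^esub> l w) \<oplus>\<^bsub>B\<^esub> l w" using x z j by (simp add: v_def)
    also have "\<dots> = y" using y lw by (simp add: a_minus_def B.a_assoc B.l_neg)
    finally show ?thesis using x(1) by blast
  qed
  obtain K k where K: "K \<in> mods" and sK: "ses K k I v B"
    by (rule ex_kernel[OF I B v onto])
  note sK' = short_exactD[OF sK]
  have f0: "x = \<zero>\<^bsub>A\<^esub>" if "x \<in> carrier A" "f x = \<zero>\<^bsub>B\<^esub>" for x
    using inj_onD[OF sD(3), of x "\<zero>\<^bsub>A\<^esub>"] that hom_zero[OF sD(1) A B] mods_zero_closed[OF A] by simp
  obtain i where i: "i \<in> mod_hom S KA I" "\<And>x. x \<in> carrier KA \<Longrightarrow> p (i x) = a x"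
    "\<And>x. x \<in> carrier KA \<Longrightarrow> q (i x) = \<zero>\<^bsub>IC\<^esub>"
    using biprod_pairing[OF b I KA sA(1) mod_hom_const_zero[OF mods_lmodule[OF ICm]]] by blast
  have vi: "v (i x) = \<zero>\<^bsub>B\<^esub>" if x: "x \<in> carrier KA" for x
    using x sA(4)[OF x]
    by (simp add: v_def i hom_zero[OF sD(1) A B] hom_zero[OF l(1) ICm B])
  have "\<exists>\<alpha>\<in>mod_hom S KA K. \<forall>x\<in>carrier KA. k (\<alpha> x) = i x"
    by (rule factor_mono[OF mods_lmodule[OF KA] mods_lmodule[OF K] sK'(1,3) i(1)])
      (use sK'(5) vi mod_hom_closed[OF i(1)] in blast)
  then obtain \<alpha> where \<alpha>: "\<alpha> \<in> mod_hom S KA K" "\<And>x. x \<in> carrier KA \<Longrightarrow> k (\<alpha> x) = i x" by blast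
  have "\<exists>\<beta>\<in>mod_hom S K KC. \<forall>x\<in>carrier K. c (\<beta> x) = q (k x)"
  proof (rule factor_mono[OF mods_lmodule[OF K] mods_lmodule[OF KC] sC(1,3)
        mod_hom_comp[OF sK'(1) bD(2)]])
    fix x assume x: "x \<in> carrier K"
    note kx = mod_hom_closed[OF sK'(1) x]
    have "c' (q (k x)) = \<zero>\<^bsub>C\<^esub>"
      using gv[OF kx] sK'(4)[OF x] hom_zero[OF sD(2) B C] by simp
    then show "\<exists>z\<in>carrier KC. q (k x) = c z"
      using sC(5)[OF mod_hom_closed[OF bD(2) kx]] by blast
  qed
  then obtain \<beta> where \<beta>: "\<beta> \<in> mod_hom S K KC" "\<And>x. x \<in> carrier K \<Longrightarrow> c (\<beta> x) = q (k x)" by blast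
  have c0: "x = \<zero>\<^bsub>KC\<^esub>" if "x \<in> carrier KC" "c x = \<zero>\<^bsub>IC\<^esub>" for x
    using inj_onD[OF sC(3), of x "\<zero>\<^bsub>KC\<^esub>"] that hom_zero[OF sC(1) KC ICm] mods_zero_closed[OF KC]
    by simp
  have "ses KA \<alpha> K \<beta> KC"
  proof (rule short_exactI[OF \<alpha>(1) \<beta>(1)])
    show "inj_on \<alpha> (carrier KA)"
    proof (rule inj_onI)
      fix x y assume xy: "x \<in> carrier KA" "y \<in> carrier KA" "\<alpha> x = \<alpha> y"
      then have "i x = i y" using \<alpha>(2) by metis
      then have "a x = a y" using i(2) xy by metis
      then show "x = y" using inj_onD[OF sA(3)] xy by blast
    qed
    show "\<beta> (\<alpha> x) = \<zero>\<^bsub>KC\<^esub>" if x: "x \<in> carrier KA" for x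
      using \<alpha>(2)[OF x] \<beta>(2)[OF mod_hom_closed[OF \<alpha>(1) x]] i(3)[OF x]
      by (intro c0 mod_hom_closed[OF \<beta>(1)] mod_hom_closed[OF \<alpha>(1)] x) simp
    show "\<exists>x\<in>carrier KA. y = \<alpha> x" if y: "y \<in> carrier K" "\<beta> y = \<zero>\<^bsub>KC\<^esub>" for y
    proof -
      note ky = mod_hom_closed[OF sK'(1) y(1)]
      note pk = mod_hom_closed[OF bD(1) ky]
      have q0: "q (k y) = \<zero>\<^bsub>IC\<^esub>"
        using \<beta>(2)[OF y(1)] y(2) hom_zero[OF sC(1) KC ICm] by simp
      have "f (a' (p (k y))) = \<zero>\<^bsub>B\<^esub>"
        using sK'(4)[OF y(1)] q0 mod_hom_closed[OF sD(1) mod_hom_closed[OF sA(2) pk]]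
        by (simp add: v_def hom_zero[OF l(1) ICm B])
      then have "a' (p (k y)) = \<zero>\<^bsub>A\<^esub>"
        by (intro f0 mod_hom_closed[OF sA(2)] pk)
      then obtain x where x: "x \<in> carrier KA" "p (k y) = a x" using sA(5)[OF pk] by blast
      have "k y = i x"
        by (rule bD(4)) (simp_all add: i(2,3)[OF x(1)] x q0 ky mod_hom_closed[OF i(1)])
      then have "k y = k (\<alpha> x)" using \<alpha>(2)[OF x(1)] by simp
      then have "y = \<alpha> x"
        using inj_onD[OF sK'(3)] y(1) mod_hom_closed[OF \<alpha>(1) x(1)] by blast
      with x(1) show ?thesis by blast
    qed
    show "\<exists>y\<in>carrier K. z = \<beta> y" if z: "z \<in> carrier KC" for z
    proof -
      note cz = mod_hom_closed[OF sC(1) z]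
      note lz = mod_hom_closed[OF l(1) cz]
      have "g (l (c z)) = \<zero>\<^bsub>C\<^esub>" using l(2)[OF cz] sC(4)[OF z] by simp
      then obtain w where w: "w \<in> carrier A" "l (c z) = f w" using sD(5)[OF lz] by blast
      obtain j where j: "j \<in> carrier IA" "w = a' j" using sA(6)[OF w(1)] by blast
      interpret IA: abelian_group IA by (rule mods_abelian_group[OF IAm])
      \<comment> \<open>l (c z) comes from A and equals f (a' j); the sign in the first coordinate
        cancels it, so that v x = 0 and x lies in K.\<close>
      obtain x where x: "x \<in> carrier I" "p x = \<ominus>\<^bsub>IA\<^esub> j" "q x = c z"
        using bD(3)[OF IA.a_inv_closed[OF j(1)] cz] by blast
      have "v x = \<ominus>\<^bsub>B\<^esub> f w \<oplus>\<^bsub>B\<^esub> f w"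
        using x w j mod_hom_a_inv[OF mods_abelian_group[OF IAm] mods_abelian_group[OF B]
            mod_hom_comp[OF sA(2) sD(1)] j(1)] by (simp add: v_def)
      then have "v x = \<zero>\<^bsub>B\<^esub>" using mod_hom_closed[OF sD(1) w(1)] by (simp add: B.l_neg)
      then obtain y where y: "y \<in> carrier K" "x = k y" using sK'(5)[OF x(1)] by blast
      have "c (\<beta> y) = c z" using \<beta>(2)[OF y(1)] y(2) x(3) by simp
      then have "z = \<beta> y"
        using inj_onD[OF sC(3)] z mod_hom_closed[OF \<beta>(1) y(1)] by metis
      with y(1) show ?thesis by blast
    qed
  qed
  with sK Ii K show ?thesis by blast
qed

section \<open>Closure under extensions and direct summands\<close>

text \<open>The middle terms of extensions of Gorenstein injectives form a coclosed class: the two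
  horseshoes have a cokernel and a kernel that are again such middle terms.\<close>

lemma gi_ext:
  assumes "ses A f B g C" "A \<in> gis" "C \<in> gis" "B \<in> mods"
  shows "B \<in> gis"
proof -
  let ?G = "{B\<in>mods. \<exists>A\<in>gis. \<exists>C\<in>gis. \<exists>f g. ses A f B g C}"
  have "gi_coclosed ?G"
    unfolding gi_coclosed_def
  proof (intro conjI ballI)
    fix B assume "B \<in> ?G"
    then obtain A C f g where B: "B \<in> mods" and A: "A \<in> gis" and C: "C \<in> gis" and s: "ses A f B g C"
      by blast
    note Am = gis_mods[OF A] and Cm = gis_mods[OF C]
    show "inj_acyclic B"
      by (rule inj_acyclic_ext[OF Am B Cm s gisD(1)[OF A] gisD(1)[OF C]])
    obtain JA A' a a' where JA: "JA \<in> injs" "A' \<in> gis" "ses A a JA a' A'"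
      using gisD(2)[OF A] by blast
    obtain JC C' c c' where JC: "JC \<in> injs" "C' \<in> gis" "ses C c JC c' C'"
      using gisD(2)[OF C] by blast
    show "\<exists>J\<in>injs. \<exists>M'\<in>?G. \<exists>f g. ses B f J g M'"
      using horseshoe_right[OF B s JA(1) JC(1) gis_mods[OF JA(2)] gis_mods[OF JC(2)] Am Cm JA(3) JC(3)]
        JA(2) JC(2) by blast
    obtain IA KA a a' where IA: "IA \<in> injs" "KA \<in> gis" "ses KA a IA a' A"
      using gisD(3)[OF A] by blast
    obtain IC KC c c' where IC: "IC \<in> injs" "KC \<in> gis" "ses KC c IC c' C"
      using gisD(3)[OF C] by blast
    show "\<exists>I\<in>injs. \<exists>K\<in>?G. \<exists>f g. ses K f I g B"
      using horseshoe_left[OF Am B Cm s IA(1) IC(1) gis_mods[OF IA(2)] gis_mods[OF IC(2)]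
          IA(3) IC(3) gisD(1)[OF A]] IA(2) IC(2) by blast
  qed blast
  from gi_coinduct[OF this] assms show ?thesis by blast
qed

text \<open>With \<open>M \<cong> N \<oplus> N'\<close>, the cokernel of \<open>N \<rightarrow> M \<rightarrow> J\<close> becomes, after
  adding \<open>N\<close>, an extension of Gorenstein injective modules, and dually for the kernel of
  \<open>I \<rightarrow> M \<rightarrow> N\<close>. Hence the summands of Gorenstein injective modules form a coclosed class.\<close>

lemma gi_summand:
  assumes "biprod M p N q N'" "M \<in> gis" "N \<in> mods" "N' \<in> mods"
  shows "N \<in> gis"
proof -
  let ?G = "{N\<in>mods. \<exists>N'\<in>mods. \<exists>M\<in>gis. \<exists>p q. biprod M p N q N'}"
  have "gi_coclosed ?G"
    unfolding gi_coclosed_def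
  proof (intro conjI ballI)
    fix N assume "N \<in> ?G"
    then obtain N' M p q where N: "N \<in> mods" and N': "N' \<in> mods" and Mg: "M \<in> gis"
      and b: "biprod M p N q N'" by blast
    have M: "M \<in> mods" by (rule gis_mods[OF Mg])
    note bD = biprodD[OF b]
    obtain i where i: "i \<in> mod_hom S N M" "\<And>x. x \<in> carrier N \<Longrightarrow> p (i x) = x"
      "\<And>x. x \<in> carrier N \<Longrightarrow> q (i x) = \<zero>\<^bsub>N'\<^esub>"
      using biprod_pairing[OF b M N mod_hom_id mod_hom_const_zero[OF mods_lmodule[OF N']]] by blast
    have iinj: "inj_on i (carrier N)" by (rule inj_onI) (metis i(2))
    interpret M: abelian_group M by (rule mods_abelian_group[OF M])
    interpret N: abelian_group N by (rule mods_abelian_group[OF N])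
    show "inj_acyclic N"
      unfolding inj_acyclic_def
    proof (intro ballI allI impI)
      fix E X Y f g \<phi> assume E: "E \<in> injs" and X: "X \<in> mods" and Y: "Y \<in> mods"
        and s: "ses N f X g Y" and \<phi>: "\<phi> \<in> mod_hom S E Y"
      note s = short_exactD[OF s]
      \<comment> \<open>Adding N' turns the extension X of Y by N into an extension of Y by M = N
        \<oplus> N', to which acyclicity of M applies.\<close>
      obtain P p' q' where P: "P \<in> mods" and b': "biprod P p' X q' N'" by (rule ex_biprod[OF X N'])
      note bD' = biprodD[OF b']
      obtain w where w: "w \<in> mod_hom S M P" "\<And>x. x \<in> carrier M \<Longrightarrow> p' (w x) = f (p x)"
        "\<And>x. x \<in> carrier M \<Longrightarrow> q' (w x) = q x"
        using biprod_pairing[OF b' P M mod_hom_comp[OF bD(1) s(1)] bD(2)] by blast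
      have "ses M w P (\<lambda>x. g (p' x)) Y"
      proof (rule short_exactI[OF w(1) mod_hom_comp[OF bD'(1) s(2)]])
        show "inj_on w (carrier M)"
        proof (rule inj_onI)
          fix x y assume xy: "x \<in> carrier M" "y \<in> carrier M" "w x = w y"
          then have "f (p x) = f (p y)" "q x = q y" using w(2,3) by metis+
          then have "p x = p y" using inj_onD[OF s(3)] mod_hom_closed[OF bD(1)] xy by blast
          with \<open>q x = q y\<close> show "x = y" using bD(4) xy by blast
        qed
        show "g (p' (w x)) = \<zero>\<^bsub>Y\<^esub>" if "x \<in> carrier M" for x
          using that w(2) s(4) mod_hom_closed[OF bD(1)] by simp
        show "\<exists>x\<in>carrier M. y = w x" if y: "y \<in> carrier P" "g (p' y) = \<zero>\<^bsub>Y\<^esub>" for y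
        proof -
          obtain n where n: "n \<in> carrier N" "p' y = f n"
            using s(5)[OF mod_hom_closed[OF bD'(1) y(1)] y(2)] by blast
          obtain x where x: "x \<in> carrier M" "p x = n" "q x = q' y"
            using bD(3)[OF n(1) mod_hom_closed[OF bD'(2) y(1)]] by blast
          have "y = w x"
            by (rule bD'(4)) (simp_all add: w(2,3)[OF x(1)] x n y mod_hom_closed[OF w(1)])
          with x(1) show ?thesis by blast
        qed
        show "\<exists>y\<in>carrier P. z = g (p' y)" if z: "z \<in> carrier Y" for z
        proof -
          obtain x where x: "x \<in> carrier X" "z = g x" using s(6)[OF z] by blast
          obtain y where "y \<in> carrier P" "p' y = x"
            using bD'(3)[OF x(1) mods_zero_closed[OF N']] by blast
          with x show ?thesis by blast
        qed
      qed
      from inj_acyclicD[OF gisD(1)[OF Mg] this E P Y \<phi>]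
      obtain \<psi> where \<psi>: "\<psi> \<in> mod_hom S E P" "\<forall>x\<in>carrier E. g (p' (\<psi> x)) = \<phi> x" by blast
      show "\<exists>\<psi>\<in>mod_hom S E X. \<forall>x\<in>carrier E. g (\<psi> x) = \<phi> x"
        by (rule bexI[OF _ mod_hom_comp[OF \<psi>(1) bD'(1)]]) (use \<psi>(2) in blast)
    qed
    show "\<exists>J\<in>injs. \<exists>M'\<in>?G. \<exists>f g. ses N f J g M'"
    proof -
      obtain J M' j g where J: "J \<in> injs" and M'g: "M' \<in> gis" and s: "ses M j J g M'"
        using gisD(2)[OF Mg] by blast
      note s = short_exactD[OF s]
      have Jm: "J \<in> mods" and M': "M' \<in> mods" using J M'g by (auto intro: injs_mods gis_mods)
      have inj: "inj_on (\<lambda>x. j (i x)) (carrier N)"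
        using comp_inj_on[OF iinj inj_on_subset[OF s(3)]] mod_hom_closed[OF i(1)]
        by (auto simp: comp_def)
      obtain Y \<pi> where Y: "Y \<in> mods" and sY: "ses N (\<lambda>x. j (i x)) J \<pi> Y"
        by (rule ex_cokernel[OF N Jm mod_hom_comp[OF i(1) s(1)] inj])
      note sY' = short_exactD[OF sY]
      have "\<exists>g'\<in>mod_hom S Y M'. \<forall>x\<in>carrier J. g' (\<pi> x) = g x"
        by (rule factor_epi[OF mods_lmodule[OF Jm] mods_lmodule[OF Y] mods_lmodule[OF M'] sY'(2,6) s(2)])
          (auto dest!: sY'(5) simp: s(4) mod_hom_closed[OF i(1)])
      then obtain g' where g': "g' \<in> mod_hom S Y M'" "\<And>x. x \<in> carrier J \<Longrightarrow> g' (\<pi> x) = g x" by blast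
      \<comment> \<open>M embeds into Y \<oplus> N by the pair of \<pi> j and p, with cokernel M'.
        So Y \<oplus> N is an extension of Gorenstein injectives, and Y is a summand of it.\<close>
      obtain Z py pn where Z: "Z \<in> mods" and bZ: "biprod Z py Y pn N" by (rule ex_biprod[OF Y N])
      note bZ' = biprodD[OF bZ]
      obtain w where w: "w \<in> mod_hom S M Z" "\<And>x. x \<in> carrier M \<Longrightarrow> py (w x) = \<pi> (j x)"
        "\<And>x. x \<in> carrier M \<Longrightarrow> pn (w x) = p x"
        using biprod_pairing[OF bZ Z M mod_hom_comp[OF s(1) sY'(2)] bD(1)] by blast
      have "ses M w Z (\<lambda>x. g' (py x)) M'"
      proof (rule short_exactI[OF w(1) mod_hom_comp[OF bZ'(1) g'(1)]])
        show "inj_on w (carrier M)"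
        proof (rule mod_hom_inj_onI[OF mods_lmodule[OF M] mods_lmodule[OF Z] w(1)])
          fix x assume x: "x \<in> carrier M" "w x = \<zero>\<^bsub>Z\<^esub>"
          have "\<pi> (j x) = \<zero>\<^bsub>Y\<^esub>" and p0: "p x = \<zero>\<^bsub>N\<^esub>"
            using w(2,3)[OF x(1)] x(2) hom_zero[OF bZ'(1) Z Y] hom_zero[OF bZ'(2) Z N] by auto
          then obtain n where n: "n \<in> carrier N" "j x = j (i n)"
            using sY'(5)[OF mod_hom_closed[OF s(1) x(1)]] by blast
          then have "x = i n" using inj_onD[OF s(3)] x(1) mod_hom_closed[OF i(1)] by blast
          with p0 i(2)[OF n(1)] show "x = \<zero>\<^bsub>M\<^esub>" using hom_zero[OF i(1) N M] by simp
        qed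
        show "g' (py (w x)) = \<zero>\<^bsub>M'\<^esub>" if x: "x \<in> carrier M" for x
          using w(2)[OF x] g'(2)[OF mod_hom_closed[OF s(1) x]] s(4)[OF x] by simp
        show "\<exists>x\<in>carrier M. z = w x" if z: "z \<in> carrier Z" "g' (py z) = \<zero>\<^bsub>M'\<^esub>" for z
        proof -
          obtain t where t: "t \<in> carrier J" "py z = \<pi> t"
            using sY'(6)[OF mod_hom_closed[OF bZ'(1) z(1)]] by blast
          then have "g t = \<zero>\<^bsub>M'\<^esub>" using g'(2) z(2) by simp
          then obtain m where m: "m \<in> carrier M" "t = j m" using s(5)[OF t(1)] by blast
          note pm = mod_hom_closed[OF bD(1) m(1)] and pnz = mod_hom_closed[OF bZ'(2) z(1)]
          \<comment> \<open>m already has the right image in Y. Adding i d corrects the coordinate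
            in N and keeps that image, because \<pi> j kills i N.\<close>
          define d where "d = pn z \<ominus>\<^bsub>N\<^esub> p m"
          have d: "d \<in> carrier N" unfolding d_def using pm pnz by simp
          note id = mod_hom_closed[OF i(1) d]
          have "p (m \<oplus>\<^bsub>M\<^esub> i d) = pn z"
            using m(1) pm pnz id i(2)[OF d] N.a_lcomm[OF pm pnz N.a_inv_closed[OF pm]]
            by (simp add: mod_hom_add[OF bD(1)] N.r_neg) (simp add: d_def a_minus_def N.r_neg)
          moreover have "\<pi> (j (m \<oplus>\<^bsub>M\<^esub> i d)) = \<pi> t"
          proof -
            interpret Y: abelian_group Y by (rule mods_abelian_group[OF Y])
            have "\<pi> (j (m \<oplus>\<^bsub>M\<^esub> i d)) = \<pi> (j m) \<oplus>\<^bsub>Y\<^esub> \<pi> (j (i d))"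
              using m(1) id
              by (simp add: mod_hom_add[OF s(1)] mod_hom_add[OF sY'(2)] mod_hom_closed[OF s(1)])
            then show ?thesis
              using sY'(4)[OF d] m t mod_hom_closed[OF sY'(2)] by simp
          qed
          ultimately have "z = w (m \<oplus>\<^bsub>M\<^esub> i d)"
            using w(2,3)[of "m \<oplus>\<^bsub>M\<^esub> i d"] m(1) id t(2) z(1)
            by (intro bZ'(4)[of z "w (m \<oplus>\<^bsub>M\<^esub> i d)"]) (simp_all add: mod_hom_closed[OF w(1)])
          then show ?thesis using m(1) id M.a_closed by blast
        qed
        show "\<exists>y\<in>carrier Z. z = g' (py y)" if z: "z \<in> carrier M'" for z
        proof -
          obtain x where x: "x \<in> carrier J" "z = g x" using s(6)[OF z] by blast
          obtain y where "y \<in> carrier Z" "py y = \<pi> x"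
            using bZ'(3)[OF mod_hom_closed[OF sY'(2) x(1)] mods_zero_closed[OF N]] by blast
          with x g'(2) show ?thesis by metis
        qed
      qed
      then have "Z \<in> gis" by (rule gi_ext[OF _ Mg M'g Z])
      then have "Y \<in> ?G" using Y N bZ by blast
      with J sY show ?thesis by blast
    qed
    show "\<exists>I\<in>injs. \<exists>K\<in>?G. \<exists>f g. ses K f I g N"
    proof -
      obtain I K k g where I: "I \<in> injs" and Kg: "K \<in> gis" and s: "ses K k I g M"
        using gisD(3)[OF Mg] by blast
      note s = short_exactD[OF s]
      have Im: "I \<in> mods" and K: "K \<in> mods" using I Kg by (auto intro: injs_mods gis_mods)
      have onto: "\<exists>y\<in>carrier I. z = p (g y)" if z: "z \<in> carrier N" for z
        using s(6)[OF mod_hom_closed[OF i(1) z]] i(2)[OF z] by metis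
      obtain X x0 where X: "X \<in> mods" and sX: "ses X x0 I (\<lambda>x. p (g x)) N"
        by (rule ex_kernel[OF Im N mod_hom_comp[OF s(2) bD(1)] onto])
      note sX' = short_exactD[OF sX]
      \<comment> \<open>The map (x, n) to i n + g x from X \<oplus> N to M is surjective with kernel
        K, so X \<oplus> N is an extension of Gorenstein injectives.\<close>
      obtain Z px pn where Z: "Z \<in> mods" and bZ: "biprod Z px X pn N" by (rule ex_biprod[OF X N])
      note bZ' = biprodD[OF bZ]
      have "\<exists>k'\<in>mod_hom S K X. \<forall>y\<in>carrier K. x0 (k' y) = k y"
      proof (rule factor_mono[OF mods_lmodule[OF K] mods_lmodule[OF X] sX'(1,3) s(1)])
        show "\<exists>a\<in>carrier X. k y = x0 a" if y: "y \<in> carrier K" for y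
          by (rule sX'(5)[OF mod_hom_closed[OF s(1) y]]) (simp add: s(4)[OF y] hom_zero[OF bD(1) M N])
      qed
      then obtain k' where k': "k' \<in> mod_hom S K X" "\<And>y. y \<in> carrier K \<Longrightarrow> x0 (k' y) = k y" by blast
      obtain u where u: "u \<in> mod_hom S K Z" "\<And>y. y \<in> carrier K \<Longrightarrow> px (u y) = k' y"
        "\<And>y. y \<in> carrier K \<Longrightarrow> pn (u y) = \<zero>\<^bsub>N\<^esub>"
        using biprod_pairing[OF bZ Z K k'(1) mod_hom_const_zero[OF mods_lmodule[OF N]]] by blast
      define v where "v z = i (pn z) \<oplus>\<^bsub>M\<^esub> g (x0 (px z))" for z
      have gx: "(\<lambda>z. g (x0 (px z))) \<in> mod_hom S Z M"
        by (rule mod_hom_comp[OF mod_hom_comp[OF bZ'(1) sX'(1)] s(2)])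
      have v: "v \<in> mod_hom S Z M"
        unfolding v_def
        by (intro mod_hom_plus[OF mods_lmodule[OF M]] gx mod_hom_comp[OF bZ'(2) i(1)])
      have "ses K u Z v M"
      proof (rule short_exactI[OF u(1) v])
        show "inj_on u (carrier K)"
        proof (rule inj_onI)
          fix x y assume xy: "x \<in> carrier K" "y \<in> carrier K" "u x = u y"
          then have "k' x = k' y" using u(2) by metis
          then have "k x = k y" using k'(2) xy by metis
          then show "x = y" using inj_onD[OF s(3)] xy by blast
        qed
        show "v (u y) = \<zero>\<^bsub>M\<^esub>" if y: "y \<in> carrier K" for y
          using s(4)[OF y] by (simp add: v_def u(2,3)[OF y] k'(2)[OF y] hom_zero[OF i(1) N M])
        show "\<exists>y\<in>carrier K. z = u y" if z: "z \<in> carrier Z" "v z = \<zero>\<^bsub>M\<^esub>" for z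
        proof -
          note pz = mod_hom_closed[OF bZ'(1) z(1)] and nz = mod_hom_closed[OF bZ'(2) z(1)]
          have "p (v z) = pn z \<oplus>\<^bsub>N\<^esub> p (g (x0 (px z)))"
            using nz mod_hom_closed[OF gx z(1)] mod_hom_closed[OF i(1) nz] i(2)[OF nz]
            by (simp add: v_def mod_hom_add[OF bD(1)])
          then have n0: "pn z = \<zero>\<^bsub>N\<^esub>"
            using sX'(4)[OF pz] z(2) hom_zero[OF bD(1) M N] nz by simp
          then have "g (x0 (px z)) = \<zero>\<^bsub>M\<^esub>"
            using z mod_hom_closed[OF gx z(1)] by (simp add: v_def hom_zero[OF i(1) N M])
          then obtain y where y: "y \<in> carrier K" "x0 (px z) = k y"
            using s(5)[OF mod_hom_closed[OF sX'(1) pz]] by blast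
          then have "x0 (px z) = x0 (k' y)" using k'(2) by simp
          then have "px z = k' y"
            using inj_onD[OF sX'(3)] pz mod_hom_closed[OF k'(1) y(1)] by blast
          then have "z = u y"
            by (intro bZ'(4)[of z "u y"]) (simp_all add: u(2,3)[OF y(1)] n0 z(1) mod_hom_closed[OF u(1) y(1)])
          with y(1) show ?thesis by blast
        qed
        show "\<exists>y\<in>carrier Z. m = v y" if m: "m \<in> carrier M" for m
        proof -
          note pm = mod_hom_closed[OF bD(1) m]
          note ipm = mod_hom_closed[OF i(1) pm]
          obtain t where t: "t \<in> carrier I" "m \<ominus>\<^bsub>M\<^esub> i (p m) = g t"
            using s(6)[OF mods_minus_closed[OF M m ipm]] by blast
          have "p (g t) = \<zero>\<^bsub>N\<^esub>"
            using pm i(2)[OF pm] by (simp flip: t(2) add: hom_minus[OF bD(1) M N m ipm] mods_minus_eq_zero[OF N])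
          then obtain x where x: "x \<in> carrier X" "t = x0 x" using sX'(5)[OF t(1)] by blast
          obtain z where z: "z \<in> carrier Z" "px z = x" "pn z = p m" using bZ'(3)[OF x(1) pm] by blast
          have "v z = i (p m) \<oplus>\<^bsub>M\<^esub> (m \<ominus>\<^bsub>M\<^esub> i (p m))" using z x t(2) by (simp add: v_def)
          also have "\<dots> = m"
            using m ipm M.a_lcomm[OF ipm m M.a_inv_closed[OF ipm]] by (simp add: a_minus_def M.r_neg)
          finally show ?thesis using z(1) by blast
        qed
      qed
      then have "Z \<in> gis" by (rule gi_ext[OF _ Kg Mg Z])
      then have "X \<in> ?G" using X N bZ by blast
      with I sX show ?thesis by blast
    qed
  qed blast
  from gi_coinduct[OF this] assms show ?thesis by blast
qed

lemma summand_closed_gis: "summand_closed S gis"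
  unfolding summand_closed_def
proof (intro ballI impI)
  fix M N N' assume M: "M \<in> gis" and N: "N \<in> mods" and N': "N' \<in> mods"
    and "mod_iso S M (direct_sum N N')"
  then obtain \<theta> where \<theta>: "\<theta> \<in> mod_hom S M (direct_sum N N')"
    "bij_betw \<theta> (carrier M) (carrier N \<times> carrier N')"
    by (auto simp: mod_iso_def direct_sum_def)
  have "fst \<in> mod_hom S (direct_sum N N') N" "snd \<in> mod_hom S (direct_sum N N') N'"
    by (auto intro!: mod_homI simp: direct_sum_def)
  note pq = mod_hom_comp[OF \<theta>(1) this(1)] mod_hom_comp[OF \<theta>(1) this(2)]
  have "biprod M (\<lambda>x. fst (\<theta> x)) N (\<lambda>x. snd (\<theta> x)) N'"
    unfolding biprod_def
  proof (intro conjI ballI impI pq)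
    fix a b assume "a \<in> carrier N" "b \<in> carrier N'"
    then have "(a, b) \<in> \<theta> ` carrier M"
      using \<theta>(2) by (simp add: bij_betw_def)
    then show "\<exists>x\<in>carrier M. fst (\<theta> x) = a \<and> snd (\<theta> x) = b" by (metis fst_conv imageE snd_conv)
  next
    fix x y assume "x \<in> carrier M" "y \<in> carrier M" "fst (\<theta> x) = fst (\<theta> y)" "snd (\<theta> x) = snd (\<theta> y)"
    then show "x = y"
      using \<theta>(2) by (auto simp: bij_betw_def inj_on_def prod_eq_iff)
  qed
  from gi_summand[OF this M N N'] show "N \<in> gis" .
qed


section \<open>Gorenstein injective dimension\<close>

text \<open>\<open>cosyz X k\<close> consists of the modules with a \<open>k\<close>-th cosyzygy in
  \<open>X\<close>: for \<open>X = GI\<close> these are the modules of Gorenstein injective dimension at most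
  \<open>k\<close>, for \<open>X = {0}\<close> those of injective dimension less than \<open>k\<close>.\<close>

primrec cosyz :: "('r, 'u) module set \<Rightarrow> nat \<Rightarrow> ('r, 'u) module set" where
  "cosyz X 0 = X"
| "cosyz X (Suc k) = {M\<in>mods. \<exists>J\<in>injs. \<exists>M'\<in>cosyz X k. \<exists>f g. ses M f J g M'}"

definition zeros :: "('r, 'u) module set" where
  "zeros = {Z\<in>mods. carrier Z = {\<zero>\<^bsub>Z\<^esub>}}"

lemma cosyz_mods: "X \<subseteq> mods \<Longrightarrow> cosyz X k \<subseteq> mods"
  by (cases k) auto

lemma cosyz_gis_mods: "M \<in> cosyz gis k \<Longrightarrow> M \<in> mods"
  using cosyz_mods[of gis k] gis_mods by blast

lemma cosyz_zeros_mods: "M \<in> cosyz zeros k \<Longrightarrow> M \<in> mods"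
  using cosyz_mods[of zeros k] by (auto simp: zeros_def)

lemma cosyz_mono: "X \<subseteq> Y \<Longrightarrow> cosyz X k \<subseteq> cosyz Y k"
proof (induction k)
  case (Suc k)
  then show ?case by (simp add: subset_iff) metis
qed simp

lemma zeros_gis: "zeros \<subseteq> gis"
  using zero_inj injs_gis by (auto simp: zeros_def)

text \<open>By the horseshoe, a first cosyzygy of B can be chosen as an extension of first
  cosyzygies of C and A.\<close>

lemma cosyz_gis_ext:
  "\<lbrakk>ses A f B g C; A \<in> cosyz gis k; C \<in> cosyz gis k; B \<in> mods\<rbrakk> \<Longrightarrow> B \<in> cosyz gis k"
proof (induction k arbitrary: A B C f g)
  case 0
  then show ?case using gi_ext by simp
next
  case (Suc k)
  obtain JA A' a a' where A: "JA \<in> injs" "A' \<in> cosyz gis k" "ses A a JA a' A'" "A \<in> mods"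
    using Suc.prems by auto
  obtain JC C' c c' where C: "JC \<in> injs" "C' \<in> cosyz gis k" "ses C c JC c' C'" "C \<in> mods"
    using Suc.prems by auto
  obtain J Y u \<pi> \<alpha> \<beta> where JY: "J \<in> injs" "Y \<in> mods" "ses B u J \<pi> Y" "ses A' \<alpha> Y \<beta> C'"
    using horseshoe_right[OF Suc.prems(4,1) A(1) C(1) cosyz_gis_mods[OF A(2)] cosyz_gis_mods[OF C(2)]
        A(4) C(4) A(3) C(3)] by blast
  have "Y \<in> cosyz gis k" by (rule Suc.IH[OF JY(4) A(2) C(2) JY(2)])
  with JY Suc.prems(4) show ?case by auto
qed

text \<open>Only the inclusion of level 0 in level 1 has to be known; the recursion propagates
  it.\<close>

lemma cosyz_le:
  assumes "X \<subseteq> cosyz X (Suc 0)" "k \<le> l"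
  shows "cosyz X k \<subseteq> cosyz X l"
proof (rule lift_Suc_mono_le[where f = "cosyz X"])
  show "cosyz X k \<subseteq> cosyz X (Suc k)" for k
  proof (induction k)
    case (Suc k)
    show ?case
    proof
      fix M assume "M \<in> cosyz X (Suc k)"
      then obtain J M' f g where "M \<in> mods" "J \<in> injs" "M' \<in> cosyz X k" "ses M f J g M'" by auto
      moreover from this(3) Suc have "M' \<in> cosyz X (Suc k)" by blast
      ultimately show "M \<in> cosyz X (Suc (Suc k))" unfolding cosyz.simps(2)[of X "Suc k"] by blast
    qed
  qed (simp only: cosyz.simps(1) assms(1))
qed (rule assms(2))

lemma cosyz_gis_le: "k \<le> l \<Longrightarrow> cosyz gis k \<subseteq> cosyz gis l"
proof (rule cosyz_le)
  show "gis \<subseteq> cosyz gis (Suc 0)" using gisD(2) gis_mods by (auto; blast)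
qed

lemma cosyz_zeros_le: "k \<le> l \<Longrightarrow> cosyz zeros k \<subseteq> cosyz zeros l"
proof (rule cosyz_le, rule subsetI)
  fix Z assume "Z \<in> zeros"
  then have Z: "Z \<in> mods" "carrier Z = {\<zero>\<^bsub>Z\<^esub>}" by (auto simp: zeros_def)
  from short_exact_id[OF mods_lmodule[OF Z(1)] mods_lmodule[OF Z(1)] Z(2)] zero_inj[OF Z]
  show "Z \<in> cosyz zeros (Suc 0)" using Z by (auto simp: zeros_def)
qed

section \<open>Dimension shifting and approximation\<close>

text \<open>The first term may be Gorenstein injective in place of injective: with G embedded into
  an injective J, the quotient J/M is an extension of J/G by G/M, and J/G is again Gorenstein
  injective.\<close>

lemma cosyz_gis_step:
  assumes M: "M \<in> mods" and s: "ses M a G b M'" and G: "G \<in> gis" and M': "M' \<in> cosyz gis k"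
  shows "M \<in> cosyz gis (Suc k)"
proof -
  note Gm = gis_mods[OF G]
  obtain J G' j g where J: "J \<in> injs" and G': "G' \<in> gis" and sG: "ses G j J g G'"
    using gisD(2)[OF G] by blast
  note Jm = injs_mods[OF J]
  note sD = short_exactD[OF s] and sG' = short_exactD[OF sG]
  have inj: "inj_on (\<lambda>x. j (a x)) (carrier M)"
    by (rule inj_onI) (metis sD(1,3) sG'(3) inj_onD mod_hom_closed)
  obtain Z q where Z: "Z \<in> mods" and sZ: "ses M (\<lambda>x. j (a x)) J q Z"
    by (rule ex_cokernel[OF M Jm mod_hom_comp[OF sD(1) sG'(1)] inj])
  obtain u v where "ses M' u Z v G'"
    using noether[OF mods_lmodule[OF M] mods_lmodule[OF Gm] mods_lmodule[OF cosyz_gis_mods[OF M']]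
        mods_lmodule[OF Jm] mods_lmodule[OF gis_mods[OF G']] mods_lmodule[OF Z] s sG sZ] by blast
  moreover have "G' \<in> cosyz gis k" using G' cosyz_gis_le[of 0 k] by auto
  ultimately have "Z \<in> cosyz gis k" by (rule cosyz_gis_ext[OF _ M' _ Z])
  with M J sZ show ?thesis by auto
qed

text \<open>Dual form of the Auslander-Buchweitz approximation. Once M' = J/M embeds into a
  Gorenstein injective B with cokernel L, two pullbacks carry the approximation from M' over to
  M.\<close>

lemma cosyz_gis_approx:
  "M \<in> cosyz gis k \<Longrightarrow> \<exists>B\<in>gis. \<exists>L\<in>cosyz zeros k. \<exists>f g. ses M f B g L"
proof (induction k arbitrary: M)
  case 0
  obtain Z where Z: "Z \<in> mods" "carrier Z = {\<zero>\<^bsub>Z\<^esub>}" by (rule zero_module)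
  have "M \<in> gis" using 0 by simp
  moreover have "ses M (\<lambda>x. x) M (\<lambda>x. \<zero>\<^bsub>Z\<^esub>) Z"
    by (intro short_exact_id mods_lmodule gis_mods Z calculation)
  ultimately show ?case using Z by (auto simp: zeros_def)
next
  case (Suc k)
  then obtain J M' a b where M: "M \<in> mods" and J: "J \<in> injs" and M'k: "M' \<in> cosyz gis k"
    and s: "ses M a J b M'" by auto
  note M' = cosyz_gis_mods[OF M'k] and Jm = injs_mods[OF J]
  obtain B L f g where B: "B \<in> gis" and L: "L \<in> cosyz zeros k" and sB: "ses M' f B g L"
    using Suc.IH[OF M'k] by blast
  note Bm = gis_mods[OF B] and Lm = cosyz_zeros_mods[OF L]
  obtain I K c d where I: "I \<in> injs" and K: "K \<in> gis" and sK: "ses K c I d B"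
    using gisD(3)[OF B] by blast
  note Im = injs_mods[OF I] and Km = gis_mods[OF K]
  note sD = short_exactD[OF s] and sBD = short_exactD[OF sB] and sKD = short_exactD[OF sK]
  \<comment> \<open>P is the preimage of M' under I -> B. It maps onto M' with kernel K, and its
    cokernel in the injective module I is L, so P lies one level above L.\<close>
  obtain P p q where P: "P \<in> mods" and pb: "pullback S P p I d q M' f"
    by (rule ex_pullback[OF Im M' Bm sKD(2) sBD(1)])
  obtain k' where sP: "ses K k' P q M'"
    using pullback_short_exact_kernel[OF mods_lmodule[OF Km] mods_lmodule[OF Im] mods_lmodule[OF M']
        mods_lmodule[OF Bm] mods_lmodule[OF P] pb sK sBD(1)] by blast
  have "ses P p I (\<lambda>x. g (d x)) L"
    by (rule pullback_short_exact_quotient[OF mods_lmodule[OF P] mods_lmodule[OF Im]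
          mods_lmodule[OF M'] mods_lmodule[OF Bm] mods_lmodule[OF Lm] pb sKD(2,6) sB])
  with P I L have PL: "P \<in> cosyz zeros (Suc k)" by auto
  note sPD = short_exactD[OF sP]
  \<comment> \<open>X is seen from both sides: over J its kernel is K, which makes it Gorenstein
    injective; over P its kernel is M, which is the wanted embedding.\<close>
  obtain X s t where X: "X \<in> mods" and pbX: "pullback S X s P q t J b"
    by (rule ex_pullback[OF P Jm M' sPD(2) sD(2)])
  obtain k'' where "ses K k'' X t J"
    using pullback_short_exact_kernel[OF mods_lmodule[OF Km] mods_lmodule[OF P] mods_lmodule[OF Jm]
        mods_lmodule[OF M'] mods_lmodule[OF X] pbX sP sD(2)] by blast
  then have "X \<in> gis" using gi_ext K J injs_gis X by blast
  moreover obtain a' where "ses M a' X s P"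
    using pullback_short_exact_kernel[OF mods_lmodule[OF M] mods_lmodule[OF Jm] mods_lmodule[OF P]
        mods_lmodule[OF M'] mods_lmodule[OF X] pullback_sym[OF pbX] s sPD(2)] by blast
  ultimately show ?case using PL by blast
qed

text \<open>A/C is an extension of L = A/M by Q = M/C and so lies in level \<open>max n m\<close>;
  going from A/C back to C costs one more level.\<close>

lemma cosyz_gis_from_extension:
  assumes C: "C \<in> mods" and M: "M \<in> mods" and s: "ses C a M b Q" and sM: "ses M f A g L"
    and A: "A \<in> gis" and L: "L \<in> cosyz zeros n" and Q: "Q \<in> cosyz gis m"
  shows "C \<in> cosyz gis (Suc (max n m))"
proof -
  note sD = short_exactD[OF s] and sM' = short_exactD[OF sM]
  note Am = gis_mods[OF A]
  have inj: "inj_on (\<lambda>x. f (a x)) (carrier C)"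
    by (rule inj_onI) (metis sD(1,3) sM'(3) inj_onD mod_hom_closed)
  obtain Y q where Y: "Y \<in> mods" and sY: "ses C (\<lambda>x. f (a x)) A q Y"
    by (rule ex_cokernel[OF C Am mod_hom_comp[OF sD(1) sM'(1)] inj])
  obtain u v where "ses Q u Y v L"
    using noether[OF mods_lmodule[OF C] mods_lmodule[OF M] mods_lmodule[OF cosyz_gis_mods[OF Q]]
        mods_lmodule[OF Am] mods_lmodule[OF cosyz_zeros_mods[OF L]] mods_lmodule[OF Y] s sM sY] by blast
  moreover have "L \<in> cosyz gis (max n m)"
    using L cosyz_mono[OF zeros_gis, of n] cosyz_gis_le[of n "max n m"] by auto
  moreover have "Q \<in> cosyz gis (max n m)"
    using Q cosyz_gis_le[of m "max n m"] by auto
  ultimately have "Y \<in> cosyz gis (max n m)" using cosyz_gis_ext Y by blast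
  from cosyz_gis_step[OF C sY A this] show ?thesis .
qed

section \<open>Coresolutions and iterated cosyzygies\<close>

lemma coresolved_by_zero:
  assumes "lmodule S C" "short_exact S C f B g Z" "B \<in> X" "X \<subseteq> mods" "Z \<in> zeros"
  shows "coresolved_by S X k C"
  unfolding coresolved_by_def
proof (intro conjI exI)
  show "0 \<le> k" by simp
  show "\<forall>i\<le>0. (case_nat B (\<lambda>_. Z)) i \<in> X" using assms(3) by simp
  show "exact_at S C f ((case_nat B (\<lambda>_. Z)) 0) ((\<lambda>_. g) (0::nat)) ((case_nat B (\<lambda>_. Z)) 1)"
    using assms(2) by (simp add: short_exact_def)
  show "inj_on f (carrier C)" using assms(2) by (simp add: short_exact_def)
qed (use assms in \<open>auto simp: zeros_def\<close>)

text \<open>B is put in front, the composite of g and \<eta> becomes the new first differential, and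
  \<open>case_nat\<close> shifts the old terms.\<close>

lemma coresolved_by_splice:
  assumes C: "lmodule S C" and s: "short_exact S C f B g L" and B: "B \<in> X"
    and X: "X \<subseteq> mods" and L: "coresolved_by S X k L"
  shows "coresolved_by S X (Suc k) C"
proof -
  obtain j Y d \<eta> where j: "j \<le> k" and Y: "\<forall>i\<le>j. Y i \<in> X"
    "Y (j + 1) \<in> Mods S" "carrier (Y (j + 1)) = {\<zero>\<^bsub>Y (j + 1)\<^esub>}"
    "inj_on \<eta> (carrier L)" "exact_at S L \<eta> (Y 0) (d 0) (Y 1)"
    "\<forall>i<j. exact_at S (Y i) (d i) (Y (i + 1)) (d (i + 1)) (Y (i + 2))"
    using L unfolding coresolved_by_def by blast
  have Ll: "lmodule S L" using L by (simp add: coresolved_by_def)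
  interpret L: lmodule S L by fact
  note s' = short_exactD[OF s]
  have \<eta>: "\<eta> \<in> mod_hom S L (Y 0)" using Y(5) by (simp add: exact_at_def)
  have gim: "g ` carrier B = carrier L" using s by (simp add: short_exact_def)
  have "Y 0 \<in> mods" using Y(1) X by auto
  then have Y0: "\<zero>\<^bsub>Y 0\<^esub> = \<eta> \<zero>\<^bsub>L\<^esub>"
    using mod_hom_zero[OF L.M.abelian_group_axioms _ \<eta>] mods_abelian_group by simp
  define Y' where "Y' = case_nat B Y"
  define d' where "d' = case_nat (\<lambda>x. \<eta> (g x)) d"
  have "exact_at S C f B (\<lambda>x. \<eta> (g x)) (Y 0)"
    unfolding exact_at_def
  proof (intro conjI s' mod_hom_comp[OF s'(2) \<eta>] equalityI subsetI)
    fix x assume "x \<in> f ` carrier C"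
    then show "x \<in> a_kernel B (Y 0) (\<lambda>x. \<eta> (g x))"
      using s'(4) mod_hom_closed[OF s'(1)] by (auto simp: a_kernel_iff Y0)
  next
    fix x assume x: "x \<in> a_kernel B (Y 0) (\<lambda>x. \<eta> (g x))"
    then have "g x = \<zero>\<^bsub>L\<^esub>"
      using inj_onD[OF Y(4), of "g x" "\<zero>\<^bsub>L\<^esub>"] mod_hom_closed[OF s'(2)] by (simp add: a_kernel_iff Y0)
    with x s'(5) show "x \<in> f ` carrier C" by (auto simp: a_kernel_iff)
  qed
  moreover have "exact_at S B (\<lambda>x. \<eta> (g x)) (Y 0) (d 0) (Y 1)"
  proof -
    have "(\<lambda>x. \<eta> (g x)) ` carrier B = \<eta> ` carrier L" using gim by (simp flip: image_image)
    with Y(5) mod_hom_comp[OF s'(2) \<eta>] show ?thesis by (simp add: exact_at_def)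
  qed
  ultimately show ?thesis
    unfolding coresolved_by_def
    using C j Y B s'(3)
    by (intro conjI exI[of _ "Suc j"] exI[of _ Y'] exI[of _ d'] exI[of _ f])
      (auto simp: Y'_def d'_def split: nat.split)
qed

text \<open>\<open>cosyz zeros (Suc k)\<close> uses k + 1 injective terms before reaching 0, and
  \<open>coresolved_by\<close> numbers these from 0 to k.\<close>

lemma cosyz_zeros_coresolved:
  "L \<in> cosyz zeros (Suc k) \<Longrightarrow> coresolved_by S injs k L"
proof (induction k arbitrary: L)
  case 0
  then obtain J M' f g where L: "L \<in> mods" "J \<in> injs" "M' \<in> zeros" "ses L f J g M'" by auto
  show ?case
    by (rule coresolved_by_zero[OF mods_lmodule[OF L(1)] L(4,2) _ L(3)]) (use injs_mods in blast)
next
  case (Suc k)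
  then obtain J M' f g where L: "L \<in> mods" "J \<in> injs" "M' \<in> cosyz zeros (Suc k)" "ses L f J g M'"
    unfolding cosyz.simps(2)[of zeros "Suc k"] by blast
  show ?case
    by (rule coresolved_by_splice[OF mods_lmodule[OF L(1)] L(4,2) _ Suc.IH[OF L(3)]])
      (use injs_mods in blast)
qed

text \<open>The terms of the coresolution are Gorenstein injective, whereas \<open>cosyz\<close>
  asks for injective ones; \<open>cosyz_gis_step\<close> bridges the difference at each step of the
  induction.\<close>

lemma coresolution_cosyz:
  "\<lbrakk>C \<in> mods; \<forall>i\<le>j. Y i \<in> gis; Y (j + 1) \<in> zeros; inj_on \<eta> (carrier C);
    exact_at S C \<eta> (Y 0) (d 0) (Y 1);
    \<forall>i<j. exact_at S (Y i) (d i) (Y (i + 1)) (d (i + 1)) (Y (i + 2))\<rbrakk> \<Longrightarrow> C \<in> cosyz gis j"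
proof (induction j arbitrary: C Y \<eta> d)
  case 0
  have Y: "Y 0 \<in> gis" "Y 1 \<in> zeros" using 0 by auto
  then have Y': "Y 0 \<in> mods" "Y 1 \<in> mods" "carrier (Y 1) = {\<zero>\<^bsub>Y 1\<^esub>}"
    using gis_mods by (auto simp: zeros_def)
  have d0: "d 0 \<in> mod_hom S (Y 0) (Y 1)" using 0 by (simp add: exact_at_def)
  have "\<eta> ` carrier C = carrier (Y 0)"
    using 0(5) mod_hom_closed[OF d0] Y' by (auto simp: exact_at_def a_kernel_iff)
  with 0 have iso: "mod_iso S C (Y 0)"
    by (auto simp: mod_iso_def exact_at_def bij_betw_def)
  \<comment> \<open>Invariance under isomorphism is read off from closure under extensions: C
    becomes an extension of a zero module by Y 0.\<close>
  have "ses (Y 0) (\<lambda>x. x) (Y 0) (\<lambda>x. \<zero>\<^bsub>Y 1\<^esub>) (Y 1)"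
    by (intro short_exact_id mods_lmodule Y')
  then obtain f g where "ses (Y 0) f C g (Y 1)"
    using short_exact_iso_mid[OF mods_lmodule[OF Y'(1)] mods_lmodule[OF 0(1)]
        mod_iso_sym[OF mods_lmodule[OF 0(1)] iso]] by blast
  then show ?case using gi_ext Y zeros_gis 0(1) by auto
next
  case (Suc j)
  have Ym: "Y 0 \<in> mods" "Y 1 \<in> mods" using Suc.prems(2) gis_mods by auto
  have e1: "exact_at S (Y 0) (d 0) (Y 1) (d 1) (Y 2)"
    using spec[OF Suc.prems(6), of 0] by (simp add: numeral_2_eq_2)
  have Y2: "Y 2 \<in> mods"
    using Suc.prems(2,3) gis_mods by (cases j) (auto simp: zeros_def numeral_2_eq_2)
  have d: "d 0 \<in> mod_hom S (Y 0) (Y 1)" "d 1 \<in> mod_hom S (Y 1) (Y 2)"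
    and im: "d 0 ` carrier (Y 0) = a_kernel (Y 1) (Y 2) (d 1)"
    using e1 by (auto simp: exact_at_def)
  \<comment> \<open>The cokernel of \<eta> is realized as the kernel of d 1, which is the image of d
    0. The remaining terms coresolve it after a shift by one.\<close>
  let ?L = "(Y 1)\<lparr>carrier := a_kernel (Y 1) (Y 2) (d 1)\<rparr>"
  have L: "?L \<in> mods" by (rule kernel_mods[OF Ym(2) Y2 d(2)])
  have d0: "d 0 \<in> mod_hom S (Y 0) ?L"
    using d(1) im by (auto simp: mod_hom_def)
  have "a_kernel (Y 0) ?L (d 0) = a_kernel (Y 0) (Y 1) (d 0)"
    by (auto simp: a_kernel_iff)
  then have s: "ses C \<eta> (Y 0) (d 0) ?L"
    using Suc.prems(4,5) d0 im by (simp add: short_exact_def exact_at_def)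
  have "?L \<in> cosyz gis j"
  proof (rule Suc.IH[of ?L "\<lambda>i. Y (Suc i)" "\<lambda>x. x" "\<lambda>i. d (Suc i)", OF L])
    show "exact_at S ?L (\<lambda>x. x) (Y (Suc 0)) (d (Suc 0)) (Y (Suc 1))"
      using d(2) by (auto simp: exact_at_def mod_hom_def a_kernel_iff numeral_2_eq_2)
    show "\<forall>i<j. exact_at S (Y (Suc i)) (d (Suc i)) (Y (Suc (i + 1))) (d (Suc (i + 1))) (Y (Suc (i + 2)))"
      using Suc.prems(6) by auto
  qed (use Suc.prems in auto)
  with cosyz_gis_step[OF Suc.prems(1) s] Suc.prems(2) show ?case by simp
qed

lemma coresolved_by_gis_cosyz:
  assumes "C \<in> mods" "coresolved_by S gis k C"
  shows "C \<in> cosyz gis k"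
proof -
  obtain j Y d \<eta> where "j \<le> k" "\<forall>i\<le>j. Y i \<in> gis" "Y (j + 1) \<in> zeros"
    "inj_on \<eta> (carrier C)" "exact_at S C \<eta> (Y 0) (d 0) (Y 1)"
    "\<forall>i<j. exact_at S (Y i) (d i) (Y (i + 1)) (d (i + 1)) (Y (i + 2))"
    using assms(2) unfolding coresolved_by_def zeros_def by blast
  with coresolution_cosyz[OF assms(1)] cosyz_gis_le show ?thesis by blast
qed

lemma coresolved_by_mono:
  assumes "coresolved_by S X k C" "X \<subseteq> Y"
  shows "coresolved_by S Y k C"
  using assms unfolding coresolved_by_def by blast

text \<open>C and C' may have different carrier types; this moves coresolutions between a bidual
  quotient and its copy in \<open>'u\<close>.\<close>

lemma coresolved_by_iso:
  assumes C: "lmodule S C" "lmodule S C'" "mod_iso S C' C" and c: "coresolved_by S X k C"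
  shows "coresolved_by S X k C'"
proof -
  obtain j Y d \<eta> where j: "j \<le> k" and Y: "\<forall>i\<le>j. Y i \<in> X"
    "Y (j + 1) \<in> Mods S" "carrier (Y (j + 1)) = {\<zero>\<^bsub>Y (j + 1)\<^esub>}"
    "inj_on \<eta> (carrier C)" "exact_at S C \<eta> (Y 0) (d 0) (Y 1)"
    "\<forall>i<j. exact_at S (Y i) (d i) (Y (i + 1)) (d (i + 1)) (Y (i + 2))"
    using c unfolding coresolved_by_def by blast
  obtain \<theta> where \<theta>: "\<theta> \<in> mod_hom S C' C" "bij_betw \<theta> (carrier C') (carrier C)"
    using C(3) by (auto simp: mod_iso_def)
  then have im: "\<theta> ` carrier C' = carrier C" and inj: "inj_on \<theta> (carrier C')"
    by (auto simp: bij_betw_def)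
  have "inj_on (\<lambda>x. \<eta> (\<theta> x)) (carrier C')"
    using comp_inj_on[OF inj] Y(4) im by (simp add: comp_def)
  moreover have "exact_at S C' (\<lambda>x. \<eta> (\<theta> x)) (Y 0) (d 0) (Y 1)"
  proof -
    have "(\<lambda>x. \<eta> (\<theta> x)) ` carrier C' = \<eta> ` carrier C" using im by (simp flip: image_image)
    with Y(5) mod_hom_comp[OF \<theta>(1), of \<eta>] show ?thesis by (simp add: exact_at_def)
  qed
  ultimately show ?thesis
    unfolding coresolved_by_def using C(2) j Y by blast
qed

end

section \<open>Free modules and vanishing of Ext\<close>

lemma ext_funcset_mem: "\<lbrakk>f \<in> X \<rightarrow>\<^sub>E A; x \<in> X\<rbrakk> \<Longrightarrow> f x \<in> A"
  by blast

definition free_module :: "('r, 'x) ring_scheme \<Rightarrow> 'a set \<Rightarrow> ('r, 'a \<Rightarrow> 'r) module" where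
  "free_module R X =
     \<lparr>carrier = {f \<in> X \<rightarrow>\<^sub>E carrier R. finite {x \<in> X. f x \<noteq> \<zero>\<^bsub>R\<^esub>}},
      mult = undefined, one = undefined, ring.zero = (\<lambda>x\<in>X. \<zero>\<^bsub>R\<^esub>),
      ring.add = (\<lambda>f g. \<lambda>x\<in>X. f x \<oplus>\<^bsub>R\<^esub> g x),
      smult = (\<lambda>r f. \<lambda>x\<in>X. r \<otimes>\<^bsub>R\<^esub> f x)\<rparr>"

definition free_basis :: "('r, 'x) ring_scheme \<Rightarrow> 'a set \<Rightarrow> 'a \<Rightarrow> ('a \<Rightarrow> 'r)" where
  "free_basis R X x = (\<lambda>y\<in>X. if y = x then \<one>\<^bsub>R\<^esub> else \<zero>\<^bsub>R\<^esub>)"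

lemma lmodule_free_module:
  assumes R: "ring R"
  shows "lmodule R (free_module R X)"
proof -
  interpret R: ring R by fact
  have supp: "finite {x \<in> X. h x \<noteq> \<zero>\<^bsub>R\<^esub>}"
    if "\<And>x. \<lbrakk>x \<in> X; f x = \<zero>\<^bsub>R\<^esub>; g x = \<zero>\<^bsub>R\<^esub>\<rbrakk> \<Longrightarrow> h x = \<zero>\<^bsub>R\<^esub>"
      "finite {x \<in> X. f x \<noteq> \<zero>\<^bsub>R\<^esub>}" "finite {x \<in> X. g x \<noteq> \<zero>\<^bsub>R\<^esub>}" for f g h
    by (rule finite_subset[OF _ finite_UnI[OF that(2,3)]]) (use that(1) in auto)
  have "abelian_group (free_module R X)"
  proof (rule abelian_groupI)
    fix f g assume fg: "f \<in> carrier (free_module R X)" "g \<in> carrier (free_module R X)"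
    have fR: "f x \<in> carrier R" if "x \<in> X" for x
      using fg(1) that by (auto simp: free_module_def)
    have "finite {x \<in> X. (\<lambda>x\<in>X. f x \<oplus>\<^bsub>R\<^esub> g x) x \<noteq> \<zero>\<^bsub>R\<^esub>}"
      by (rule supp[of f g]) (use fg in \<open>auto simp: free_module_def\<close>)
    with fg show "f \<oplus>\<^bsub>free_module R X\<^esub> g \<in> carrier (free_module R X)"
      by (auto simp: free_module_def ext_funcset_mem)
    have "f x \<oplus>\<^bsub>R\<^esub> g x = g x \<oplus>\<^bsub>R\<^esub> f x" if "x \<in> X" for x
      using fg that by (intro R.a_comm) (auto simp: free_module_def)
    then show "f \<oplus>\<^bsub>free_module R X\<^esub> g = g \<oplus>\<^bsub>free_module R X\<^esub> f"
      by (auto simp: free_module_def fun_eq_iff)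
    have "finite {x \<in> X. (\<lambda>x\<in>X. \<ominus>\<^bsub>R\<^esub> f x) x \<noteq> \<zero>\<^bsub>R\<^esub>}"
      by (rule supp[of f f]) (use fg in \<open>auto simp: free_module_def\<close>)
    then show "\<exists>g\<in>carrier (free_module R X). g \<oplus>\<^bsub>free_module R X\<^esub> f = \<zero>\<^bsub>free_module R X\<^esub>"
      using fg fR by (intro bexI[of _ "\<lambda>x\<in>X. \<ominus>\<^bsub>R\<^esub> f x"])
        (auto simp: free_module_def fun_eq_iff R.l_neg)
  next
    fix f assume f: "f \<in> carrier (free_module R X)"
    show "\<zero>\<^bsub>free_module R X\<^esub> \<oplus>\<^bsub>free_module R X\<^esub> f = f"
      using f by (auto simp: free_module_def fun_eq_iff restrict_def PiE_def extensional_def Pi_def)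
  qed (auto simp: free_module_def fun_eq_iff restrict_def ext_funcset_mem R.a_assoc)
  then show ?thesis
  proof (rule lmoduleI[OF R])
    fix r f assume rf: "r \<in> carrier R" "f \<in> carrier (free_module R X)"
    have "finite {x \<in> X. (\<lambda>x\<in>X. r \<otimes>\<^bsub>R\<^esub> f x) x \<noteq> \<zero>\<^bsub>R\<^esub>}"
      by (rule supp[of f f]) (use rf in \<open>auto simp: free_module_def\<close>)
    with rf show "r \<odot>\<^bsub>free_module R X\<^esub> f \<in> carrier (free_module R X)"
      by (auto simp: free_module_def ext_funcset_mem)
  next
    fix f assume f: "f \<in> carrier (free_module R X)"
    show "\<one>\<^bsub>R\<^esub> \<odot>\<^bsub>free_module R X\<^esub> f = f"
      using f by (auto simp: free_module_def fun_eq_iff restrict_def PiE_def extensional_def Pi_def)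
  qed (auto simp: free_module_def fun_eq_iff restrict_def ext_funcset_mem R.l_distr R.r_distr R.m_assoc)
qed

lemma free_basis_closed:
  assumes "ring R" "x \<in> X"
  shows "free_basis R X x \<in> carrier (free_module R X)"
proof -
  interpret R: ring R by fact
  have "finite {y \<in> X. free_basis R X x y \<noteq> \<zero>\<^bsub>R\<^esub>}"
    by (rule finite_subset[of _ "{x}"]) (auto simp: free_basis_def split: if_splits)
  then show ?thesis by (auto simp: free_module_def free_basis_def)
qed

text \<open>Linear combinations over a possibly infinite basis are taken with
  \<open>gfinprod\<close>, which runs over the finite support; scalars pass through by induction on
  finite subsets.\<close>

lemma (in lmodule) smult_gfinprod:
  assumes r: "r \<in> carrier R" and h: "h \<in> X \<rightarrow> carrier M" and fin: "finite {x \<in> X. h x \<noteq> \<zero>\<^bsub>M\<^esub>}"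
  shows "r \<odot>\<^bsub>M\<^esub> gfinprod (add_monoid M) h X = gfinprod (add_monoid M) (\<lambda>x. r \<odot>\<^bsub>M\<^esub> h x) X"
proof -
  let ?F = "{x \<in> X. h x \<noteq> \<zero>\<^bsub>M\<^esub>}"
  have A: "comm_monoid (add_monoid M)" by (rule M.a_comm_monoid)
  have *: "r \<odot>\<^bsub>M\<^esub> finprod (add_monoid M) h G = finprod (add_monoid M) (\<lambda>x. r \<odot>\<^bsub>M\<^esub> h x) G"
    if "finite G" "G \<subseteq> X" for G
    using that
  proof (induction rule: finite_induct)
    case empty
    then show ?case using r by (simp add: comm_monoid.finprod_empty[OF A])
  next
    case (insert x G)
    have "h \<in> G \<rightarrow> carrier M" "h x \<in> carrier M" using h insert.prems by auto
    moreover from this have "(\<lambda>x. r \<odot>\<^bsub>M\<^esub> h x) \<in> G \<rightarrow> carrier M" "r \<odot>\<^bsub>M\<^esub> h x \<in> carrier M"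
      using r smult_closed by auto
    moreover have "finprod (add_monoid M) h G \<in> carrier M"
      using comm_monoid.finprod_closed[OF A, of h G] calculation by auto
    ultimately show ?case
      using insert comm_monoid.finprod_insert[OF A, of G x h] comm_monoid.finprod_insert[OF A, of G x "\<lambda>x. r \<odot>\<^bsub>M\<^esub> h x"] r
      by (simp add: smult_r_distr)
  qed
  have "gfinprod (add_monoid M) (\<lambda>x. r \<odot>\<^bsub>M\<^esub> h x) X = gfinprod (add_monoid M) (\<lambda>x. r \<odot>\<^bsub>M\<^esub> h x) ?F"
    by (rule comm_monoid.gfinprod_mono_neutral_cong_right[OF A]) (use r h smult_closed in auto)
  also have "\<dots> = finprod (add_monoid M) (\<lambda>x. r \<odot>\<^bsub>M\<^esub> h x) ?F"
    by (rule comm_monoid.gfinprod_eq_finprod[OF A fin]) (use r h smult_closed in auto)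
  finally show ?thesis
    using *[OF fin] fin by (simp add: gfinprod_def)
qed

lemma free_module_extend:
  assumes A: "lmodule R A" and a: "a \<in> X \<rightarrow> carrier A"
  shows "\<exists>h\<in>mod_hom R (free_module R X) A. \<forall>x\<in>X. h (free_basis R X x) = a x"
proof -
  interpret A: lmodule R A by fact
  have G: "comm_monoid (add_monoid A)" by (rule A.M.a_comm_monoid)
  let ?h = "\<lambda>f. gfinprod (add_monoid A) (\<lambda>x. f x \<odot>\<^bsub>A\<^esub> a x) X"
  have ac: "a x \<in> carrier A" if "x \<in> X" for x using a that by auto
  have supp: "finite {x \<in> X. f x \<odot>\<^bsub>A\<^esub> a x \<noteq> \<zero>\<^bsub>A\<^esub>}" if "f \<in> carrier (free_module R X)" for f
    by (rule finite_subset[of _ "{x \<in> X. f x \<noteq> \<zero>\<^bsub>R\<^esub>}"])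
      (use that in \<open>auto simp: free_module_def ac\<close>)
  have cl: "(\<lambda>x. f x \<odot>\<^bsub>A\<^esub> a x) \<in> X \<rightarrow> carrier A" if "f \<in> carrier (free_module R X)" for f
    using that a by (auto simp: free_module_def intro!: A.smult_closed)
  have fc: "f x \<in> carrier R" if "f \<in> carrier (free_module R X)" "x \<in> X" for f x
    using that by (auto simp: free_module_def)
  have "?h \<in> mod_hom R (free_module R X) A"
  proof (rule mod_homI)
    fix f assume f: "f \<in> carrier (free_module R X)"
    show "?h f \<in> carrier A" using comm_monoid.gfinprod_closed[OF G, of "\<lambda>x. f x \<odot>\<^bsub>A\<^esub> a x" X] cl[OF f] by simp
    fix g assume g: "g \<in> carrier (free_module R X)"
    have "?h (f \<oplus>\<^bsub>free_module R X\<^esub> g)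
        = gfinprod (add_monoid A) (\<lambda>x. (f x \<odot>\<^bsub>A\<^esub> a x) \<otimes>\<^bsub>add_monoid A\<^esub> (g x \<odot>\<^bsub>A\<^esub> a x)) X"
      by (rule comm_monoid.gfinprod_cong[OF G])
        (use f g in \<open>auto simp: free_module_def simp_implies_def A.smult_l_distr ac ext_funcset_mem
          intro!: A.smult_closed A.M.a_closed\<close>)
    also have "\<dots> = ?h f \<oplus>\<^bsub>A\<^esub> ?h g"
      using comm_monoid.gfinprod_distrib[OF G, of X "\<lambda>x. f x \<odot>\<^bsub>A\<^esub> a x" "\<lambda>x. g x \<odot>\<^bsub>A\<^esub> a x"] supp cl f g by simp
    finally show "?h (f \<oplus>\<^bsub>free_module R X\<^esub> g) = ?h f \<oplus>\<^bsub>A\<^esub> ?h g" .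
  next
    fix r f assume r: "r \<in> carrier R" and f: "f \<in> carrier (free_module R X)"
    have "?h (r \<odot>\<^bsub>free_module R X\<^esub> f) = gfinprod (add_monoid A) (\<lambda>x. r \<odot>\<^bsub>A\<^esub> (f x \<odot>\<^bsub>A\<^esub> a x)) X"
      by (rule comm_monoid.gfinprod_cong[OF G])
        (use r f in \<open>auto simp: free_module_def simp_implies_def A.smult_assoc1 ac ext_funcset_mem
          intro!: A.smult_closed\<close>)
    also have "\<dots> = r \<odot>\<^bsub>A\<^esub> ?h f"
      using A.smult_gfinprod[OF r cl[OF f] supp[OF f]] by simp
    finally show "?h (r \<odot>\<^bsub>free_module R X\<^esub> f) = r \<odot>\<^bsub>A\<^esub> ?h f" .
  qed
  moreover have "\<forall>x\<in>X. ?h (free_basis R X x) = a x"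
  proof
    fix x assume x: "x \<in> X"
    have "?h (free_basis R X x) = gfinprod (add_monoid A) (\<lambda>y. a x) {x}"
      by (rule comm_monoid.gfinprod_mono_neutral_cong_right[OF G])
        (use x ac cl[OF free_basis_closed[OF A.R.ring_axioms x]] in \<open>auto simp: free_basis_def A.smult_one\<close>)
    also have "\<dots> = a x"
      using ac[OF x] comm_monoid.gfinprod_eq_finprod[OF G, of "{x}" "\<lambda>y. a x"]
        comm_monoid.finprod_insert[OF G, of "{}" x "\<lambda>y. a x"] comm_monoid.finprod_empty[OF G]
      by simp
    finally show "?h (free_basis R X x) = a x" .
  qed
  ultimately show ?thesis by (intro bexI[where x = "?h"])
qed

text \<open>Induction on the size of the support: splitting off one term of f leaves a function with
  one support point less.\<close>

lemma free_module_hom_eq: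
  assumes B: "lmodule R B" and h: "h \<in> mod_hom R (free_module R X) B"
    and h': "h' \<in> mod_hom R (free_module R X) B"
    and eq: "\<And>x. x \<in> X \<Longrightarrow> h (free_basis R X x) = h' (free_basis R X x)"
    and f: "f \<in> carrier (free_module R X)"
  shows "h f = h' f"
  using f
proof (induction "card {x \<in> X. f x \<noteq> \<zero>\<^bsub>R\<^esub>}" arbitrary: f)
  interpret B: lmodule R B by fact
  interpret F: lmodule R "free_module R X" by (rule lmodule_free_module[OF B.R.ring_axioms])
  {
    case 0
    then have "f = \<zero>\<^bsub>free_module R X\<^esub>"
      by (auto simp: free_module_def fun_eq_iff restrict_def PiE_def extensional_def)
    then show ?case
      using mod_hom_zero[OF F.M.abelian_group_axioms B.M.abelian_group_axioms] h h' by metis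
  next
    case (Suc n)
    have fin: "finite {x \<in> X. f x \<noteq> \<zero>\<^bsub>R\<^esub>}" using Suc.prems by (simp add: free_module_def)
    have "{x \<in> X. f x \<noteq> \<zero>\<^bsub>R\<^esub>} \<noteq> {}" using Suc.hyps(2) by force
    then obtain x where x: "x \<in> X" "f x \<noteq> \<zero>\<^bsub>R\<^esub>" by blast
    have fx: "f x \<in> carrier R" using Suc.prems x by (auto simp: free_module_def)
    let ?g = "\<lambda>y\<in>X. if y = x then \<zero>\<^bsub>R\<^esub> else f y"
    have supp: "{y \<in> X. ?g y \<noteq> \<zero>\<^bsub>R\<^esub>} = {y \<in> X. f y \<noteq> \<zero>\<^bsub>R\<^esub>} - {x}" by auto
    have "finite {y \<in> X. ?g y \<noteq> \<zero>\<^bsub>R\<^esub>}"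
      unfolding supp using fin by simp
    moreover have "?g \<in> X \<rightarrow>\<^sub>E carrier R"
      using Suc.prems by (auto simp: free_module_def)
    ultimately have g: "?g \<in> carrier (free_module R X)"
      by (simp only: free_module_def partial_object.simps mem_Collect_eq)
    have "card {y \<in> X. ?g y \<noteq> \<zero>\<^bsub>R\<^esub>} = n"
      using Suc.hyps(2) x fin by (subst supp) simp
    then have IH: "h ?g = h' ?g" using Suc.hyps(1) g by metis
    note bx = free_basis_closed[OF B.R.ring_axioms x(1)]
    have f: "f = ?g \<oplus>\<^bsub>free_module R X\<^esub> (f x \<odot>\<^bsub>free_module R X\<^esub> free_basis R X x)"
      using Suc.prems x(1)
      by (auto simp: free_module_def free_basis_def fun_eq_iff restrict_def PiE_def extensional_def Pi_def)
    have "k f = k ?g \<oplus>\<^bsub>B\<^esub> f x \<odot>\<^bsub>B\<^esub> k (free_basis R X x)" if k: "k \<in> mod_hom R (free_module R X) B" for k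
      using arg_cong[OF f, of k] mod_hom_add[OF k g F.smult_closed[OF fx bx]] mod_hom_smult[OF k fx bx]
      by simp
    from this[OF h] this[OF h'] IH eq[OF x(1)] show ?case by simp
  }
qed

context small_modules
begin

lemma small_free_module:
  assumes "X \<prec> (UNIV :: 'u set)"
  shows "carrier (free_module S X) \<prec> (UNIV :: 'u set)"
  using small_PiE[OF universe assms small_ring]
  by (rule lesspoll_trans1[rotated]) (auto simp: free_module_def intro!: subset_imp_lepoll)

section \<open>Projective resolutions\<close>

text \<open>P is a copy of the free module on the underlying set of M; it is projective because
  preimages of basis elements can be chosen freely.\<close>

lemma ex_projective_cover:
  assumes M: "M \<in> mods"
  shows "\<exists>P\<in>(Proj_mods S :: ('r, 'u) module set). \<exists>e\<in>mod_hom S P M. \<forall>y\<in>carrier M. \<exists>x\<in>carrier P. y = e x"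
proof -
  let ?F = "free_module S (carrier M)"
  let ?b = "free_basis S (carrier M)"
  have F: "lmodule S ?F" by (rule lmodule_free_module[OF ring])
  have "carrier M \<prec> (UNIV :: 'u set)" using M by (simp add: Mods_def)
  from ex_copy[OF F small_free_module[OF this]]
  obtain P where P: "P \<in> mods" and iso: "mod_iso S ?F P" by blast
  obtain \<theta> where \<theta>: "\<theta> \<in> mod_hom S ?F P" "bij_betw \<theta> (carrier ?F) (carrier P)"
    using iso by (auto simp: mod_iso_def)
  have im: "\<theta> ` carrier ?F = carrier P" and inj: "inj_on \<theta> (carrier ?F)"
    using \<theta>(2) by (auto simp: bij_betw_def)
  have "\<exists>\<psi>\<in>mod_hom S P ?F. \<forall>x\<in>carrier P. \<theta> (\<psi> x) = x"
    by (rule factor_mono[OF mods_lmodule[OF P] F \<theta>(1) inj mod_hom_id]) (use im in auto)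
  then obtain \<psi> where \<psi>: "\<psi> \<in> mod_hom S P ?F" "\<And>x. x \<in> carrier P \<Longrightarrow> \<theta> (\<psi> x) = x"
    by blast
  have \<psi>\<theta>: "\<psi> (\<theta> x) = x" if "x \<in> carrier ?F" for x
    using that \<psi>(2) inj_onD[OF inj] mod_hom_closed[OF \<theta>(1)] mod_hom_closed[OF \<psi>(1)] by blast
  note b = free_basis_closed[OF ring]
  have "P \<in> Proj_mods S"
    unfolding Proj_mods_def
  proof (intro CollectI conjI P ballI impI)
    fix A B p f assume A: "A \<in> mods" and B: "B \<in> mods" and p: "p \<in> mod_hom S A B"
      and f: "f \<in> mod_hom S P B" and onto: "p ` carrier A = carrier B"
    have "\<exists>a. \<forall>x\<in>carrier M. a x \<in> carrier A \<and> p (a x) = f (\<theta> (?b x))"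
    proof (rule bchoice, rule ballI)
      fix x assume "x \<in> carrier M"
      then have "f (\<theta> (?b x)) \<in> p ` carrier A"
        unfolding onto by (intro mod_hom_closed[OF f] mod_hom_closed[OF \<theta>(1)] b)
      then show "\<exists>y. y \<in> carrier A \<and> p y = f (\<theta> (?b x))" by (metis imageE)
    qed
    then obtain a where a: "\<And>x. x \<in> carrier M \<Longrightarrow> a x \<in> carrier A \<and> p (a x) = f (\<theta> (?b x))" by blast
    then have "a \<in> carrier M \<rightarrow> carrier A" by blast
    from free_module_extend[OF mods_lmodule[OF A] this]
    obtain g where g: "g \<in> mod_hom S ?F A" "\<And>x. x \<in> carrier M \<Longrightarrow> g (?b x) = a x" by blast
    have "p (g y) = f (\<theta> y)" if "y \<in> carrier ?F" for y
      by (rule free_module_hom_eq[OF mods_lmodule[OF B] mod_hom_comp[OF g(1) p] mod_hom_comp[OF \<theta>(1) f] _ that])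
        (simp add: g(2) a)
    then have "p (g (\<psi> x)) = f x" if "x \<in> carrier P" for x
      using that mod_hom_closed[OF \<psi>(1)] \<psi>(2) by simp
    then show "\<exists>g\<in>mod_hom S P A. \<forall>x\<in>carrier P. p (g x) = f x"
      by (intro bexI[OF _ mod_hom_comp[OF \<psi>(1) g(1)]]) simp
  qed
  obtain e where e: "e \<in> mod_hom S ?F M" "\<And>x. x \<in> carrier M \<Longrightarrow> e (?b x) = x"
    using free_module_extend[OF mods_lmodule[OF M], of "\<lambda>x. x" "carrier M"] by blast
  have "\<exists>x\<in>carrier P. y = e (\<psi> x)" if y: "y \<in> carrier M" for y
    using \<psi>\<theta>[OF b[OF y]] e(2)[OF y] mod_hom_closed[OF \<theta>(1) b[OF y]] by metis
  with \<open>P \<in> Proj_mods S\<close> show ?thesis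
    using mod_hom_comp[OF \<psi>(1) e(1)] by (intro bexI[of _ P] bexI[of _ "\<lambda>x. e (\<psi> x)"]) auto
qed

lemma proj_lift:
  fixes P :: "('r, 'u) module"
  assumes "P \<in> Proj_mods S" "A \<in> mods" "B \<in> mods" "p \<in> mod_hom S A B" "f \<in> mod_hom S P B"
    "p ` carrier A = carrier B"
  shows "\<exists>g\<in>mod_hom S P A. \<forall>x\<in>carrier P. p (g x) = f x"
  using assms unfolding Proj_mods_def by blast

text \<open>\<open>Ext\<close> selects its resolution by \<open>SOME\<close>, so the selected pair
  is a resolution only because one exists.\<close>

lemma ex_proj_resolution:
  assumes A: "A \<in> mods"
  shows "\<exists>P d \<epsilon>. proj_resolution S A P d \<epsilon>"
proof -
  \<comment> \<open>Covers are chosen simultaneously for all modules, so that taking syzygies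
    becomes a function \<Omega> that can be iterated.\<close>
  have "\<exists>F :: ('r, 'u) module \<Rightarrow> ('r, 'u) module \<times> ('u \<Rightarrow> 'u). \<forall>M\<in>mods. fst (F M) \<in> Proj_mods S \<and> snd (F M) \<in> mod_hom S (fst (F M)) M \<and>
      (\<forall>y\<in>carrier M. \<exists>x\<in>carrier (fst (F M)). y = snd (F M) x)"
  proof (rule bchoice, rule ballI)
    fix M assume "M \<in> mods"
    from ex_projective_cover[OF this] obtain P e where
      "(P :: ('r, 'u) module) \<in> Proj_mods S" "e \<in> mod_hom S P M" "\<forall>y\<in>carrier M. \<exists>x\<in>carrier P. y = e x"
      by blast
    then show "\<exists>p. fst p \<in> Proj_mods S \<and> snd p \<in> mod_hom S (fst p) M \<and>
      (\<forall>y\<in>carrier M. \<exists>x\<in>carrier (fst p :: ('r, 'u) module). y = snd p x)"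
      by (intro exI[of _ "(P, e)"]) simp
  qed
  then obtain F :: "('r, 'u) module \<Rightarrow> ('r, 'u) module \<times> ('u \<Rightarrow> 'u)" where F: "\<forall>M\<in>mods. fst (F M) \<in> Proj_mods S \<and> snd (F M) \<in> mod_hom S (fst (F M)) M \<and>
      (\<forall>y\<in>carrier M. \<exists>x\<in>carrier (fst (F M)). y = snd (F M) x)" ..
  define c e where "c M = fst (F M)" and "e M = snd (F M)" for M
  have c: "c M \<in> Proj_mods S" and e: "e M \<in> mod_hom S (c M) M"
    and onto: "y \<in> carrier M \<Longrightarrow> \<exists>x\<in>carrier (c M). y = e M x" if "M \<in> mods" for M y
    using F that by (auto simp: c_def e_def)
  have cm: "c M \<in> mods" if "M \<in> mods" for M using c[OF that] by (simp add: Proj_mods_def)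
  define \<Omega> where "\<Omega> M = (c M)\<lparr>carrier := a_kernel (c M) M (e M)\<rparr>" for M
  define K where "K n = (\<Omega> ^^ n) A" for n
  have K0: "K 0 = A" and KS: "K (Suc n) = \<Omega> (K n)" for n by (simp_all add: K_def)
  have Km: "K n \<in> mods" for n
    by (induction n) (use A kernel_mods cm e in \<open>auto simp: K0 KS \<Omega>_def\<close>)
  have ex: "exact_at S (c (K (Suc n))) (e (K (Suc n))) (c (K n)) (e (K n)) (K n)" for n
    unfolding exact_at_def
  proof (intro conjI e Km)
    have eK: "e (K (Suc n)) \<in> mod_hom S (c (K (Suc n))) (K (Suc n))" by (intro e Km)
    have sub: "carrier (K (Suc n)) = a_kernel (c (K n)) (K n) (e (K n))" by (simp add: KS \<Omega>_def)
    show "e (K (Suc n)) \<in> mod_hom S (c (K (Suc n))) (c (K n))"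
      using eK sub by (auto simp: mod_hom_def KS \<Omega>_def a_kernel_iff)
    have "e (K (Suc n)) ` carrier (c (K (Suc n))) = carrier (K (Suc n))"
      using onto[OF Km] mod_hom_closed[OF eK] by blast
    then show "e (K (Suc n)) ` carrier (c (K (Suc n))) = a_kernel (c (K n)) (K n) (e (K n))"
      using sub by simp
  qed
  \<comment> \<open>The syzygy is a submodule of the preceding cover and has the same zero, so the
    kernel is the same whether the map is regarded as going to the syzygy or to the cover.\<close>
  have "exact_at S (c (K (Suc (Suc n)))) (e (K (Suc (Suc n)))) (c (K (Suc n))) (e (K (Suc n))) (c (K n))" for n
  proof -
    have "\<zero>\<^bsub>K (Suc n)\<^esub> = \<zero>\<^bsub>c (K n)\<^esub>" by (simp add: KS \<Omega>_def)
    then have "a_kernel (c (K (Suc n))) (K (Suc n)) (e (K (Suc n)))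
        = a_kernel (c (K (Suc n))) (c (K n)) (e (K (Suc n)))"
      by (simp add: a_kernel_def kernel_def)
    with ex[of n] ex[of "Suc n"] show ?thesis by (simp add: exact_at_def)
  qed
  moreover have "e (K 0) ` carrier (c (K 0)) = carrier (K 0)"
    using onto[OF Km] mod_hom_closed[OF e[OF Km]] by blast
  ultimately have "proj_resolution S A (\<lambda>n. c (K n)) (\<lambda>n. e (K (Suc n))) (e A)"
    using ex[of 0] c[OF Km] by (simp add: proj_resolution_def K0 numeral_2_eq_2)
  then show ?thesis by blast
qed

section \<open>Vanishing of Ext from injective to Gorenstein injective modules\<close>

text \<open>Dimension shifting in the second variable: an embedding of G into an injective J with
  cokernel G' turns the cocycle f of degree i + 1 into a cocycle of degree i with values in G'. The
  induction ends with a map E -> G', which lifts to J because G is acyclic.\<close>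

lemma proj_resolution_extend:
  assumes P: "proj_resolution S E P d \<epsilon>" and E: "E \<in> injs"
  shows "\<lbrakk>G \<in> gis; f \<in> mod_hom S (P (Suc i)) G; \<And>x. x \<in> carrier (P (i + 2)) \<Longrightarrow> f (d (i + 1) x) = \<zero>\<^bsub>G\<^esub>\<rbrakk>
    \<Longrightarrow> \<exists>h\<in>mod_hom S (P i) G. \<forall>x\<in>carrier (P (Suc i)). f x = h (d i x)"
proof (induction i arbitrary: G f)
  have Pp: "P i \<in> Proj_mods S" for i using P by (simp add: proj_resolution_def)
  then have Pm: "P i \<in> mods" for i by (simp add: Proj_mods_def)
  have ex: "exact_at S (P (i + 2)) (d (i + 1)) (P (i + 1)) (d i) (P i)" for i
    using P by (simp add: proj_resolution_def)
  have ex0: "exact_at S (P 1) (d 0) (P 0) \<epsilon> E" and \<epsilon>: "\<epsilon> ` carrier (P 0) = carrier E"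
    using P by (auto simp: proj_resolution_def)
  have d: "d i \<in> mod_hom S (P (Suc i)) (P i)" for i
    using ex[of i] by (simp add: exact_at_def)
  have \<epsilon>h: "\<epsilon> \<in> mod_hom S (P 0) E" using ex0 by (simp add: exact_at_def)
  have ker: "\<exists>y\<in>carrier (P (i + 2)). x = d (i + 1) y"
    if "x \<in> carrier (P (Suc i))" "d i x = \<zero>\<^bsub>P i\<^esub>" for i x
  proof -
    have "x \<in> a_kernel (P (i + 1)) (P i) (d i)" using that by (simp add: a_kernel_iff)
    with ex[of i] show ?thesis by (auto simp: exact_at_def)
  qed
  have dd: "d i (d (Suc i) y) = \<zero>\<^bsub>P i\<^esub>" if "y \<in> carrier (P (Suc (Suc i)))" for i y
  proof -
    have "d (Suc i) y \<in> a_kernel (P (i + 1)) (P i) (d i)"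
      using that ex[of i] by (auto simp: exact_at_def)
    then show ?thesis by (simp add: a_kernel_iff)
  qed
  note Em = injs_mods[OF E]
  {
    fix i G f assume G: "G \<in> gis" and f: "f \<in> mod_hom S (P (Suc i)) G"
      and f0: "\<forall>x\<in>carrier (P (i + 2)). f (d (i + 1) x) = \<zero>\<^bsub>G\<^esub>"
    note Gm = gis_mods[OF G]
    obtain J G' s t where J: "J \<in> injs" and G': "G' \<in> gis" and st: "ses G s J t G'"
      using gisD(2)[OF G] by blast
    note Jm = injs_mods[OF J] and stD = short_exactD[OF st]
    \<comment> \<open>s f vanishes on the kernel of d i, so injectivity of J extends it to P
      i.\<close>
    have "\<exists>u\<in>mod_hom S (P i) J. \<forall>x\<in>carrier (P (Suc i)). u (d i x) = s (f x)"
      by (rule inj_extend_ker[OF J Pm Pm d mod_hom_comp[OF f stD(1)]])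
        (auto dest!: ker simp: f0[simplified] hom_zero[OF stD(1) Gm Jm])
    then obtain u where u: "u \<in> mod_hom S (P i) J" "\<And>x. x \<in> carrier (P (Suc i)) \<Longrightarrow> u (d i x) = s (f x)"
      by blast
    have tu: "t (u (d i x)) = \<zero>\<^bsub>G'\<^esub>" if "x \<in> carrier (P (Suc i))" for x
      using u(2)[OF that] stD(4) mod_hom_closed[OF f that] by simp
    \<comment> \<open>If w agrees with u modulo G and vanishes on boundaries, then u - w takes
      values in G and pulls back to f along d i.\<close>
    have finish: "\<exists>h\<in>mod_hom S (P i) G. \<forall>x\<in>carrier (P (Suc i)). f x = h (d i x)"
      if w: "w \<in> mod_hom S (P i) J" "\<And>x. x \<in> carrier (P i) \<Longrightarrow> t (w x) = t (u x)"
        "\<And>x. x \<in> carrier (P (Suc i)) \<Longrightarrow> w (d i x) = \<zero>\<^bsub>J\<^esub>" for w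
    proof -
      have "\<exists>h\<in>mod_hom S (P i) G. \<forall>x\<in>carrier (P i). s (h x) = u x \<ominus>\<^bsub>J\<^esub> w x"
      proof (rule factor_mono[OF mods_lmodule[OF Pm] mods_lmodule[OF Gm] stD(1,3)
            mod_hom_diff[OF mods_lmodule[OF Jm] u(1) w(1)]])
        fix x assume x: "x \<in> carrier (P i)"
        note ux = mod_hom_closed[OF u(1) x] and wx = mod_hom_closed[OF w(1) x]
        show "\<exists>a\<in>carrier G. u x \<ominus>\<^bsub>J\<^esub> w x = s a"
          by (rule stD(5)[OF mods_minus_closed[OF Jm ux wx]])
            (simp add: hom_minus[OF stD(2) Jm gis_mods[OF G'] ux wx] w(2)[OF x]
              mods_minus_eq_zero[OF gis_mods[OF G']] mod_hom_closed[OF stD(2) ux])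
      qed
      then obtain h where h: "h \<in> mod_hom S (P i) G" "\<And>x. x \<in> carrier (P i) \<Longrightarrow> s (h x) = u x \<ominus>\<^bsub>J\<^esub> w x"
        by blast
      have "f x = h (d i x)" if x: "x \<in> carrier (P (Suc i))" for x
      proof -
        note dx = mod_hom_closed[OF d x]
        interpret J: abelian_group J by (rule mods_abelian_group[OF Jm])
        have "s (h (d i x)) = s (f x) \<ominus>\<^bsub>J\<^esub> \<zero>\<^bsub>J\<^esub>" using h(2)[OF dx] u(2)[OF x] w(3)[OF x] by simp
        also have "\<dots> = s (f x)"
          using mod_hom_closed[OF stD(1) mod_hom_closed[OF f x]] by (simp add: a_minus_def)
        finally show ?thesis
          using inj_onD[OF stD(3)] mod_hom_closed[OF f x] mod_hom_closed[OF h(1) dx] by metis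
      qed
      with h(1) show ?thesis by blast
    qed
    \<comment> \<open>The data and the correction principle are packed into one statement, since the
      base case and the induction step both use them, each with its own w.\<close>
    have "\<exists>J G' s t u. J \<in> injs \<and> G' \<in> gis \<and> ses G s J t G' \<and> u \<in> mod_hom S (P i) J \<and>
      (\<forall>x\<in>carrier (P (Suc i)). t (u (d i x)) = \<zero>\<^bsub>G'\<^esub>) \<and>
      (\<forall>w\<in>mod_hom S (P i) J. (\<forall>x\<in>carrier (P i). t (w x) = t (u x)) \<longrightarrow>
        (\<forall>x\<in>carrier (P (Suc i)). w (d i x) = \<zero>\<^bsub>J\<^esub>) \<longrightarrow>
        (\<exists>h\<in>mod_hom S (P i) G. \<forall>x\<in>carrier (P (Suc i)). f x = h (d i x)))"
      by (rule exI[of _ J], rule exI[of _ G'], rule exI[of _ s], rule exI[of _ t], rule exI[of _ u])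
        (auto intro: J G' st u(1) tu finish)
  }
  note step = this
  {
    case 0
    have "\<forall>x\<in>carrier (P (0 + 2)). f (d (0 + 1) x) = \<zero>\<^bsub>G\<^esub>"
      using 0(3) by blast
    from step[OF 0(1,2) this]
    obtain J G' s t u where J: "J \<in> injs" and G': "G' \<in> gis" and st: "ses G s J t G'"
      and u: "u \<in> mod_hom S (P 0) J"
      and tu': "\<forall>x\<in>carrier (P (Suc 0)). t (u (d 0 x)) = \<zero>\<^bsub>G'\<^esub>"
      and finish': "\<forall>w\<in>mod_hom S (P 0) J. (\<forall>x\<in>carrier (P 0). t (w x) = t (u x)) \<longrightarrow>
        (\<forall>x\<in>carrier (P (Suc 0)). w (d 0 x) = \<zero>\<^bsub>J\<^esub>) \<longrightarrow>
        (\<exists>h\<in>mod_hom S (P 0) G. \<forall>x\<in>carrier (P (Suc 0)). f x = h (d 0 x))"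
      by (elim exE conjE) (rule that)
    note tu = bspec[OF tu']
    have finish: "\<lbrakk>w \<in> mod_hom S (P 0) J; \<And>x. x \<in> carrier (P 0) \<Longrightarrow> t (w x) = t (u x);
        \<And>x. x \<in> carrier (P (Suc 0)) \<Longrightarrow> w (d 0 x) = \<zero>\<^bsub>J\<^esub>\<rbrakk> \<Longrightarrow>
        \<exists>h\<in>mod_hom S (P 0) G. \<forall>x\<in>carrier (P (Suc 0)). f x = h (d 0 x)" for w
      using finish' by blast
    note Jm = injs_mods[OF J] and stD = short_exactD[OF st] and G'm = gis_mods[OF G']
    \<comment> \<open>In degree 0 the map t u kills the image of d 0, which is the kernel of
      \<epsilon>, and so descends to E.\<close>
    have "\<exists>v\<in>mod_hom S E G'. \<forall>x\<in>carrier (P 0). v (\<epsilon> x) = t (u x)"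
    proof (rule factor_epi[OF mods_lmodule[OF Pm] mods_lmodule[OF Em] mods_lmodule[OF G'm] \<epsilon>h _
          mod_hom_comp[OF u stD(2)]])
      show "\<exists>x\<in>carrier (P 0). y = \<epsilon> x" if "y \<in> carrier E" for y using \<epsilon> that by blast
      show "t (u x) = \<zero>\<^bsub>G'\<^esub>" if "x \<in> carrier (P 0)" "\<epsilon> x = \<zero>\<^bsub>E\<^esub>" for x
      proof -
        have "x \<in> d 0 ` carrier (P 1)" using ex0 that by (simp add: exact_at_def a_kernel_iff)
        with tu show ?thesis by auto
      qed
    qed
    then obtain v where v: "v \<in> mod_hom S E G'" "\<And>x. x \<in> carrier (P 0) \<Longrightarrow> v (\<epsilon> x) = t (u x)" by blast
    obtain w where w: "w \<in> mod_hom S E J" "\<And>x. x \<in> carrier E \<Longrightarrow> t (w x) = v x"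
      using inj_acyclicD[OF gisD(1)[OF 0(1)] st E Jm G'm v(1)] by blast
    show ?case
    proof (rule finish[OF mod_hom_comp[OF \<epsilon>h w(1)]])
      show "t (w (\<epsilon> x)) = t (u x)" if "x \<in> carrier (P 0)" for x
        using w(2) v(2) that mod_hom_closed[OF \<epsilon>h] by simp
      show "w (\<epsilon> (d 0 x)) = \<zero>\<^bsub>J\<^esub>" if "x \<in> carrier (P (Suc 0))" for x
      proof -
        have "d 0 x \<in> a_kernel (P 0) E \<epsilon>" using ex0 that by (auto simp: exact_at_def)
        then show ?thesis using hom_zero[OF w(1) Em Jm] by (simp add: a_kernel_iff)
      qed
    qed
  next
    case (Suc i)
    have "\<forall>x\<in>carrier (P ((Suc i) + 2)). f (d ((Suc i) + 1) x) = \<zero>\<^bsub>G\<^esub>"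
      using Suc.prems(3) by blast
    from step[OF Suc.prems(1,2) this]
    obtain J G' s t u where J: "J \<in> injs" and G': "G' \<in> gis" and st: "ses G s J t G'"
      and u: "u \<in> mod_hom S (P (Suc i)) J"
      and tu': "\<forall>x\<in>carrier (P (Suc (Suc i))). t (u (d (Suc i) x)) = \<zero>\<^bsub>G'\<^esub>"
      and finish': "\<forall>w\<in>mod_hom S (P (Suc i)) J. (\<forall>x\<in>carrier (P (Suc i)). t (w x) = t (u x)) \<longrightarrow>
        (\<forall>x\<in>carrier (P (Suc (Suc i))). w (d (Suc i) x) = \<zero>\<^bsub>J\<^esub>) \<longrightarrow>
        (\<exists>h\<in>mod_hom S (P (Suc i)) G. \<forall>x\<in>carrier (P (Suc (Suc i))). f x = h (d (Suc i) x))"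
      by (elim exE conjE) (rule that)
    note tu = bspec[OF tu']
    have finish: "\<lbrakk>w \<in> mod_hom S (P (Suc i)) J; \<And>x. x \<in> carrier (P (Suc i)) \<Longrightarrow> t (w x) = t (u x);
        \<And>x. x \<in> carrier (P (Suc (Suc i))) \<Longrightarrow> w (d (Suc i) x) = \<zero>\<^bsub>J\<^esub>\<rbrakk> \<Longrightarrow>
        \<exists>h\<in>mod_hom S (P (Suc i)) G. \<forall>x\<in>carrier (P (Suc (Suc i))). f x = h (d (Suc i) x)" for w
      using finish' by blast
    note Jm = injs_mods[OF J] and stD = short_exactD[OF st] and G'm = gis_mods[OF G']
    have "\<exists>h\<in>mod_hom S (P i) G'. \<forall>x\<in>carrier (P (Suc i)). t (u x) = h (d i x)"
      by (rule Suc.IH[OF G' mod_hom_comp[OF u stD(2)]]) (use tu in simp)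
    then obtain v where v: "v \<in> mod_hom S (P i) G'" "\<And>x. x \<in> carrier (P (Suc i)) \<Longrightarrow> t (u x) = v (d i x)"
      by blast
    have "t ` carrier J = carrier G'" using st by (simp add: short_exact_def)
    \<comment> \<open>Projectivity of P i lifts v along J -> G'; composed with d i, the lift is the
      correction needed in \<open>finish\<close>.\<close>
    then obtain w where w: "w \<in> mod_hom S (P i) J" "\<And>x. x \<in> carrier (P i) \<Longrightarrow> t (w x) = v x"
      using proj_lift[OF Pp Jm G'm stD(2) v(1)] by blast
    show ?case
    proof (rule finish[OF mod_hom_comp[OF d w(1)]])
      show "t (w (d i x)) = t (u x)" if "x \<in> carrier (P (Suc i))" for x
        using w(2)[OF mod_hom_closed[OF d that]] v(2)[OF that] by simp
      show "w (d i (d (Suc i) x)) = \<zero>\<^bsub>J\<^esub>" if "x \<in> carrier (P (Suc (Suc i)))" for x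
        using dd[OF that] hom_zero[OF w(1) Pm Jm] by simp
    qed
  }
qed

lemma comm_group_hom_group:
  assumes A: "lmodule S A" and B: "lmodule S B"
  shows "comm_group (hom_group S A B)"
proof -
  interpret A: lmodule S A by fact
  interpret B: lmodule S B by fact
  have ext: "restrict f (carrier A) \<in> carrier (hom_group S A B)" if "f \<in> mod_hom S A B" for f
    using that by (auto simp: hom_group_def mod_hom_def A.smult_closed)
  show ?thesis
  proof (rule comm_groupI)
    fix f assume f: "f \<in> carrier (hom_group S A B)"
    then have fh: "f \<in> mod_hom S A B" by (simp add: hom_group_def)
    show "\<one>\<^bsub>hom_group S A B\<^esub> \<otimes>\<^bsub>hom_group S A B\<^esub> f = f"
      using f mod_hom_closed[OF fh] by (auto simp: hom_group_def fun_eq_iff restrict_def extensional_def)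
    let ?g = "\<lambda>x\<in>carrier A. \<zero>\<^bsub>B\<^esub> \<ominus>\<^bsub>B\<^esub> f x"
    have "?g \<in> carrier (hom_group S A B)"
      by (rule ext[OF mod_hom_diff[OF B mod_hom_const_zero[OF B] fh]])
    moreover have "?g \<otimes>\<^bsub>hom_group S A B\<^esub> f = \<one>\<^bsub>hom_group S A B\<^esub>"
      using mod_hom_closed[OF fh] by (auto simp: hom_group_def fun_eq_iff restrict_def a_minus_def B.M.l_neg)
    ultimately show "\<exists>g\<in>carrier (hom_group S A B). g \<otimes>\<^bsub>hom_group S A B\<^esub> f = \<one>\<^bsub>hom_group S A B\<^esub>" by blast
    fix g assume "g \<in> carrier (hom_group S A B)"
    then have gh: "g \<in> mod_hom S A B" by (simp add: hom_group_def)
    show "f \<otimes>\<^bsub>hom_group S A B\<^esub> g \<in> carrier (hom_group S A B)"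
      using ext[OF mod_hom_plus[OF B fh gh]] by (simp add: hom_group_def)
    show "f \<otimes>\<^bsub>hom_group S A B\<^esub> g = g \<otimes>\<^bsub>hom_group S A B\<^esub> f"
      using mod_hom_closed[OF fh] mod_hom_closed[OF gh]
      by (auto simp: hom_group_def fun_eq_iff restrict_def B.M.a_comm)
  next
    show "\<one>\<^bsub>hom_group S A B\<^esub> \<in> carrier (hom_group S A B)"
      using ext[OF mod_hom_const_zero[OF B]] by (simp add: hom_group_def)
  next
    fix f g h assume "f \<in> carrier (hom_group S A B)" "g \<in> carrier (hom_group S A B)"
      "h \<in> carrier (hom_group S A B)"
    then show "f \<otimes>\<^bsub>hom_group S A B\<^esub> g \<otimes>\<^bsub>hom_group S A B\<^esub> h
        = f \<otimes>\<^bsub>hom_group S A B\<^esub> (g \<otimes>\<^bsub>hom_group S A B\<^esub> h)"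
      by (auto simp: hom_group_def fun_eq_iff restrict_def B.M.a_assoc mod_hom_closed)
  qed
qed

lemma hom_pre_hom:
  assumes "lmodule S A" "lmodule S A'" "lmodule S B" "d \<in> mod_hom S A' A"
  shows "hom_pre A' d \<in> hom (hom_group S A B) (hom_group S A' B)"
proof (rule homI)
  interpret A': lmodule S A' by fact
  show "hom_pre A' d f \<in> carrier (hom_group S A' B)" if "f \<in> carrier (hom_group S A B)" for f
    using that mod_hom_comp[OF assms(4), of f B]
    by (auto simp: hom_group_def hom_pre_def mod_hom_def A'.smult_closed)
  show "hom_pre A' d (f \<otimes>\<^bsub>hom_group S A B\<^esub> g)
      = hom_pre A' d f \<otimes>\<^bsub>hom_group S A' B\<^esub> hom_pre A' d g"
    if "f \<in> carrier (hom_group S A B)" "g \<in> carrier (hom_group S A B)" for f g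
    using that by (auto simp: hom_group_def hom_pre_def fun_eq_iff restrict_def
        mod_hom_closed[OF assms(4)])
qed

lemma trivial_Mod_self:
  assumes "group H"
  shows "trivial_group (H Mod carrier H)"
proof -
  interpret H: group H by fact
  have "carrier H \<lhd> H" by (simp add: H.normal_inv_iff H.subgroup_self)
  then have "group (H Mod carrier H)" by (rule normal.factorgroup_is_group)
  moreover have "carrier (H Mod carrier H) = {carrier H}"
    using H.coset_join2[OF _ H.subgroup_self] by (auto simp: carrier_FactGroup image_iff)
  ultimately show ?thesis by (simp add: trivial_group_def)
qed

text \<open>By \<open>proj_resolution_extend\<close> the kernel and the image defining the
  cohomology group coincide. All positive degrees are covered, so this condition of the right
  cotorsion pair holds for every length.\<close>

lemma trivial_Ext_injs_gis:
  assumes E: "E \<in> injs" and G: "G \<in> gis" and i: "1 \<le> i"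
  shows "trivial_group (Ext S i E G)"
proof -
  let ?Pd = "SOME (P, d). \<exists>\<epsilon>. proj_resolution S E P d \<epsilon>"
  obtain P d where Pd: "?Pd = (P, d)" by (cases ?Pd)
  have "\<exists>Pd. case Pd of (P, d) \<Rightarrow> \<exists>\<epsilon>. proj_resolution S E P d \<epsilon>"
    using ex_proj_resolution[OF injs_mods[OF E]] by auto
  from someI_ex[OF this] obtain \<epsilon> where P: "proj_resolution S E P d \<epsilon>" by (auto simp: Pd)
  obtain j where j: "i = Suc j" using i by (cases i) auto
  note Gm = gis_mods[OF G]
  have Pm: "P i \<in> mods" for i using P by (simp add: proj_resolution_def Proj_mods_def)
  have d: "d i \<in> mod_hom S (P (Suc i)) (P i)" for i
    using P by (simp add: proj_resolution_def exact_at_def)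
  have dd: "d i (d (Suc i) y) = \<zero>\<^bsub>P i\<^esub>" if y: "y \<in> carrier (P (Suc (Suc i)))" for i y
  proof -
    have "exact_at S (P (i + 2)) (d (i + 1)) (P (i + 1)) (d i) (P i)"
      using P by (simp add: proj_resolution_def)
    then have "d (Suc i) y \<in> a_kernel (P (i + 1)) (P i) (d i)"
      using y by (auto simp: exact_at_def)
    then show ?thesis by (simp add: a_kernel_iff)
  qed
  let ?H = "\<lambda>i. hom_group S (P i) G"
  let ?K = "kernel (?H i) (?H (i + 1)) (hom_pre (P (i + 1)) (d i))"
  have "hom_pre (P i) (d j) ` carrier (?H j) = ?K"
  proof (intro equalityI subsetI)
    fix f assume "f \<in> hom_pre (P i) (d j) ` carrier (?H j)"
    then obtain h where h: "h \<in> carrier (?H j)" "f = hom_pre (P i) (d j) h" by blast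
    have "f \<in> carrier (?H i)"
      using hom_pre_hom[OF mods_lmodule[OF Pm] mods_lmodule[OF Pm] mods_lmodule[OF Gm] d, of j] h j
      by (auto simp: hom_def)
    moreover have "hom_pre (P (i + 1)) (d i) f = \<one>\<^bsub>?H (i + 1)\<^esub>"
      using h hom_zero[of h "P j" G, OF _ Pm Gm] mod_hom_closed[OF d]
      by (auto simp: hom_pre_def hom_group_def fun_eq_iff restrict_def j dd)
    ultimately show "f \<in> ?K" by (simp add: kernel_def)
  next
    fix f assume f: "f \<in> ?K"
    then have fh: "f \<in> mod_hom S (P (Suc j)) G" and fe: "f \<in> extensional (carrier (P (Suc j)))"
      by (auto simp: kernel_def hom_group_def j)
    have f0: "f (d (j + 1) x) = \<zero>\<^bsub>G\<^esub>" if x: "x \<in> carrier (P (j + 2))" for x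
    proof -
      have "hom_pre (P (i + 1)) (d i) f = \<one>\<^bsub>?H (i + 1)\<^esub>" using f by (simp add: kernel_def)
      from fun_cong[OF this, of x] x show ?thesis by (simp add: hom_pre_def hom_group_def j)
    qed
    obtain h where h: "h \<in> mod_hom S (P j) G" "\<And>x. x \<in> carrier (P (Suc j)) \<Longrightarrow> f x = h (d j x)"
      using proj_resolution_extend[OF P E G fh f0] by blast
    interpret Pj: lmodule S "P j" by (rule mods_lmodule[OF Pm])
    have "restrict h (carrier (P j)) \<in> carrier (?H j)"
      using h(1) by (auto simp: hom_group_def mod_hom_def Pj.smult_closed)
    moreover have "f = hom_pre (P i) (d j) (restrict h (carrier (P j)))"
      using fe h(2) mod_hom_closed[OF d[of j]]
      by (auto simp: hom_pre_def j fun_eq_iff restrict_def extensional_def)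
    ultimately show "f \<in> hom_pre (P i) (d j) ` carrier (?H j)" by blast
  qed
  then have eq: "hom_cohomology S P d i G = ((?H i)\<lparr>carrier := ?K\<rparr>) Mod carrier ((?H i)\<lparr>carrier := ?K\<rparr>)"
    by (simp add: hom_cohomology_def j)
  have "group_hom (?H i) (?H (i + 1)) (hom_pre (P (i + 1)) (d i))"
    using comm_group_hom_group[OF mods_lmodule[OF Pm] mods_lmodule[OF Gm]]
      hom_pre_hom[OF mods_lmodule[OF Pm] mods_lmodule[OF Pm] mods_lmodule[OF Gm] d, of i]
    by (simp add: group_hom_def group_hom_axioms_def comm_group_def)
  then have "subgroup ?K (?H i)" by (rule group_hom.subgroup_kernel)
  then have "group ((?H i)\<lparr>carrier := ?K\<rparr>)"
    using comm_group_hom_group[OF mods_lmodule[OF Pm] mods_lmodule[OF Gm]]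
    by (simp add: comm_group_def group.subgroup_imp_group)
  then have "trivial_group (hom_cohomology S P d i G)" unfolding eq by (rule trivial_Mod_self)
  then show ?thesis by (simp add: Ext_def Pd)
qed

end

section \<open>Characters of abelian groups\<close>

definition rat_add :: "rat monoid" where
  "rat_add = \<lparr>carrier = UNIV, mult = (+), one = 0\<rparr>"

lemma comm_group_rat_add: "comm_group rat_add"
  by (rule comm_groupI) (auto simp: rat_add_def intro: exI[of _ "- _"])

lemma rat_add_simps [simp]:
  "carrier rat_add = UNIV" "x \<otimes>\<^bsub>rat_add\<^esub> y = x + y" "\<one>\<^bsub>rat_add\<^esub> = 0"
  by (simp_all add: rat_add_def)

lemma rat_add_inv [simp]: "inv\<^bsub>rat_add\<^esub> x = - x"
  by (rule group.inv_equality) (use comm_group_rat_add in \<open>auto simp: comm_group_def\<close>)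

lemma rat_add_nat_pow [simp]: "x [^]\<^bsub>rat_add\<^esub> (n :: nat) = of_nat n * x"
  by (induction n) (auto simp: nat_pow_def algebra_simps)

lemma rat_add_int_pow [simp]: "x [^]\<^bsub>rat_add\<^esub> (k :: int) = of_int k * x"
  by (cases k rule: int_cases2) (auto simp: int_pow_int group.int_pow_neg
      comm_group_rat_add[unfolded comm_group_def])

lemma QmodZ_eq: "QmodZ = rat_add Mod \<int>"
  by (simp add: QmodZ_def rat_add_def)

lemma Ints_normal: "\<int> \<lhd> rat_add"
proof (rule comm_group.subgroup_imp_normal[OF comm_group_rat_add], rule subgroup.intro)
qed (auto simp: comm_group_rat_add)

lemma comm_group_QmodZ: "comm_group QmodZ"
  unfolding QmodZ_eq
  by (rule comm_group.abelian_FactGroup[OF comm_group_rat_add]) (rule normal_imp_subgroup[OF Ints_normal])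

definition rat_class :: "rat \<Rightarrow> rat set" where
  "rat_class q = \<int> #>\<^bsub>rat_add\<^esub> q"

lemma rat_class_hom: "rat_class \<in> hom rat_add QmodZ"
  unfolding QmodZ_eq rat_class_def using normal.r_coset_hom_Mod[OF Ints_normal] by simp

lemma rat_class_closed [simp]: "rat_class q \<in> carrier QmodZ"
  using hom_in_carrier[OF rat_class_hom, of q] by simp

lemma carrier_QmodZ: "carrier QmodZ = range rat_class"
  by (auto simp: QmodZ_eq carrier_FactGroup rat_class_def)

lemma rat_class_eq_one: "rat_class q = \<one>\<^bsub>QmodZ\<^esub> \<longleftrightarrow> q \<in> \<int>"
proof -
  have "group rat_add" using comm_group_rat_add by (simp add: comm_group_def)
  then show ?thesis
    using group.coset_join1[of rat_add \<int> q] group.coset_join2[of rat_add q \<int>]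
      normal_imp_subgroup[OF Ints_normal]
    by (auto simp: QmodZ_eq rat_class_def)
qed

lemma rat_class_pow: "rat_class q [^]\<^bsub>QmodZ\<^esub> (k :: int) = rat_class (of_int k * q)"
  using hom_int_pow[OF rat_class_hom, of q k] comm_group_rat_add comm_group_QmodZ
  by (simp add: comm_group_def)

interpretation QmodZ: comm_group QmodZ by (rule comm_group_QmodZ)

lemma QmodZ_divisible:
  assumes "y \<in> carrier QmodZ" "n > 0"
  shows "\<exists>z\<in>carrier QmodZ. z [^]\<^bsub>QmodZ\<^esub> (n :: int) = y"
proof -
  from assms(1) obtain q where "y = rat_class q" by (auto simp: carrier_QmodZ)
  with assms(2) show ?thesis
    by (intro bexI[of _ "rat_class (q / of_int n)"]) (auto simp: rat_class_pow)
qed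

section \<open>Extension of characters: Q/Z is injective as an abelian group\<close>

text \<open>The graph of a homomorphism from a subgroup of G to Q/Z, as a subgroup of the product
  that meets 1 x Q/Z trivially; this last condition is single-valuedness. With graphs, a chain is
  bounded simply by its union.\<close>

definition partial_char :: "('g, 'm) monoid_scheme \<Rightarrow> ('g \<times> rat set) set \<Rightarrow> bool" where
  "partial_char G T \<longleftrightarrow> T \<subseteq> carrier G \<times> carrier QmodZ \<and> (\<one>\<^bsub>G\<^esub>, \<one>\<^bsub>QmodZ\<^esub>) \<in> T \<and>
     (\<forall>x y x' y'. (x, y) \<in> T \<longrightarrow> (x', y') \<in> T \<longrightarrow> (x \<otimes>\<^bsub>G\<^esub> x', y \<otimes>\<^bsub>QmodZ\<^esub> y') \<in> T) \<and>
     (\<forall>x y. (x, y) \<in> T \<longrightarrow> (inv\<^bsub>G\<^esub> x, inv\<^bsub>QmodZ\<^esub> y) \<in> T) \<and>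
     (\<forall>y. (\<one>\<^bsub>G\<^esub>, y) \<in> T \<longrightarrow> y = \<one>\<^bsub>QmodZ\<^esub>)"

lemma partial_charD:
  assumes "partial_char G T"
  shows "(x, y) \<in> T \<Longrightarrow> x \<in> carrier G" "(x, y) \<in> T \<Longrightarrow> y \<in> carrier QmodZ"
    and "(\<one>\<^bsub>G\<^esub>, \<one>\<^bsub>QmodZ\<^esub>) \<in> T"
    and "\<lbrakk>(x, y) \<in> T; (x', y') \<in> T\<rbrakk> \<Longrightarrow> (x \<otimes>\<^bsub>G\<^esub> x', y \<otimes>\<^bsub>QmodZ\<^esub> y') \<in> T"
    and "(x, y) \<in> T \<Longrightarrow> (inv\<^bsub>G\<^esub> x, inv\<^bsub>QmodZ\<^esub> y) \<in> T"
    and "(\<one>\<^bsub>G\<^esub>, y) \<in> T \<Longrightarrow> y = \<one>\<^bsub>QmodZ\<^esub>"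
proof -
  from assms have *: "T \<subseteq> carrier G \<times> carrier QmodZ" "(\<one>\<^bsub>G\<^esub>, \<one>\<^bsub>QmodZ\<^esub>) \<in> T"
    "\<forall>x y x' y'. (x, y) \<in> T \<longrightarrow> (x', y') \<in> T \<longrightarrow> (x \<otimes>\<^bsub>G\<^esub> x', y \<otimes>\<^bsub>QmodZ\<^esub> y') \<in> T"
    "\<forall>x y. (x, y) \<in> T \<longrightarrow> (inv\<^bsub>G\<^esub> x, inv\<^bsub>QmodZ\<^esub> y) \<in> T"
    "\<forall>y. (\<one>\<^bsub>G\<^esub>, y) \<in> T \<longrightarrow> y = \<one>\<^bsub>QmodZ\<^esub>"
    unfolding partial_char_def by simp_all
  show "(x, y) \<in> T \<Longrightarrow> x \<in> carrier G" "(x, y) \<in> T \<Longrightarrow> y \<in> carrier QmodZ"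
    using *(1) by auto
  show "(\<one>\<^bsub>G\<^esub>, \<one>\<^bsub>QmodZ\<^esub>) \<in> T" by (rule *(2))
  show "\<lbrakk>(x, y) \<in> T; (x', y') \<in> T\<rbrakk> \<Longrightarrow> (x \<otimes>\<^bsub>G\<^esub> x', y \<otimes>\<^bsub>QmodZ\<^esub> y') \<in> T"
    by (rule *(3)[rule_format])
  show "(x, y) \<in> T \<Longrightarrow> (inv\<^bsub>G\<^esub> x, inv\<^bsub>QmodZ\<^esub> y) \<in> T"
    by (rule *(4)[rule_format])
  show "(\<one>\<^bsub>G\<^esub>, y) \<in> T \<Longrightarrow> y = \<one>\<^bsub>QmodZ\<^esub>"
    by (rule *(5)[rule_format])
qed

context comm_group
begin

lemma partial_char_unique:
  assumes T: "partial_char G T" and "(x, y) \<in> T" "(x, y') \<in> T"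
  shows "y = y'"
proof -
  note D = partial_charD[OF T]
  have "(x \<otimes> inv x, y \<otimes>\<^bsub>QmodZ\<^esub> inv\<^bsub>QmodZ\<^esub> y') \<in> T"
    by (rule D(4)[OF assms(2) D(5)[OF assms(3)]])
  then have "y \<otimes>\<^bsub>QmodZ\<^esub> inv\<^bsub>QmodZ\<^esub> y' = \<one>\<^bsub>QmodZ\<^esub>"
    using D(1)[OF assms(2)] by (intro D(6)) simp
  then show ?thesis
    using D(2)[OF assms(2)] D(2)[OF assms(3)]
    by (metis QmodZ.inv_closed QmodZ.inv_equality QmodZ.inv_inv)
qed

lemma partial_char_pow:
  assumes T: "partial_char G T" and xy: "(x, y) \<in> T"
  shows "(x [^] (k :: int), y [^]\<^bsub>QmodZ\<^esub> k) \<in> T"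
proof -
  note D = partial_charD[OF T]
  have nat: "(x [^] (n :: nat), y [^]\<^bsub>QmodZ\<^esub> n) \<in> T" for n
    by (induction n) (auto simp: D(3) intro: D(4) xy)
  show ?thesis
  proof (cases k rule: int_cases2)
    case (nonneg n)
    then show ?thesis using nat by (simp add: int_pow_int)
  next
    case (nonpos n)
    then show ?thesis
      using D(5)[OF nat[of n]] D(1,2)[OF xy] by (simp add: int_pow_neg_int QmodZ.int_pow_neg_int)
  qed
qed

text \<open>T' is generated by T and (g, q). \<open>compat\<close> says that q agrees with T on the
  powers of g already in the domain, which keeps T' single-valued.\<close>

lemma partial_char_insert:
  assumes T: "partial_char G T" and g: "g \<in> carrier G" and q: "q \<in> carrier QmodZ"
    and compat: "\<And>k y. (g [^] (k :: int), y) \<in> T \<Longrightarrow> y = q [^]\<^bsub>QmodZ\<^esub> k"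
  shows "\<exists>T'. partial_char G T' \<and> T \<subseteq> T' \<and> (g, q) \<in> T'"
proof -
  note D = partial_charD[OF T]
  define T' where "T' = {(h \<otimes> g [^] (k :: int), y \<otimes>\<^bsub>QmodZ\<^esub> q [^]\<^bsub>QmodZ\<^esub> k) | h y k. (h, y) \<in> T}"
  have I: "(h \<otimes> g [^] k, y \<otimes>\<^bsub>QmodZ\<^esub> q [^]\<^bsub>QmodZ\<^esub> k) \<in> T'" if "(h, y) \<in> T" for h y and k :: int
    using that unfolding T'_def by blast
  have "T \<subseteq> T'"
  proof
    fix p assume p: "p \<in> T"
    obtain h y where hy: "p = (h, y)" by (cases p)
    with p I[of h y 0] D(1,2)[of h y] show "p \<in> T'" by simp
  qed
  moreover have "(g, q) \<in> T'" using I[OF D(3), of 1] g q by simp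
  moreover have "partial_char G T'"
    unfolding partial_char_def
  proof (intro conjI allI impI)
    show "T' \<subseteq> carrier G \<times> carrier QmodZ" using D(1,2) g q by (auto simp: T'_def)
    show "(\<one>, \<one>\<^bsub>QmodZ\<^esub>) \<in> T'" using \<open>T \<subseteq> T'\<close> D(3) by blast
  next
    fix x y x' y' assume "(x, y) \<in> T'" "(x', y') \<in> T'"
    then obtain h z k h' z' k' where *: "(h, z) \<in> T" "(h', z') \<in> T"
      "x = h \<otimes> g [^] (k :: int)" "y = z \<otimes>\<^bsub>QmodZ\<^esub> q [^]\<^bsub>QmodZ\<^esub> k"
      "x' = h' \<otimes> g [^] (k' :: int)" "y' = z' \<otimes>\<^bsub>QmodZ\<^esub> q [^]\<^bsub>QmodZ\<^esub> k'"
      unfolding T'_def by blast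
    have "x \<otimes> x' = (h \<otimes> h') \<otimes> g [^] (k + k')"
      using * g D(1)[OF *(1)] D(1)[OF *(2)] by (simp add: int_pow_mult m_ac)
    moreover have "y \<otimes>\<^bsub>QmodZ\<^esub> y' = (z \<otimes>\<^bsub>QmodZ\<^esub> z') \<otimes>\<^bsub>QmodZ\<^esub> q [^]\<^bsub>QmodZ\<^esub> (k + k')"
      using * q D(2)[OF *(1)] D(2)[OF *(2)] by (simp add: QmodZ.int_pow_mult QmodZ.m_ac)
    ultimately show "(x \<otimes> x', y \<otimes>\<^bsub>QmodZ\<^esub> y') \<in> T'" using I[OF D(4)[OF *(1,2)]] by simp
  next
    fix x y assume "(x, y) \<in> T'"
    then obtain h z k where *: "(h, z) \<in> T"
      "x = h \<otimes> g [^] (k :: int)" "y = z \<otimes>\<^bsub>QmodZ\<^esub> q [^]\<^bsub>QmodZ\<^esub> k"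
      unfolding T'_def by blast
    then show "(inv x, inv\<^bsub>QmodZ\<^esub> y) \<in> T'"
      using I[OF D(5)[OF *(1)], of "- k"] g q D(1,2)[OF *(1)]
      by (simp add: inv_mult QmodZ.inv_mult int_pow_neg QmodZ.int_pow_neg)
  next
    fix y assume "(\<one>, y) \<in> T'"
    then obtain h z k where *: "(h, z) \<in> T"
      "\<one> = h \<otimes> g [^] (k :: int)" "y = z \<otimes>\<^bsub>QmodZ\<^esub> q [^]\<^bsub>QmodZ\<^esub> k"
      unfolding T'_def by blast
    then have "inv (g [^] k) = h" using D(1)[OF *(1)] g by (intro inv_equality) auto
    then have "g [^] (- k) = h" using g by (simp add: int_pow_neg)
    with *(1) have "z = q [^]\<^bsub>QmodZ\<^esub> (- k)" using compat by blast
    with * q show "y = \<one>\<^bsub>QmodZ\<^esub>" by (simp flip: QmodZ.int_pow_mult)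
  qed
  ultimately show ?thesis by blast
qed

text \<open>The k for which the k-th power of g lies in the domain form an ideal of the integers. If
  n > 0 generates it, the value at g must be an n-th root of the value at the n-th power, and Q/Z is
  divisible.\<close>

lemma ex_partial_char_value:
  assumes T: "partial_char G T" and g: "g \<in> carrier G"
  shows "\<exists>q\<in>carrier QmodZ. \<forall>k y. (g [^] (k :: int), y) \<in> T \<longrightarrow> y = q [^]\<^bsub>QmodZ\<^esub> k"
proof (cases "\<exists>k > 0. \<exists>y. (g [^] (k :: int), y) \<in> T")
  case False
  note D = partial_charD[OF T]
  have "k = 0" if ky: "(g [^] k, y) \<in> T" for k :: int and y
  proof (rule ccontr)
    assume "k \<noteq> 0"
    then consider "k > 0" | "- k > 0" by linarith
    then show False
    proof cases
      case 2
      from D(5)[OF ky] have "(g [^] (- k), inv\<^bsub>QmodZ\<^esub> y) \<in> T" using g by (simp add: int_pow_neg)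
      with 2 False show False by blast
    qed (use False ky in blast)
  qed
  \<comment> \<open>Only k = 0 is constrained, so the trivial value serves.\<close>
  with D(6) show ?thesis by (intro bexI[of _ "\<one>\<^bsub>QmodZ\<^esub>"]) force+
next
  case True
  note D = partial_charD[OF T]
  let ?P = "\<lambda>n::nat. n > 0 \<and> (\<exists>y. (g [^] (int n), y) \<in> T)"
  define n where "n = (LEAST n. ?P n)"
  from True obtain k y where "k > 0" "(g [^] (k :: int), y) \<in> T" by blast
  then have "?P (nat k)" by auto
  then have n: "?P n" unfolding n_def by (rule LeastI)
  have least: "n \<le> l" if "?P l" for l unfolding n_def using that by (rule Least_le)
  from n obtain y0 where y0: "(g [^] (int n), y0) \<in> T" by blast
  obtain q where q: "q \<in> carrier QmodZ" "q [^]\<^bsub>QmodZ\<^esub> (int n) = y0"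
    using QmodZ_divisible[OF D(2)[OF y0], of "int n"] n by auto
  have "y = q [^]\<^bsub>QmodZ\<^esub> k" if ky: "(g [^] k, y) \<in> T" for k :: int and y
  proof -
    let ?m = "k div int n" and ?r = "k mod int n"
    have pm: "(g [^] (int n * ?m), y0 [^]\<^bsub>QmodZ\<^esub> ?m) \<in> T"
      using partial_char_pow[OF T y0, of ?m] g by (simp add: int_pow_pow)
    have "g [^] k \<otimes> inv (g [^] (int n * ?m)) = g [^] ?r"
      using g by (simp flip: int_pow_neg int_pow_mult add: minus_mult_div_eq_mod)
    then have r: "(g [^] ?r, y \<otimes>\<^bsub>QmodZ\<^esub> inv\<^bsub>QmodZ\<^esub> (y0 [^]\<^bsub>QmodZ\<^esub> ?m)) \<in> T"
      using D(4)[OF ky D(5)[OF pm]] by simp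
    \<comment> \<open>A nonzero remainder would be a positive exponent in the domain smaller than
      n.\<close>
    have "?r = 0"
    proof (rule ccontr)
      assume "?r \<noteq> 0"
      moreover have "?r \<ge> 0" "?r < int n" using n by auto
      ultimately have "?P (nat ?r)" using r by auto
      from least[OF this] \<open>?r < int n\<close> \<open>?r \<ge> 0\<close> show False by linarith
    qed
    then have "k = int n * ?m" by (metis add.right_neutral mult_div_mod_eq)
    with pm have "(g [^] k, y0 [^]\<^bsub>QmodZ\<^esub> ?m) \<in> T" by simp
    from partial_char_unique[OF T ky this] have "y = q [^]\<^bsub>QmodZ\<^esub> (int n * ?m)"
      by (simp flip: q(2) add: QmodZ.int_pow_pow[OF q(1)])
    with \<open>k = int n * ?m\<close> show ?thesis by simp
  qed
  with q(1) show ?thesis by blast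
qed

text \<open>Zorn's lemma on graphs ordered by inclusion: at any g outside its domain, a maximal
  graph could be enlarged by \<open>partial_char_insert\<close>.\<close>

lemma partial_char_extend:
  assumes T: "partial_char G T"
  shows "\<exists>\<omega>\<in>hom G QmodZ. \<forall>(x, y)\<in>T. \<omega> x = y"
proof -
  let ?A = "{T'. partial_char G T' \<and> T \<subseteq> T'}"
  have "\<exists>M\<in>?A. \<forall>X\<in>?A. M \<subseteq> X \<longrightarrow> X = M"
  proof (rule subset_Zorn_nonempty)
    show "?A \<noteq> {}" using T by blast
    fix C assume C: "C \<noteq> {}" "subset.chain ?A C"
    then have pc: "partial_char G X" "T \<subseteq> X" if "X \<in> C" for X
      using that by (auto simp: subset_chain_def)
    have "partial_char G (\<Union>C)"
      unfolding partial_char_def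
    proof (intro conjI allI impI)
      show "\<Union>C \<subseteq> carrier G \<times> carrier QmodZ" using partial_charD(1,2)[OF pc(1)] by auto
      show "(\<one>, \<one>\<^bsub>QmodZ\<^esub>) \<in> \<Union>C" using C(1) partial_charD(3)[OF pc(1)] by blast
      show "(x \<otimes> x', y \<otimes>\<^bsub>QmodZ\<^esub> y') \<in> \<Union>C" if xy: "(x, y) \<in> \<Union>C" "(x', y') \<in> \<Union>C" for x y x' y'
      proof -
        obtain X X' where X: "X \<in> C" "X' \<in> C" "(x, y) \<in> X" "(x', y') \<in> X'" using xy by blast
        then have "X \<subseteq> X' \<or> X' \<subseteq> X" using C(2) by (auto simp: subset_chain_def)
        then obtain Y where "Y \<in> C" "(x, y) \<in> Y" "(x', y') \<in> Y" using X by blast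
        then show ?thesis using partial_charD(4)[OF pc(1)[of Y]] by blast
      qed
      show "(inv x, inv\<^bsub>QmodZ\<^esub> y) \<in> \<Union>C" if "(x, y) \<in> \<Union>C" for x y
        using that partial_charD(5)[OF pc(1)] by blast
      show "y = \<one>\<^bsub>QmodZ\<^esub>" if "(\<one>, y) \<in> \<Union>C" for y
        using that partial_charD(6)[OF pc(1)] by blast
    qed
    then show "\<Union>C \<in> ?A" using C(1) pc by blast
  qed
  then obtain M where M: "partial_char G M" "T \<subseteq> M"
    and max: "\<And>X. \<lbrakk>partial_char G X; M \<subseteq> X\<rbrakk> \<Longrightarrow> X = M"
    by (auto; blast)
  note D = partial_charD[OF M(1)]
  have dom: "\<exists>y. (g, y) \<in> M" if g: "g \<in> carrier G" for g
  proof -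
    obtain q where q: "q \<in> carrier QmodZ" "\<And>k y. (g [^] (k :: int), y) \<in> M \<Longrightarrow> y = q [^]\<^bsub>QmodZ\<^esub> k"
      using ex_partial_char_value[OF M(1) g] by blast
    obtain X where "partial_char G X" "M \<subseteq> X" "(g, q) \<in> X"
      using partial_char_insert[OF M(1) g q] by blast
    with max show ?thesis by blast
  qed
  define \<omega> where "\<omega> x = (THE y. (x, y) \<in> M)" for x
  have \<omega>: "\<omega> x = y" if "(x, y) \<in> M" for x y
    unfolding \<omega>_def by (rule the_equality, rule that) (rule partial_char_unique[OF M(1) _ that])
  have "\<omega> \<in> hom G QmodZ"
  proof (rule homI)
    show "\<omega> x \<in> carrier QmodZ" if "x \<in> carrier G" for x
      using dom[OF that] \<omega> D(2) by blast
    show "\<omega> (x \<otimes> y) = \<omega> x \<otimes>\<^bsub>QmodZ\<^esub> \<omega> y" if xy: "x \<in> carrier G" "y \<in> carrier G" for x y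
    proof -
      obtain a b where "(x, a) \<in> M" "(y, b) \<in> M" using dom xy by blast
      with D(4)[OF this] show ?thesis by (simp add: \<omega>)
    qed
  qed
  moreover have "\<forall>(x, y)\<in>T. \<omega> x = y" using \<omega> M(2) by blast
  ultimately show ?thesis by blast
qed

text \<open>Injectivity of Q/Z in the form used later: \<chi> is well defined on the image of f, and
  the resulting graph extends to G. f may have a kernel, as long as \<chi> kills it.\<close>

lemma character_factor:
  assumes X: "group X" and f: "f \<in> hom X G" and \<chi>: "\<chi> \<in> hom X QmodZ"
    and ker: "\<And>x. \<lbrakk>x \<in> carrier X; f x = \<one>\<rbrakk> \<Longrightarrow> \<chi> x = \<one>\<^bsub>QmodZ\<^esub>"
  shows "\<exists>\<omega>\<in>hom G QmodZ. \<forall>x\<in>carrier X. \<omega> (f x) = \<chi> x"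
proof -
  interpret X: group X by fact
  interpret f: group_hom X G f using X f by (simp add: group_hom_def group_hom_axioms_def is_group)
  interpret \<chi>: group_hom X QmodZ \<chi>
    using X \<chi> by (simp add: group_hom_def group_hom_axioms_def QmodZ.is_group)
  let ?T = "{(f x, \<chi> x) | x. x \<in> carrier X}"
  have I: "(f x, \<chi> x) \<in> ?T" if "x \<in> carrier X" for x using that by blast
  have "partial_char G ?T"
    unfolding partial_char_def
  proof (intro conjI allI impI)
    show "(\<one>, \<one>\<^bsub>QmodZ\<^esub>) \<in> ?T" using I[OF X.one_closed] by simp
    show "(a \<otimes> a', b \<otimes>\<^bsub>QmodZ\<^esub> b') \<in> ?T" if ab: "(a, b) \<in> ?T" "(a', b') \<in> ?T" for a b a' b'
    proof -
      obtain x x' where "x \<in> carrier X" "x' \<in> carrier X" "a = f x" "b = \<chi> x" "a' = f x'" "b' = \<chi> x'"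
        using ab by blast
      with I[of "x \<otimes>\<^bsub>X\<^esub> x'"] show ?thesis by simp
    qed
    show "(inv a, inv\<^bsub>QmodZ\<^esub> b) \<in> ?T" if ab: "(a, b) \<in> ?T" for a b
    proof -
      obtain x where "x \<in> carrier X" "a = f x" "b = \<chi> x" using ab by blast
      with I[of "inv\<^bsub>X\<^esub> x"] show ?thesis by simp
    qed
  qed (use ker in auto)
  from partial_char_extend[OF this] show ?thesis by blast
qed

text \<open>At x a class of rationals is prescribed that is nontrivial but killed by every exponent
  that kills x: 1/2 works for infinite order, 1/n for order n.\<close>

lemma separating_character:
  assumes x: "x \<in> carrier G" "x \<noteq> \<one>"
  shows "\<exists>\<omega>\<in>hom G QmodZ. \<omega> x \<noteq> \<one>\<^bsub>QmodZ\<^esub>"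
proof -
  have T: "partial_char G {(\<one>, \<one>\<^bsub>QmodZ\<^esub>)}" by (auto simp: partial_char_def)
  have "\<exists>q. q \<notin> \<int> \<and> (\<forall>k::int. x [^] k = \<one> \<longrightarrow> of_int k * q \<in> (\<int> :: rat set))"
  proof (cases "\<exists>n>0. x [^] (n :: nat) = \<one>")
    case False
    have "k = 0" if k: "x [^] k = \<one>" for k :: int
    proof (rule ccontr)
      assume "k \<noteq> 0"
      then have "nat \<bar>k\<bar> > 0" by simp
      moreover have "x [^] (nat \<bar>k\<bar>) = \<one>"
        using k x(1) by (cases k rule: int_cases2) (auto simp: int_pow_int int_pow_neg)
      ultimately show False using False by blast
    qed
    moreover have "(1 / 2 :: rat) \<notin> \<int>"
    proof
      assume "(1 / 2 :: rat) \<in> \<int>"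
      then obtain z where "(1 / 2 :: rat) = of_int z" by (rule Ints_cases)
      then have "(of_int 1 :: rat) = of_int (2 * z)" by simp
      then have "1 = 2 * z" by (simp only: of_int_eq_iff)
      then show False by presburger
    qed
    moreover from calculation(1) have "of_int k * (1 / 2) \<in> (\<int> :: rat set)" if "x [^] k = \<one>" for k :: int
      using that by fastforce
    ultimately show ?thesis by blast
  next
    case True
    define n where "n = (LEAST n. n > 0 \<and> x [^] (n :: nat) = \<one>)"
    have n: "n > 0" "x [^] n = \<one>" using LeastI_ex[OF True] by (simp_all add: n_def)
    have least: "n \<le> l" if "l > 0" "x [^] l = \<one>" for l
      unfolding n_def using that by (intro Least_le) simp
    \<comment> \<open>x is not the identity, so n is at least 2 and 1/n is not an integer.\<close>
    have "n \<noteq> 1" using n(2) x by auto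
    have "(1 / of_nat n :: rat) \<notin> \<int>"
    proof
      assume "(1 / of_nat n :: rat) \<in> \<int>"
      then obtain z where z: "(1 / of_nat n :: rat) = of_int z" by (rule Ints_cases)
      then have "(of_int 1 :: rat) = of_int (int n * z)" using n(1) by (simp add: field_simps)
      then have "1 = int n * z" by (simp only: of_int_eq_iff)
      then have "int n dvd 1" by (rule dvdI)
      with \<open>n \<noteq> 1\<close> show False by simp
    qed
    moreover have "of_int k * (1 / of_nat n) \<in> (\<int> :: rat set)" if k: "x [^] k = \<one>" for k :: int
    proof -
      let ?r = "nat (k mod int n)"
      have "x [^] (int n * (k div int n)) = \<one>"
        using n(2) x(1) by (simp flip: int_pow_pow add: int_pow_int)
      then have "x [^] (k mod int n) = \<one>"
        using k int_pow_mult[OF x(1), of "int n * (k div int n)" "k mod int n"] x(1) by simp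
      then have "x [^] ?r = \<one>" using n(1) by (simp flip: int_pow_int)
      moreover have r: "k mod int n \<ge> 0" "k mod int n < int n" using n(1) by auto
      ultimately have "\<not> ?r > 0" using least[of ?r] by linarith
      with r have "k mod int n = 0" by simp
      then have "int n dvd k" by (rule mod_0_imp_dvd)
      then obtain m where "k = int n * m" by blast
      then show ?thesis using n(1) by simp
    qed
    ultimately show ?thesis by blast
  qed
  then obtain q where q: "q \<notin> \<int>" "\<And>k::int. x [^] k = \<one> \<Longrightarrow> of_int k * q \<in> (\<int> :: rat set)" by blast
  have "y = rat_class q [^]\<^bsub>QmodZ\<^esub> k" if "(x [^] k, y) \<in> {(\<one>, \<one>\<^bsub>QmodZ\<^esub>)}" for k :: int and y
    using that q(2)[of k] rat_class_eq_one by (auto simp: rat_class_pow)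
  from partial_char_insert[OF T x(1) rat_class_closed this]
  obtain T' where T': "partial_char G T'" "(x, rat_class q) \<in> T'" by blast
  from partial_char_extend[OF T'(1)] T'(2) obtain \<omega> where "\<omega> \<in> hom G QmodZ" "\<omega> x = rat_class q" by auto
  with q(1) rat_class_eq_one show ?thesis by metis
qed

end

lemma small_QmodZ:
  assumes "universe_type TYPE('u)"
  shows "carrier QmodZ \<prec> (UNIV :: 'u set)"
  by (rule small_countable[OF assms]) (simp add: carrier_QmodZ)

section \<open>Pontryagin duals\<close>

lemma op_ring_simps [simp]:
  "carrier (op_ring R) = carrier R" "\<one>\<^bsub>op_ring R\<^esub> = \<one>\<^bsub>R\<^esub>" "\<zero>\<^bsub>op_ring R\<^esub> = \<zero>\<^bsub>R\<^esub>"
  "a \<oplus>\<^bsub>op_ring R\<^esub> b = a \<oplus>\<^bsub>R\<^esub> b" "a \<otimes>\<^bsub>op_ring R\<^esub> b = b \<otimes>\<^bsub>R\<^esub> a"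
  by (simp_all add: op_ring_def)

lemma op_ring_op_ring [simp]: "op_ring (op_ring R) = R"
  by (simp add: op_ring_def)

lemma ring_op_ring:
  assumes "ring R" shows "ring (op_ring R)"
proof -
  interpret R: ring R by fact
  show ?thesis
  proof (rule ringI)
    show "abelian_group (op_ring R)"
      by (rule abelian_groupI) (auto simp: R.a_ac intro: R.l_neg R.a_inv_closed)
    show "monoid (op_ring R)"
      by (rule monoidI) (auto simp: R.m_assoc)
  qed (auto simp: R.l_distr R.r_distr)
qed

lemma dual_memD:
  assumes "\<chi> \<in> carrier (dual M)"
  shows "\<chi> \<in> hom (add_monoid M) QmodZ" "\<chi> \<in> extensional (carrier M)"
    and "x \<in> carrier M \<Longrightarrow> \<chi> x \<in> carrier QmodZ"
    and "\<lbrakk>x \<in> carrier M; y \<in> carrier M\<rbrakk> \<Longrightarrow> \<chi> (x \<oplus>\<^bsub>M\<^esub> y) = \<chi> x \<otimes>\<^bsub>QmodZ\<^esub> \<chi> y"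
  using assms by (auto simp: dual_def hom_def)

lemma dual_memI:
  assumes "\<And>x. x \<in> carrier M \<Longrightarrow> \<chi> x \<in> carrier QmodZ"
    and "\<And>x y. \<lbrakk>x \<in> carrier M; y \<in> carrier M; x \<oplus>\<^bsub>M\<^esub> y \<in> carrier M\<rbrakk> \<Longrightarrow>
      \<chi> (x \<oplus>\<^bsub>M\<^esub> y) = \<chi> x \<otimes>\<^bsub>QmodZ\<^esub> \<chi> y"
    and "lmodule R M"
  shows "restrict \<chi> (carrier M) \<in> carrier (dual M)"
proof -
  interpret lmodule R M by fact
  show ?thesis using assms(1,2) by (auto simp: dual_def hom_def)
qed

lemma dual_eqI:
  "\<lbrakk>\<phi> \<in> carrier (dual M); \<chi> \<in> carrier (dual M); \<And>x. x \<in> carrier M \<Longrightarrow> \<phi> x = \<chi> x\<rbrakk> \<Longrightarrow> \<phi> = \<chi>"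
  using dual_memD(2) by (blast intro: extensionalityI)

lemma dual_simps:
  "x \<in> carrier M \<Longrightarrow> (\<phi> \<oplus>\<^bsub>dual M\<^esub> \<chi>) x = \<phi> x \<otimes>\<^bsub>QmodZ\<^esub> \<chi> x"
  "x \<in> carrier M \<Longrightarrow> \<zero>\<^bsub>dual M\<^esub> x = \<one>\<^bsub>QmodZ\<^esub>"
  "x \<in> carrier M \<Longrightarrow> (r \<odot>\<^bsub>dual M\<^esub> \<phi>) x = \<phi> (r \<odot>\<^bsub>M\<^esub> x)"
  by (auto simp: dual_def)

text \<open>A scalar acts on a character through its argument, so successive scalars compose in the
  opposite order; hence \<open>op_ring R\<close>.\<close>

lemma lmodule_dual:
  assumes M: "lmodule R M"
  shows "lmodule (op_ring R) (dual M)"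
proof -
  interpret M: lmodule R M by fact
  note I = dual_memI[OF _ _ M]
  have add: "\<phi> \<oplus>\<^bsub>dual M\<^esub> \<chi> \<in> carrier (dual M)"
    if "\<phi> \<in> carrier (dual M)" "\<chi> \<in> carrier (dual M)" for \<phi> \<chi>
    using I[of "\<lambda>x. \<phi> x \<otimes>\<^bsub>QmodZ\<^esub> \<chi> x"] dual_memD(3,4)[OF that(1)] dual_memD(3,4)[OF that(2)]
    by (simp add: dual_def QmodZ.m_ac)
  have zero: "\<zero>\<^bsub>dual M\<^esub> \<in> carrier (dual M)"
    using I[of "\<lambda>x. \<one>\<^bsub>QmodZ\<^esub>"] by (simp add: dual_def)
  have smult: "r \<odot>\<^bsub>dual M\<^esub> \<phi> \<in> carrier (dual M)"
    if r: "r \<in> carrier R" and \<phi>: "\<phi> \<in> carrier (dual M)" for r \<phi>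
    using I[of "\<lambda>x. \<phi> (r \<odot>\<^bsub>M\<^esub> x)"] dual_memD(3,4)[OF \<phi>] r
    by (simp add: dual_def M.smult_closed M.smult_r_distr)
  have "abelian_group (dual M)"
  proof (rule abelian_groupI)
    fix \<phi> assume \<phi>: "\<phi> \<in> carrier (dual M)"
    have "(\<lambda>x\<in>carrier M. inv\<^bsub>QmodZ\<^esub> \<phi> x) \<in> carrier (dual M)"
      by (rule I) (auto simp: dual_memD(3,4)[OF \<phi>] QmodZ.inv_mult)
    moreover have "(\<lambda>x\<in>carrier M. inv\<^bsub>QmodZ\<^esub> \<phi> x) \<oplus>\<^bsub>dual M\<^esub> \<phi> = \<zero>\<^bsub>dual M\<^esub>"
      by (rule dual_eqI[OF add[OF calculation \<phi>] zero]) (simp add: dual_simps dual_memD(3)[OF \<phi>])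
    ultimately show "\<exists>\<chi>\<in>carrier (dual M). \<chi> \<oplus>\<^bsub>dual M\<^esub> \<phi> = \<zero>\<^bsub>dual M\<^esub>" by blast
    show "\<zero>\<^bsub>dual M\<^esub> \<oplus>\<^bsub>dual M\<^esub> \<phi> = \<phi>"
      by (rule dual_eqI[OF add[OF zero \<phi>] \<phi>]) (simp add: dual_simps dual_memD(3)[OF \<phi>])
    fix \<chi> assume \<chi>: "\<chi> \<in> carrier (dual M)"
    show "\<phi> \<oplus>\<^bsub>dual M\<^esub> \<chi> \<in> carrier (dual M)" by (rule add[OF \<phi> \<chi>])
    show "\<phi> \<oplus>\<^bsub>dual M\<^esub> \<chi> = \<chi> \<oplus>\<^bsub>dual M\<^esub> \<phi>"
      by (rule dual_eqI[OF add[OF \<phi> \<chi>] add[OF \<chi> \<phi>]])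
        (simp add: dual_simps dual_memD(3)[OF \<phi>] dual_memD(3)[OF \<chi>] QmodZ.m_comm)
    fix \<psi> assume \<psi>: "\<psi> \<in> carrier (dual M)"
    show "\<phi> \<oplus>\<^bsub>dual M\<^esub> \<chi> \<oplus>\<^bsub>dual M\<^esub> \<psi> = \<phi> \<oplus>\<^bsub>dual M\<^esub> (\<chi> \<oplus>\<^bsub>dual M\<^esub> \<psi>)"
      by (rule dual_eqI[OF add[OF add[OF \<phi> \<chi>] \<psi>] add[OF \<phi> add[OF \<chi> \<psi>]]])
        (simp add: dual_simps dual_memD(3)[OF \<phi>] dual_memD(3)[OF \<chi>] dual_memD(3)[OF \<psi>] QmodZ.m_assoc)
  qed (rule zero)
  then show ?thesis
  proof (rule lmoduleI[OF ring_op_ring[OF M.R.ring_axioms]]; unfold op_ring_simps)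
    fix r s \<phi> assume r: "r \<in> carrier R" and s: "s \<in> carrier R" and \<phi>: "\<phi> \<in> carrier (dual M)"
    show "(r \<oplus>\<^bsub>R\<^esub> s) \<odot>\<^bsub>dual M\<^esub> \<phi> = r \<odot>\<^bsub>dual M\<^esub> \<phi> \<oplus>\<^bsub>dual M\<^esub> s \<odot>\<^bsub>dual M\<^esub> \<phi>"
      by (rule dual_eqI[OF smult[OF _ \<phi>] add[OF smult[OF r \<phi>] smult[OF s \<phi>]]])
        (simp_all add: r s dual_simps M.smult_l_distr M.smult_closed dual_memD(4)[OF \<phi>])
    show "(s \<otimes>\<^bsub>R\<^esub> r) \<odot>\<^bsub>dual M\<^esub> \<phi> = r \<odot>\<^bsub>dual M\<^esub> (s \<odot>\<^bsub>dual M\<^esub> \<phi>)"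
      by (rule dual_eqI[OF smult[OF _ \<phi>] smult[OF r smult[OF s \<phi>]]])
        (simp_all add: r s dual_simps M.smult_assoc1 M.smult_closed)
  next
    fix r \<phi> \<chi> assume r: "r \<in> carrier R" and \<phi>: "\<phi> \<in> carrier (dual M)" and \<chi>: "\<chi> \<in> carrier (dual M)"
    show "r \<odot>\<^bsub>dual M\<^esub> (\<phi> \<oplus>\<^bsub>dual M\<^esub> \<chi>) = r \<odot>\<^bsub>dual M\<^esub> \<phi> \<oplus>\<^bsub>dual M\<^esub> r \<odot>\<^bsub>dual M\<^esub> \<chi>"
      by (rule dual_eqI[OF smult[OF r add[OF \<phi> \<chi>]] add[OF smult[OF r \<phi>] smult[OF r \<chi>]]])
        (simp add: r dual_simps M.smult_closed)
  next
    fix \<phi> assume \<phi>: "\<phi> \<in> carrier (dual M)"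
    show "\<one>\<^bsub>R\<^esub> \<odot>\<^bsub>dual M\<^esub> \<phi> = \<phi>"
      by (rule dual_eqI[OF smult[OF _ \<phi>] \<phi>]) (simp_all add: dual_simps M.smult_one)
  qed (rule smult)
qed

lemma small_dual:
  fixes M :: "('r, 'a) module"
  assumes U: "universe_type TYPE('u)" and M: "carrier M \<prec> (UNIV :: 'u set)"
  shows "carrier (dual M) \<prec> (UNIV :: 'u set)"
proof -
  have "carrier (dual M) \<subseteq> carrier M \<rightarrow>\<^sub>E carrier QmodZ"
    by (auto simp: dual_def hom_def PiE_def)
  from subset_imp_lepoll[OF this] small_PiE[OF U M small_QmodZ[OF U]] show ?thesis
    by (rule lesspoll_trans1)
qed

definition dual_map :: "('r, 'a) module \<Rightarrow> ('a \<Rightarrow> 'b) \<Rightarrow> ('b \<Rightarrow> rat set) \<Rightarrow> ('a \<Rightarrow> rat set)" where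
  "dual_map A f = (\<lambda>\<phi>. \<lambda>x\<in>carrier A. \<phi> (f x))"

lemma dual_map_hom:
  assumes A: "lmodule R A" and B: "lmodule R B" and f: "f \<in> mod_hom R A B"
  shows "dual_map A f \<in> mod_hom (op_ring R) (dual B) (dual A)"
proof (rule mod_homI)
  interpret A: lmodule R A by fact
  interpret A': lmodule "op_ring R" "dual A" by (rule lmodule_dual[OF A])
  interpret B': lmodule "op_ring R" "dual B" by (rule lmodule_dual[OF B])
  have cl: "dual_map A f \<phi> \<in> carrier (dual A)" if "\<phi> \<in> carrier (dual B)" for \<phi>
    unfolding dual_map_def
    by (rule dual_memI[OF _ _ A]) (auto simp: dual_memD(3,4)[OF that] mod_hom_closed[OF f] mod_hom_add[OF f])
  then show "dual_map A f \<phi> \<in> carrier (dual A)" if "\<phi> \<in> carrier (dual B)" for \<phi> using that .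
  show "dual_map A f (\<phi> \<oplus>\<^bsub>dual B\<^esub> \<chi>) = dual_map A f \<phi> \<oplus>\<^bsub>dual A\<^esub> dual_map A f \<chi>"
    if "\<phi> \<in> carrier (dual B)" "\<chi> \<in> carrier (dual B)" for \<phi> \<chi>
  proof (rule dual_eqI[of _ A])
    fix x assume "x \<in> carrier A"
    then show "dual_map A f (\<phi> \<oplus>\<^bsub>dual B\<^esub> \<chi>) x = (dual_map A f \<phi> \<oplus>\<^bsub>dual A\<^esub> dual_map A f \<chi>) x"
      by (simp add: dual_simps dual_map_def mod_hom_closed[OF f])
  qed (use that in \<open>auto intro!: cl A'.M.a_closed B'.M.a_closed\<close>)
  show "dual_map A f (r \<odot>\<^bsub>dual B\<^esub> \<phi>) = r \<odot>\<^bsub>dual A\<^esub> dual_map A f \<phi>"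
    if r: "r \<in> carrier (op_ring R)" "\<phi> \<in> carrier (dual B)" for r \<phi>
  proof (rule dual_eqI[of _ A])
    fix x assume "x \<in> carrier A"
    then show "dual_map A f (r \<odot>\<^bsub>dual B\<^esub> \<phi>) x = (r \<odot>\<^bsub>dual A\<^esub> dual_map A f \<phi>) x"
      using r by (simp add: dual_simps dual_map_def mod_hom_closed[OF f] mod_hom_smult[OF f] A.smult_closed)
  qed (use r in \<open>auto intro!: cl A'.smult_closed B'.smult_closed\<close>)
qed

lemma hom_add_monoid:
  assumes "f \<in> mod_hom R A B"
  shows "f \<in> hom (add_monoid A) (add_monoid B)"
  using assms by (auto simp: mod_hom_def hom_def)

text \<open>Exactness in the middle and surjectivity on the right both come from
  \<open>character_factor\<close>, applied to g and to f respectively.\<close>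

lemma dual_short_exact:
  assumes A: "lmodule R A" and B: "lmodule R B" and C: "lmodule R C" and s: "short_exact R A f B g C"
  shows "short_exact (op_ring R) (dual C) (dual_map B g) (dual B) (dual_map A f) (dual A)"
proof -
  interpret A: lmodule R A by fact
  interpret B: lmodule R B by fact
  interpret C: lmodule R C by fact
  note s = short_exactD[OF s]
  note gh = dual_map_hom[OF B C s(2)] and fh = dual_map_hom[OF A B s(1)]
  have dz: "\<chi> \<zero>\<^bsub>C\<^esub> = \<one>\<^bsub>QmodZ\<^esub>" if "\<chi> \<in> carrier (dual C)" for \<chi>
    using hom_one[OF dual_memD(1)[OF that]] C.M.a_group QmodZ.is_group by simp
  show ?thesis
  proof (rule short_exactI[OF gh fh])
    show "inj_on (dual_map B g) (carrier (dual C))"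
    proof (rule inj_onI)
      fix \<phi> \<chi> assume *: "\<phi> \<in> carrier (dual C)" "\<chi> \<in> carrier (dual C)" "dual_map B g \<phi> = dual_map B g \<chi>"
      show "\<phi> = \<chi>"
      proof (rule dual_eqI[OF *(1,2)])
        fix x assume "x \<in> carrier C"
        then obtain y where y: "y \<in> carrier B" "x = g y" using s(6) by blast
        then show "\<phi> x = \<chi> x" using fun_cong[OF *(3), of y] by (simp add: dual_map_def)
      qed
    qed
    show "dual_map A f (dual_map B g \<chi>) = \<zero>\<^bsub>dual A\<^esub>" if "\<chi> \<in> carrier (dual C)" for \<chi>
      using s(4) mod_hom_closed[OF s(1)] dz[OF that] by (auto simp: dual_map_def dual_def fun_eq_iff)
    show "\<exists>\<chi>\<in>carrier (dual C). \<phi> = dual_map B g \<chi>"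
      if \<phi>: "\<phi> \<in> carrier (dual B)" "dual_map A f \<phi> = \<zero>\<^bsub>dual A\<^esub>" for \<phi>
    proof -
      have "\<exists>\<omega>\<in>hom (add_monoid C) QmodZ. \<forall>x\<in>carrier (add_monoid B). \<omega> (g x) = \<phi> x"
      proof (rule comm_group.character_factor[OF C.M.a_comm_group B.M.a_group hom_add_monoid[OF s(2)]
            dual_memD(1)[OF \<phi>(1)]])
        fix y assume y: "y \<in> carrier (add_monoid B)" "g y = \<one>\<^bsub>add_monoid C\<^esub>"
        then obtain x where x: "x \<in> carrier A" "y = f x" using s(5)[of y] by auto
        then show "\<phi> y = \<one>\<^bsub>QmodZ\<^esub>" using fun_cong[OF \<phi>(2), of x] by (simp add: dual_map_def dual_simps)
      qed
      then obtain \<omega> where \<omega>: "\<omega> \<in> hom (add_monoid C) QmodZ" "\<And>x. x \<in> carrier B \<Longrightarrow> \<omega> (g x) = \<phi> x" by auto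
      have "restrict \<omega> (carrier C) \<in> carrier (dual C)"
        by (rule dual_memI[OF _ _ C]) (use \<omega>(1) in \<open>auto simp: hom_def\<close>)
      moreover have "\<phi> = dual_map B g (restrict \<omega> (carrier C))"
        by (rule dual_eqI[OF \<phi>(1) mod_hom_closed[OF gh calculation]])
          (simp add: dual_map_def mod_hom_closed[OF s(2)] \<omega>(2))
      ultimately show ?thesis by blast
    qed
    show "\<exists>\<chi>\<in>carrier (dual B). \<phi> = dual_map A f \<chi>" if \<phi>: "\<phi> \<in> carrier (dual A)" for \<phi>
    proof -
      have "\<exists>\<omega>\<in>hom (add_monoid B) QmodZ. \<forall>x\<in>carrier (add_monoid A). \<omega> (f x) = \<phi> x"
      proof (rule comm_group.character_factor[OF B.M.a_comm_group A.M.a_group hom_add_monoid[OF s(1)]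
            dual_memD(1)[OF \<phi>]])
        fix x assume x: "x \<in> carrier (add_monoid A)" "f x = \<one>\<^bsub>add_monoid B\<^esub>"
        then have "x = \<zero>\<^bsub>A\<^esub>"
          using inj_onD[OF s(3), of x "\<zero>\<^bsub>A\<^esub>"]
            mod_hom_zero[OF A.M.abelian_group_axioms B.M.abelian_group_axioms s(1)] by simp
        then show "\<phi> x = \<one>\<^bsub>QmodZ\<^esub>"
          using hom_one[OF dual_memD(1)[OF \<phi>]] A.M.a_group QmodZ.is_group by simp
      qed
      then obtain \<omega> where \<omega>: "\<omega> \<in> hom (add_monoid B) QmodZ" "\<And>x. x \<in> carrier A \<Longrightarrow> \<omega> (f x) = \<phi> x" by auto
      have "restrict \<omega> (carrier B) \<in> carrier (dual B)"
        by (rule dual_memI[OF _ _ B]) (use \<omega>(1) in \<open>auto simp: hom_def\<close>)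
      moreover have "\<phi> = dual_map A f (restrict \<omega> (carrier B))"
        by (rule dual_eqI[OF \<phi> mod_hom_closed[OF fh calculation]])
          (simp add: dual_map_def mod_hom_closed[OF s(1)] \<omega>(2))
      ultimately show ?thesis by blast
    qed
  qed
qed

text \<open>Injectivity is the existence of separating characters.\<close>

lemma bidual_eval_hom:
  assumes N: "lmodule R N"
  shows "bidual_eval N \<in> mod_hom R N (dual (dual N))" "inj_on (bidual_eval N) (carrier N)"
proof -
  interpret N: lmodule R N by fact
  have D: "lmodule (op_ring R) (dual N)" by (rule lmodule_dual[OF N])
  interpret D: lmodule "op_ring R" "dual N" by (rule D)
  have DD: "lmodule R (dual (dual N))" using lmodule_dual[OF D] by simp
  interpret DD: lmodule R "dual (dual N)" by (rule DD)
  have cl: "bidual_eval N x \<in> carrier (dual (dual N))" if "x \<in> carrier N" for x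
    unfolding bidual_eval_def
    by (rule dual_memI[OF _ _ D]) (auto simp: that dual_memD(3) dual_simps)
  show hom: "bidual_eval N \<in> mod_hom R N (dual (dual N))"
  proof (rule mod_homI[OF cl])
    fix x y assume xy: "x \<in> carrier N" "y \<in> carrier N"
    show "bidual_eval N (x \<oplus>\<^bsub>N\<^esub> y) = bidual_eval N x \<oplus>\<^bsub>dual (dual N)\<^esub> bidual_eval N y"
    proof (rule dual_eqI)
      fix \<phi> assume "\<phi> \<in> carrier (dual N)"
      then show "bidual_eval N (x \<oplus>\<^bsub>N\<^esub> y) \<phi> = (bidual_eval N x \<oplus>\<^bsub>dual (dual N)\<^esub> bidual_eval N y) \<phi>"
        by (simp add: xy dual_simps bidual_eval_def dual_memD(4))
    qed (use xy in \<open>auto intro!: cl DD.M.a_closed\<close>)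
  next
    fix r x assume rx: "r \<in> carrier R" "x \<in> carrier N"
    show "bidual_eval N (r \<odot>\<^bsub>N\<^esub> x) = r \<odot>\<^bsub>dual (dual N)\<^esub> bidual_eval N x"
    proof (rule dual_eqI)
      fix \<phi> assume "\<phi> \<in> carrier (dual N)"
      then show "bidual_eval N (r \<odot>\<^bsub>N\<^esub> x) \<phi> = (r \<odot>\<^bsub>dual (dual N)\<^esub> bidual_eval N x) \<phi>"
        using D.smult_closed[of r \<phi>] rx by (simp add: dual_simps bidual_eval_def)
    qed (use rx in \<open>auto intro!: cl DD.smult_closed N.smult_closed\<close>)
  qed
  show "inj_on (bidual_eval N) (carrier N)"
  proof (rule mod_hom_inj_onI[OF N DD hom])
    fix x assume x: "x \<in> carrier N" "bidual_eval N x = \<zero>\<^bsub>dual (dual N)\<^esub>"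
    show "x = \<zero>\<^bsub>N\<^esub>"
    proof (rule ccontr)
      assume "x \<noteq> \<zero>\<^bsub>N\<^esub>"
      then obtain \<omega> where \<omega>: "\<omega> \<in> hom (add_monoid N) QmodZ" "\<omega> x \<noteq> \<one>\<^bsub>QmodZ\<^esub>"
        using comm_group.separating_character[OF N.M.a_comm_group, of x] x(1) by auto
      have "restrict \<omega> (carrier N) \<in> carrier (dual N)"
        by (rule dual_memI[OF _ _ N]) (use \<omega>(1) in \<open>auto simp: hom_def\<close>)
      with fun_cong[OF x(2), of "restrict \<omega> (carrier N)"] \<omega>(2) x(1) show False
        by (simp add: bidual_eval_def dual_simps)
    qed
  qed
qed

text \<open>The size bound in the last conclusion is what gives the bidual quotient a copy in
  \<open>'u\<close>.\<close>

lemma bidual_short_exact: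
  assumes N: "lmodule R N"
  shows "lmodule R (bidual_quotient N)"
    and "\<exists>g. short_exact R N (bidual_eval N) (dual (dual N)) g (bidual_quotient N)"
    and "carrier (bidual_quotient N) \<lesssim> carrier (dual (dual N))"
proof -
  have DD: "lmodule R (dual (dual N))" using lmodule_dual[OF lmodule_dual[OF N]] by simp
  note e = bidual_eval_hom[OF N]
  have sub: "bidual_eval N ` carrier N \<subseteq> carrier (dual (dual N))"
    using mod_hom_closed[OF e(1)] by auto
  note q = lmodule_quotient[OF DD sub lmodule_image[OF N DD e(1)], folded bidual_quotient_def]
  show "lmodule R (bidual_quotient N)" by (rule q)
  show "\<exists>g. short_exact R N (bidual_eval N) (dual (dual N)) g (bidual_quotient N)"
    using e q by (auto simp: short_exact_def exact_at_def)
  show "carrier (bidual_quotient N) \<lesssim> carrier (dual (dual N))"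
    unfolding q(3)[symmetric] by (rule image_lepoll)
qed


section \<open>Characters of tensor products\<close>

definition tens ::
  "('r, 'x) ring_scheme \<Rightarrow> ('r, 'e) module \<Rightarrow> ('r, 'f) module \<Rightarrow> 'e \<Rightarrow> 'f \<Rightarrow> ('e \<times> 'f \<Rightarrow>\<^sub>0 int) set"
  where "tens R E F e x =
    tensor_rels R E F #>\<^bsub>free_Abelian_group (carrier E \<times> carrier F)\<^esub> frag_of (e, x)"

text \<open>The relators inside \<open>tensor_rels\<close>, named so that the generated subgroup can
  be treated by induction and the three kinds of relators by cases.\<close>

definition tensor_gens ::
  "('r, 'x) ring_scheme \<Rightarrow> ('r, 'e) module \<Rightarrow> ('r, 'f) module \<Rightarrow> ('e \<times> 'f \<Rightarrow>\<^sub>0 int) set" where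
  "tensor_gens R E F =
     {frag_of (e \<oplus>\<^bsub>E\<^esub> e', x) - frag_of (e, x) - frag_of (e', x) | e e' x.
           e \<in> carrier E \<and> e' \<in> carrier E \<and> x \<in> carrier F} \<union>
     {frag_of (e, x \<oplus>\<^bsub>F\<^esub> x') - frag_of (e, x) - frag_of (e, x') | e x x'.
           e \<in> carrier E \<and> x \<in> carrier F \<and> x' \<in> carrier F} \<union>
     {frag_of (r \<odot>\<^bsub>E\<^esub> e, x) - frag_of (e, r \<odot>\<^bsub>F\<^esub> x) | r e x.
           r \<in> carrier R \<and> e \<in> carrier E \<and> x \<in> carrier F}"

lemma tensor_gensE:
  assumes "c \<in> tensor_gens R E F"
  obtains (left) e e' x where "e \<in> carrier E" "e' \<in> carrier E" "x \<in> carrier F"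
      "c = frag_of (e \<oplus>\<^bsub>E\<^esub> e', x) - frag_of (e, x) - frag_of (e', x)"
    | (right) e x x' where "e \<in> carrier E" "x \<in> carrier F" "x' \<in> carrier F"
      "c = frag_of (e, x \<oplus>\<^bsub>F\<^esub> x') - frag_of (e, x) - frag_of (e, x')"
    | (smult) r e x where "r \<in> carrier R" "e \<in> carrier E" "x \<in> carrier F"
      "c = frag_of (r \<odot>\<^bsub>E\<^esub> e, x) - frag_of (e, r \<odot>\<^bsub>F\<^esub> x)"
  using assms unfolding tensor_gens_def by blast

lemma tensor_rels_eq:
  "tensor_rels R E F = generate (free_Abelian_group (carrier E \<times> carrier F)) (tensor_gens R E F)"
  by (simp add: tensor_rels_def tensor_gens_def)

text \<open>The shape that a character of the free abelian group takes on an additivity relator,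
  once differences are written with inverses and biadditivity is used.\<close>

lemma QmodZ_commutator:
  assumes "a \<in> carrier QmodZ" "b \<in> carrier QmodZ"
  shows "a \<otimes>\<^bsub>QmodZ\<^esub> b \<otimes>\<^bsub>QmodZ\<^esub> inv\<^bsub>QmodZ\<^esub> a \<otimes>\<^bsub>QmodZ\<^esub> inv\<^bsub>QmodZ\<^esub> b = \<one>\<^bsub>QmodZ\<^esub>"
proof -
  have "a \<otimes>\<^bsub>QmodZ\<^esub> b \<otimes>\<^bsub>QmodZ\<^esub> inv\<^bsub>QmodZ\<^esub> a = b"
    using assms by (simp add: QmodZ.m_comm[of a b] QmodZ.m_assoc)
  with assms show ?thesis by simp
qed

locale tensor_product =
  fixes R :: "('r, 'x) ring_scheme" and E :: "('r, 'e) module" and F :: "('r, 'f) module"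
  assumes E: "lmodule (op_ring R) E" and F: "lmodule R F"
begin

sublocale E: lmodule "op_ring R" E by (rule E)
sublocale F: lmodule R F by (rule F)

abbreviation free where "free \<equiv> free_Abelian_group (carrier E \<times> carrier F)"

lemma smult_closed_E: "\<lbrakk>r \<in> carrier R; e \<in> carrier E\<rbrakk> \<Longrightarrow> r \<odot>\<^bsub>E\<^esub> e \<in> carrier E"
  using E.smult_closed by simp

lemma diff_closed: "\<lbrakk>a \<in> carrier free; b \<in> carrier free\<rbrakk> \<Longrightarrow> a - b \<in> carrier free"
  using keys_diff[of a b] by auto

lemma gens_closed: "tensor_gens R E F \<subseteq> carrier free"
  unfolding tensor_gens_def
  by (auto simp del: carrier_free_Abelian_group_iff intro!: diff_closed simp: smult_closed_E F.smult_closed)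

lemma rels_subgroup: "subgroup (tensor_rels R E F) free"
  unfolding tensor_rels_eq by (rule group.generate_is_subgroup[OF group_free_Abelian_group gens_closed])

lemma rels_normal: "tensor_rels R E F \<lhd> free"
  by (rule comm_group.subgroup_imp_normal[OF abelian_free_Abelian_group rels_subgroup])

lemma comm_group_tensor: "comm_group (tensor R E F)"
  unfolding tensor_def by (rule comm_group.abelian_FactGroup[OF abelian_free_Abelian_group rels_subgroup])

lemma class_hom: "(\<lambda>c. tensor_rels R E F #>\<^bsub>free\<^esub> c) \<in> hom free (tensor R E F)"
  unfolding tensor_def by (rule normal.r_coset_hom_Mod[OF rels_normal])

lemma class_rels:
  assumes "c \<in> tensor_rels R E F"
  shows "tensor_rels R E F #>\<^bsub>free\<^esub> c = \<one>\<^bsub>tensor R E F\<^esub>"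
  using group.coset_join2[OF group_free_Abelian_group _ rels_subgroup assms]
    subgroup.subset[OF rels_subgroup] assms by (auto simp: tensor_def)

lemma class_eq:
  assumes "c - c' \<in> tensor_rels R E F" "c \<in> carrier free" "c' \<in> carrier free"
  shows "tensor_rels R E F #>\<^bsub>free\<^esub> c = tensor_rels R E F #>\<^bsub>free\<^esub> c'"
proof -
  interpret T: comm_group "tensor R E F" by (rule comm_group_tensor)
  let ?k = "\<lambda>c. tensor_rels R E F #>\<^bsub>free\<^esub> c"
  have cl: "c - c' \<in> carrier free" using subgroup.subset[OF rels_subgroup] assms(1) by blast
  have "?k c = ?k ((c - c') \<otimes>\<^bsub>free\<^esub> c')" by simp
  also have "\<dots> = ?k (c - c') \<otimes>\<^bsub>tensor R E F\<^esub> ?k c'"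
    by (rule hom_mult[OF class_hom cl assms(3)])
  also have "\<dots> = ?k c'"
    using class_rels[OF assms(1)] hom_in_carrier[OF class_hom assms(3)] by simp
  finally show ?thesis .
qed

lemma tens_closed: "\<lbrakk>e \<in> carrier E; x \<in> carrier F\<rbrakk> \<Longrightarrow> tens R E F e x \<in> carrier (tensor R E F)"
  unfolding tens_def by (rule hom_in_carrier[OF class_hom]) simp

lemma gen_rels: "c \<in> tensor_gens R E F \<Longrightarrow> c \<in> tensor_rels R E F"
  unfolding tensor_rels_eq by (rule generate.incl)

lemma class_add:
  assumes "c \<in> carrier free" "c' \<in> carrier free"
  shows "tensor_rels R E F #>\<^bsub>free\<^esub> (c + c')
    = (tensor_rels R E F #>\<^bsub>free\<^esub> c) \<otimes>\<^bsub>tensor R E F\<^esub> (tensor_rels R E F #>\<^bsub>free\<^esub> c')"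
  using hom_mult[OF class_hom assms] by simp

lemma tens_add_left:
  assumes "e \<in> carrier E" "e' \<in> carrier E" "x \<in> carrier F"
  shows "tens R E F (e \<oplus>\<^bsub>E\<^esub> e') x = tens R E F e x \<otimes>\<^bsub>tensor R E F\<^esub> tens R E F e' x"
proof -
  have "frag_of (e \<oplus>\<^bsub>E\<^esub> e', x) - frag_of (e, x) - frag_of (e', x) \<in> tensor_rels R E F"
    by (rule gen_rels) (use assms in \<open>auto simp: tensor_gens_def\<close>)
  then have "frag_of (e \<oplus>\<^bsub>E\<^esub> e', x) - (frag_of (e, x) + frag_of (e', x)) \<in> tensor_rels R E F"
    by (simp add: diff_diff_eq)
  moreover have "frag_of (e, x) + frag_of (e', x) \<in> carrier free"
    using keys_add[of "frag_of (e, x)" "frag_of (e', x)"] assms by auto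
  ultimately have "tensor_rels R E F #>\<^bsub>free\<^esub> frag_of (e \<oplus>\<^bsub>E\<^esub> e', x) = tensor_rels R E F #>\<^bsub>free\<^esub> (frag_of (e, x) + frag_of (e', x))"
    using assms by (intro class_eq) auto
  then show ?thesis
    unfolding tens_def using assms by (simp add: class_add)
qed

lemma tens_add_right:
  assumes "e \<in> carrier E" "x \<in> carrier F" "x' \<in> carrier F"
  shows "tens R E F e (x \<oplus>\<^bsub>F\<^esub> x') = tens R E F e x \<otimes>\<^bsub>tensor R E F\<^esub> tens R E F e x'"
proof -
  have "frag_of (e, x \<oplus>\<^bsub>F\<^esub> x') - frag_of (e, x) - frag_of (e, x') \<in> tensor_rels R E F"
    by (rule gen_rels) (use assms in \<open>auto simp: tensor_gens_def\<close>)
  then have "frag_of (e, x \<oplus>\<^bsub>F\<^esub> x') - (frag_of (e, x) + frag_of (e, x')) \<in> tensor_rels R E F"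
    by (simp add: diff_diff_eq)
  moreover have "frag_of (e, x) + frag_of (e, x') \<in> carrier free"
    using keys_add[of "frag_of (e, x)" "frag_of (e, x')"] assms by auto
  ultimately have "tensor_rels R E F #>\<^bsub>free\<^esub> frag_of (e, x \<oplus>\<^bsub>F\<^esub> x') = tensor_rels R E F #>\<^bsub>free\<^esub> (frag_of (e, x) + frag_of (e, x'))"
    using assms by (intro class_eq) auto
  then show ?thesis
    unfolding tens_def using assms by (simp add: class_add)
qed

lemma tens_smult:
  assumes "r \<in> carrier R" "e \<in> carrier E" "x \<in> carrier F"
  shows "tens R E F (r \<odot>\<^bsub>E\<^esub> e) x = tens R E F e (r \<odot>\<^bsub>F\<^esub> x)"
proof -
  have "frag_of (r \<odot>\<^bsub>E\<^esub> e, x) - frag_of (e, r \<odot>\<^bsub>F\<^esub> x) \<in> tensor_rels R E F"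
    by (rule gen_rels) (use assms in \<open>auto simp: tensor_gens_def\<close>)
  then show ?thesis
    unfolding tens_def using assms by (intro class_eq) (auto simp: smult_closed_E F.smult_closed)
qed

lemma tensor_hom_trivial:
  assumes "group G" "h \<in> hom (tensor R E F) G"
    and "\<And>e x. \<lbrakk>e \<in> carrier E; x \<in> carrier F\<rbrakk> \<Longrightarrow> h (tens R E F e x) = \<one>\<^bsub>G\<^esub>"
    and "t \<in> carrier (tensor R E F)"
  shows "h t = \<one>\<^bsub>G\<^esub>"
proof -
  interpret T: comm_group "tensor R E F" by (rule comm_group_tensor)
  interpret G: group G by fact
  interpret h: group_hom "tensor R E F" G h
    using assms(2) by (simp add: group_hom_def group_hom_axioms_def T.is_group assms(1))
  let ?k = "\<lambda>c. tensor_rels R E F #>\<^bsub>free\<^esub> c"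
  interpret k: group_hom free "tensor R E F" ?k
    using class_hom by (simp add: group_hom_def group_hom_axioms_def T.is_group)
  obtain c where c: "c \<in> carrier free" "t = ?k c"
    using assms(4) by (auto simp: tensor_def carrier_FactGroup)
  from c(1) have "Poly_Mapping.keys c \<subseteq> carrier E \<times> carrier F" by simp
  then have "h (?k c) = \<one>\<^bsub>G\<^esub>"
  proof (induction rule: free_Abelian_group_induct[consumes 1, case_names zero diff of])
    case zero
    show ?case using k.hom_one by simp
  next
    case (diff a b)
    have "?k (a - b) = ?k a \<otimes>\<^bsub>tensor R E F\<^esub> inv\<^bsub>tensor R E F\<^esub> (?k b)"
      using diff(1,2) k.hom_mult[of a "inv\<^bsub>free\<^esub> b"] k.hom_inv[of b] by simp
    with diff show ?case using k.hom_closed by simp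
  next
    case (of a)
    then show ?case using assms(3) by (cases a) (simp add: tens_def)
  qed
  with c(2) show ?thesis by simp
qed

text \<open>Universal property of the tensor product for maps into Q/Z: \<beta> extends to the free
  abelian group, kills the relators and descends to the quotient.\<close>

lemma balanced_character:
  assumes \<beta>: "\<And>e x. \<lbrakk>e \<in> carrier E; x \<in> carrier F\<rbrakk> \<Longrightarrow> \<beta> e x \<in> carrier QmodZ"
    and "\<And>e e' x. \<lbrakk>e \<in> carrier E; e' \<in> carrier E; x \<in> carrier F\<rbrakk> \<Longrightarrow>
      \<beta> (e \<oplus>\<^bsub>E\<^esub> e') x = \<beta> e x \<otimes>\<^bsub>QmodZ\<^esub> \<beta> e' x"
    and "\<And>e x x'. \<lbrakk>e \<in> carrier E; x \<in> carrier F; x' \<in> carrier F\<rbrakk> \<Longrightarrow>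
      \<beta> e (x \<oplus>\<^bsub>F\<^esub> x') = \<beta> e x \<otimes>\<^bsub>QmodZ\<^esub> \<beta> e x'"
    and "\<And>r e x. \<lbrakk>r \<in> carrier R; e \<in> carrier E; x \<in> carrier F\<rbrakk> \<Longrightarrow>
      \<beta> (r \<odot>\<^bsub>E\<^esub> e) x = \<beta> e (r \<odot>\<^bsub>F\<^esub> x)"
  shows "\<exists>\<chi>\<in>hom (tensor R E F) QmodZ. \<forall>e\<in>carrier E. \<forall>x\<in>carrier F. \<chi> (tens R E F e x) = \<beta> e x"
proof -
  have "(\<lambda>(e, x). \<beta> e x) ` (carrier E \<times> carrier F) \<subseteq> carrier QmodZ" using \<beta> by auto
  from QmodZ.free_Abelian_group_universal[OF this]
  obtain h where h: "h \<in> hom free QmodZ"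
    "\<And>p. p \<in> carrier E \<times> carrier F \<Longrightarrow> h (frag_of p) = (\<lambda>(e, x). \<beta> e x) p" by blast
  interpret h: group_hom free QmodZ h
    using h(1) by (simp add: group_hom_def group_hom_axioms_def QmodZ.is_group)
  have hd: "h (a - b) = h a \<otimes>\<^bsub>QmodZ\<^esub> inv\<^bsub>QmodZ\<^esub> h b" if "a \<in> carrier free" "b \<in> carrier free" for a b
    using that h.hom_mult[of a "inv\<^bsub>free\<^esub> b"] h.hom_inv[of b] by simp
  note cl = diff_closed
  have "tensor_gens R E F \<subseteq> kernel free QmodZ h"
  proof
    fix c assume c: "c \<in> tensor_gens R E F"
    then have "h c = \<one>\<^bsub>QmodZ\<^esub>"
    proof (cases rule: tensor_gensE)
      case left
      then show ?thesis by (simp add: hd cl h(2) assms QmodZ_commutator del: carrier_free_Abelian_group_iff)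
    next
      case right
      then show ?thesis by (simp add: hd cl h(2) assms QmodZ_commutator del: carrier_free_Abelian_group_iff)
    next
      case smult
      then show ?thesis
        by (simp add: hd h(2) assms smult_closed_E F.smult_closed del: carrier_free_Abelian_group_iff)
    qed
    with subsetD[OF gens_closed c] show "c \<in> kernel free QmodZ h" by (simp add: kernel_def)
  qed
  then have rels: "tensor_rels R E F \<subseteq> kernel free QmodZ h"
    unfolding tensor_rels_eq
    by (rule group.generate_subgroup_incl[OF group_free_Abelian_group _ h.subgroup_kernel])
  have "h a = h b" if ab: "a \<in> carrier free" "b \<in> carrier free"
    "tensor_rels R E F #>\<^bsub>free\<^esub> a = tensor_rels R E F #>\<^bsub>free\<^esub> b" for a b
  proof -
    have "a \<in> tensor_rels R E F #>\<^bsub>free\<^esub> b"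
      using group.rcos_self[OF group_free_Abelian_group ab(1) rels_subgroup] ab(3) by simp
    then obtain c where c: "c \<in> tensor_rels R E F" "a = c \<otimes>\<^bsub>free\<^esub> b" by (auto simp: r_coset_def)
    then have "h c = \<one>\<^bsub>QmodZ\<^esub>" "c \<in> carrier free" using rels by (auto simp: kernel_def)
    then show ?thesis using c(2) h.hom_mult[of c b] ab(2) h.hom_closed by simp
  qed
  from FactGroup_universal[OF h(1) rels_normal this]
  obtain \<chi> where \<chi>: "\<chi> \<in> hom (tensor R E F) QmodZ"
    "\<And>c. c \<in> carrier free \<Longrightarrow> \<chi> (tensor_rels R E F #>\<^bsub>free\<^esub> c) = h c"
    unfolding tensor_def by blast
  have "\<chi> (tens R E F e x) = \<beta> e x" if "e \<in> carrier E" "x \<in> carrier F" for e x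
    using that \<chi>(2)[of "frag_of (e, x)"] h(2)[of "(e, x)"] by (simp add: tens_def)
  with \<chi>(1) show ?thesis by blast
qed

text \<open>With \<open>character_hom_to_dual\<close>, the two directions of the adjunction between
  Hom(E, F^+) and the characters of E \<otimes> F. Maps into a dual can thus be extended by
  extending characters.\<close>

lemma hom_to_dual_character:
  assumes \<phi>: "\<phi> \<in> mod_hom (op_ring R) E (dual F)"
  shows "\<exists>\<chi>\<in>hom (tensor R E F) QmodZ. \<forall>e\<in>carrier E. \<forall>x\<in>carrier F. \<chi> (tens R E F e x) = \<phi> e x"
  by (rule balanced_character)
    (auto simp: dual_memD(3,4)[OF mod_hom_closed[OF \<phi>]] mod_hom_add[OF \<phi>] mod_hom_smult[OF \<phi>]
      dual_simps)

lemma character_hom_to_dual: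
  assumes \<omega>: "\<omega> \<in> hom (tensor R E F) QmodZ"
  shows "(\<lambda>e. \<lambda>x\<in>carrier F. \<omega> (tens R E F e x)) \<in> mod_hom (op_ring R) E (dual F)"
proof (rule mod_homI)
  interpret D: lmodule "op_ring R" "dual F" by (rule lmodule_dual[OF F])
  let ?f = "\<lambda>e. \<lambda>x\<in>carrier F. \<omega> (tens R E F e x)"
  have cl: "?f e \<in> carrier (dual F)" if e: "e \<in> carrier E" for e
    by (rule dual_memI[OF _ _ F])
      (auto simp: e tens_add_right hom_mult[OF \<omega> tens_closed tens_closed] intro: hom_in_carrier[OF \<omega> tens_closed])
  then show "?f e \<in> carrier (dual F)" if "e \<in> carrier E" for e using that .
  show "?f (e \<oplus>\<^bsub>E\<^esub> e') = ?f e \<oplus>\<^bsub>dual F\<^esub> ?f e'" if "e \<in> carrier E" "e' \<in> carrier E" for e e'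
    by (rule dual_eqI[of _ F]) (use that in \<open>auto intro!: cl D.M.a_closed simp: dual_simps tens_add_left
        hom_mult[OF \<omega> tens_closed tens_closed]\<close>)
  show "?f (r \<odot>\<^bsub>E\<^esub> e) = r \<odot>\<^bsub>dual F\<^esub> ?f e" if "r \<in> carrier (op_ring R)" "e \<in> carrier E" for r e
    by (rule dual_eqI[of _ F]) (use that in \<open>auto intro!: cl D.smult_closed smult_closed_E
        simp: dual_simps tens_smult F.smult_closed\<close>)
qed

end

text \<open>\<open>tensor_map\<close> takes the image of a coset as a set and adds all relations of
  the target. The result is the coset of the image of any representative, because relators go to
  relators.\<close>

lemma tensor_map_class:
  assumes T: "tensor_product R E F" and T': "tensor_product R E' F'"
    and g: "g \<in> mod_hom (op_ring R) E E'" and h: "h \<in> mod_hom R F F'"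
  shows "tensor_map R E' F' g h \<in> hom (tensor R E F) (tensor R E' F')"
    and "\<lbrakk>e \<in> carrier E; x \<in> carrier F\<rbrakk> \<Longrightarrow>
      tensor_map R E' F' g h (tens R E F e x) = tens R E' F' (g e) (h x)"
proof -
  interpret T: tensor_product R E F by fact
  interpret T': tensor_product R E' F' by fact
  let ?\<phi> = "frag_extend (\<lambda>(e, x). frag_of (g e, h x))"
  let ?K = "tensor_rels R E F" and ?K' = "tensor_rels R E' F'"
  have keys: "?\<phi> c \<in> carrier T'.free" if "c \<in> carrier T.free" for c
  proof -
    have "Poly_Mapping.keys c \<subseteq> carrier E \<times> carrier F" using that by simp
    then have "Poly_Mapping.keys (?\<phi> c) \<subseteq> carrier E' \<times> carrier F'"
    proof (induction rule: free_Abelian_group_induct[consumes 1, case_names zero diff of])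
      case (diff a b)
      then show ?case using T'.diff_closed[of "?\<phi> a" "?\<phi> b"] by (simp add: frag_extend_diff)
    next
      case (of a)
      then show ?case using mod_hom_closed[OF g] mod_hom_closed[OF h] by auto
    qed simp
    then show ?thesis by simp
  qed
  have \<phi>: "?\<phi> \<in> hom T.free T'.free"
    using keys by (intro homI) (auto simp: frag_extend_add)
  interpret \<phi>: group_hom T.free T'.free ?\<phi>
    using \<phi> by (simp add: group_hom_def group_hom_axioms_def)
  have smg: "g (r \<odot>\<^bsub>E\<^esub> e) = r \<odot>\<^bsub>E'\<^esub> g e" if "r \<in> carrier R" "e \<in> carrier E" for r e
    using mod_hom_smult[OF g, of r e] that by simp
  have gens: "?\<phi> c \<in> tensor_gens R E' F'" if "c \<in> tensor_gens R E F" for c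
  proof -
    from that show ?thesis
    proof (cases rule: tensor_gensE)
      case left
      then show ?thesis
        unfolding tensor_gens_def using mod_hom_closed[OF g] mod_hom_closed[OF h]
        by (simp add: frag_extend_diff mod_hom_add[OF g]) blast
    next
      case right
      then show ?thesis
        unfolding tensor_gens_def using mod_hom_closed[OF g] mod_hom_closed[OF h]
        by (simp add: frag_extend_diff mod_hom_add[OF h]) blast
    next
      case smult
      then show ?thesis
        unfolding tensor_gens_def using mod_hom_closed[OF g] mod_hom_closed[OF h]
        by (simp add: frag_extend_diff smg mod_hom_smult[OF h]) blast
    qed
  qed
  have rels: "?\<phi> c \<in> ?K'" if "c \<in> ?K" for c
    using that unfolding tensor_rels_eq
  proof (induction rule: generate.induct)
    case one
    then show ?case
      using generate.one[of T'.free "tensor_gens R E' F'"] by (simp only: \<phi>.hom_one)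
  next
    case (incl c)
    then show ?case by (intro generate.incl gens)
  next
    case (inv c)
    moreover have "c \<in> carrier T.free" using subsetD[OF T.gens_closed inv] .
    ultimately show ?case
      using generate.inv[OF gens, of c T'.free] by (simp only: \<phi>.hom_inv)
  next
    case (eng c c')
    moreover have "generate T.free (tensor_gens R E F) \<subseteq> carrier T.free"
      by (rule group.generate_incl[OF group_free_Abelian_group T.gens_closed])
    ultimately have "c \<in> carrier T.free" "c' \<in> carrier T.free" by blast+
    with generate.eng[OF eng(3,4)] show ?case by (simp only: \<phi>.hom_mult)
  qed
  have map: "tensor_map R E' F' g h (?K #>\<^bsub>T.free\<^esub> c) = ?K' #>\<^bsub>T'.free\<^esub> ?\<phi> c"
    if c: "c \<in> carrier T.free" for c
    unfolding tensor_map_def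
  proof (intro equalityI subsetI)
    fix y assume "y \<in> ?K' <#>\<^bsub>T'.free\<^esub> (?\<phi> ` (?K #>\<^bsub>T.free\<^esub> c))"
    then obtain k k' where k: "k \<in> ?K'" "k' \<in> ?K" "y = k + ?\<phi> (k' + c)"
      by (auto simp: set_mult_def r_coset_def)
    then have "y = (k + ?\<phi> k') + ?\<phi> c" by (simp add: frag_extend_add add.assoc)
    moreover have "k + ?\<phi> k' \<in> ?K'"
      using subgroup.m_closed[OF T'.rels_subgroup k(1) rels[OF k(2)]] by simp
    ultimately show "y \<in> ?K' #>\<^bsub>T'.free\<^esub> ?\<phi> c" by (auto simp: r_coset_def)
  next
    fix y assume "y \<in> ?K' #>\<^bsub>T'.free\<^esub> ?\<phi> c"
    then obtain k where k: "k \<in> ?K'" "y = k + ?\<phi> c" by (auto simp: r_coset_def)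
    have "c \<in> ?K #>\<^bsub>T.free\<^esub> c"
      by (rule group.rcos_self[OF group_free_Abelian_group c T.rels_subgroup])
    with k show "y \<in> ?K' <#>\<^bsub>T'.free\<^esub> (?\<phi> ` (?K #>\<^bsub>T.free\<^esub> c))"
      by (auto simp: set_mult_def)
  qed
  show "tensor_map R E' F' g h (tens R E F e x) = tens R E' F' (g e) (h x)"
    if "e \<in> carrier E" "x \<in> carrier F" for e x
    using that map[of "frag_of (e, x)"] by (simp add: tens_def)
  show "tensor_map R E' F' g h \<in> hom (tensor R E F) (tensor R E' F')"
  proof (rule homI)
    fix s assume "s \<in> carrier (tensor R E F)"
    then obtain a where a: "a \<in> carrier T.free" "s = ?K #>\<^bsub>T.free\<^esub> a"
      by (auto simp: tensor_def carrier_FactGroup)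
    then show "tensor_map R E' F' g h s \<in> carrier (tensor R E' F')"
      using map[OF a(1)] hom_in_carrier[OF T'.class_hom keys[OF a(1)]] by simp
    fix t assume "t \<in> carrier (tensor R E F)"
    then obtain b where b: "b \<in> carrier T.free" "t = ?K #>\<^bsub>T.free\<^esub> b"
      by (auto simp: tensor_def carrier_FactGroup)
    have ab: "a + b \<in> carrier T.free" using a(1) b(1) keys_add[of a b] by auto
    have "s \<otimes>\<^bsub>tensor R E F\<^esub> t = ?K #>\<^bsub>T.free\<^esub> (a + b)"
      using T.class_add[OF a(1) b(1)] a b by simp
    then show "tensor_map R E' F' g h (s \<otimes>\<^bsub>tensor R E F\<^esub> t)
        = tensor_map R E' F' g h s \<otimes>\<^bsub>tensor R E' F'\<^esub> tensor_map R E' F' g h t"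
      using map[OF ab] map[OF a(1)] map[OF b(1)] a(2) b(2) T'.class_add[OF keys[OF a(1)] keys[OF b(1)]]
      by (simp add: frag_extend_add)
  qed
qed

text \<open>In contrast to the one-sided transports, the maps stay under control: g' corresponds to
  g under \<beta> and \<gamma>, so lifts found along g can be used for g'.\<close>

lemma short_exact_iso:
  assumes B: "lmodule R B" "lmodule R B'" and C: "lmodule R C" "lmodule R C'"
    and A: "lmodule R A" "lmodule R A'" "mod_iso R A' A" and s: "short_exact R A f B g C"
    and \<beta>: "\<beta> \<in> mod_hom R B B'" "bij_betw \<beta> (carrier B) (carrier B')"
    and \<gamma>: "\<gamma> \<in> mod_hom R C C'" "bij_betw \<gamma> (carrier C) (carrier C')"
  shows "\<exists>f' g'. short_exact R A' f' B' g' C' \<and> (\<forall>y\<in>carrier B. g' (\<beta> y) = \<gamma> (g y))"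
proof -
  obtain f1 where s1: "short_exact R A' f1 B g C"
    using short_exact_iso_left[OF A s] by blast
  note sD = short_exactD[OF s1]
  interpret C: lmodule R C by fact
  interpret C': lmodule R C' by fact
  have im: "\<beta> ` carrier B = carrier B'" "\<gamma> ` carrier C = carrier C'"
    and inj: "inj_on \<beta> (carrier B)" "inj_on \<gamma> (carrier C)"
    using \<beta>(2) \<gamma>(2) by (auto simp: bij_betw_def)
  have "\<exists>\<psi>\<in>mod_hom R B' B. \<forall>x\<in>carrier B'. \<beta> (\<psi> x) = x"
    by (rule factor_mono[OF B(2,1) \<beta>(1) inj(1) mod_hom_id]) (use im in auto)
  then obtain \<psi> where \<psi>: "\<psi> \<in> mod_hom R B' B" "\<And>x. x \<in> carrier B' \<Longrightarrow> \<beta> (\<psi> x) = x"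
    by blast
  have \<psi>\<beta>: "\<psi> (\<beta> x) = x" if "x \<in> carrier B" for x
    using inj_onD[OF inj(1) \<psi>(2)] mod_hom_closed[OF \<beta>(1) that] mod_hom_closed[OF \<psi>(1)] that by blast
  have \<gamma>0: "\<gamma> \<zero>\<^bsub>C\<^esub> = \<zero>\<^bsub>C'\<^esub>"
    by (rule mod_hom_zero[OF C.M.abelian_group_axioms C'.M.abelian_group_axioms \<gamma>(1)])
  have "short_exact R A' (\<lambda>x. \<beta> (f1 x)) B' (\<lambda>x. \<gamma> (g (\<psi> x))) C'"
  proof (rule short_exactI[OF mod_hom_comp[OF sD(1) \<beta>(1)] mod_hom_comp[OF mod_hom_comp[OF \<psi>(1) sD(2)] \<gamma>(1)]])
    show "inj_on (\<lambda>x. \<beta> (f1 x)) (carrier A')"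
      by (rule inj_onI) (metis \<psi>\<beta> sD(1,3) mod_hom_closed inj_onD)
    show "\<gamma> (g (\<psi> (\<beta> (f1 x)))) = \<zero>\<^bsub>C'\<^esub>" if "x \<in> carrier A'" for x
      using that sD(4) mod_hom_closed[OF sD(1)] by (simp add: \<psi>\<beta> \<gamma>0)
    show "\<exists>x\<in>carrier A'. y = \<beta> (f1 x)" if y: "y \<in> carrier B'" "\<gamma> (g (\<psi> y)) = \<zero>\<^bsub>C'\<^esub>" for y
    proof -
      note \<psi>y = mod_hom_closed[OF \<psi>(1) y(1)]
      have "g (\<psi> y) = \<zero>\<^bsub>C\<^esub>"
        by (rule inj_onD[OF inj(2)]) (simp_all add: y \<gamma>0 mod_hom_closed[OF sD(2) \<psi>y])
      then obtain x where "x \<in> carrier A'" "\<psi> y = f1 x" using sD(5)[OF \<psi>y] by blast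
      with \<psi>(2)[OF y(1)] show ?thesis by (intro bexI[of _ x]) simp
    qed
    show "\<exists>y\<in>carrier B'. z = \<gamma> (g (\<psi> y))" if z: "z \<in> carrier C'" for z
    proof -
      obtain c where c: "c \<in> carrier C" "z = \<gamma> c" using z im(2) by blast
      obtain b where b: "b \<in> carrier B" "c = g b" using sD(6)[OF c(1)] by blast
      show ?thesis
        using b c \<psi>\<beta>[OF b(1)] mod_hom_closed[OF \<beta>(1) b(1)] by (intro bexI[of _ "\<beta> b"]) simp_all
    qed
  qed
  then show ?thesis using \<psi>\<beta> by (intro exI conjI) auto
qed


lemma mod_iso_trans:
  assumes "mod_iso R A B" "mod_iso R B C"
  shows "mod_iso R A C"
proof -
  obtain f where f: "f \<in> mod_hom R A B" "bij_betw f (carrier A) (carrier B)"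
    using assms(1) by (auto simp: mod_iso_def)
  obtain g where g: "g \<in> mod_hom R B C" "bij_betw g (carrier B) (carrier C)"
    using assms(2) by (auto simp: mod_iso_def)
  from bij_betw_trans[OF f(2) g(2)] mod_hom_comp[OF f(1) g(1)] show ?thesis
    by (auto simp: mod_iso_def comp_def)
qed

lemma mod_iso_dual:
  assumes A: "lmodule R A" and B: "lmodule R B" and iso: "mod_iso R A B"
  shows "mod_iso (op_ring R) (dual B) (dual A)"
proof -
  obtain f where f: "f \<in> mod_hom R A B" "bij_betw f (carrier A) (carrier B)"
    using iso by (auto simp: mod_iso_def)
  then have im: "f ` carrier A = carrier B" and inj: "inj_on f (carrier A)"
    by (auto simp: bij_betw_def)
  have "\<exists>g\<in>mod_hom R B A. \<forall>x\<in>carrier B. f (g x) = x"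
    by (rule factor_mono[OF B A f(1) inj mod_hom_id]) (use im in auto)
  then obtain g where g: "g \<in> mod_hom R B A" "\<And>x. x \<in> carrier B \<Longrightarrow> f (g x) = x" by blast
  have gf: "g (f x) = x" if x: "x \<in> carrier A" for x
    using inj_onD[OF inj g(2)] mod_hom_closed[OF f(1) x] mod_hom_closed[OF g(1)] x by blast
  note f' = dual_map_hom[OF A B f(1)] and g' = dual_map_hom[OF B A g(1)]
  have "bij_betw (dual_map A f) (carrier (dual B)) (carrier (dual A))"
  proof (rule bij_betwI[where g = "dual_map B g"])
    show "dual_map A f \<in> carrier (dual B) \<rightarrow> carrier (dual A)" using mod_hom_closed[OF f'] by blast
    show "dual_map B g \<in> carrier (dual A) \<rightarrow> carrier (dual B)" using mod_hom_closed[OF g'] by blast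
    show "dual_map B g (dual_map A f \<phi>) = \<phi>" if \<phi>: "\<phi> \<in> carrier (dual B)" for \<phi>
      by (rule dual_eqI[OF mod_hom_closed[OF g' mod_hom_closed[OF f' \<phi>]] \<phi>])
        (simp add: dual_map_def g mod_hom_closed[OF g(1)])
    show "dual_map A f (dual_map B g \<phi>) = \<phi>" if \<phi>: "\<phi> \<in> carrier (dual A)" for \<phi>
      by (rule dual_eqI[OF mod_hom_closed[OF f' mod_hom_closed[OF g' \<phi>]] \<phi>])
        (simp add: dual_map_def gf mod_hom_closed[OF f(1)])
  qed
  with f' show ?thesis by (auto simp: mod_iso_def)
qed


section \<open>Duality between left and right modules\<close>

text \<open>Unqualified names such as \<open>mods\<close>, \<open>injs\<close> and
  \<open>gis\<close> refer to right modules, that is to \<open>op_ring R\<close>; left modules carry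
  the prefix \<open>left\<close>.\<close>

locale small_bimodules =
  fixes R :: "('r, 'x) ring_scheme" and U :: "'u itself"
  assumes universe: "universe_type TYPE('u)"
    and ring: "ring R"
    and small_ring: "carrier R \<prec> (UNIV :: 'u set)"
begin

sublocale left: small_modules R U
  by (intro small_modules.intro universe ring small_ring)

sublocale small_modules "op_ring R" U
  by (intro small_modules.intro universe ring_op_ring ring) (simp add: small_ring)

text \<open>The dual itself has functions as elements; M is a copy of it in \<open>'u\<close>, so
  that it can belong to \<open>mods\<close>.\<close>

abbreviation is_dual where "is_dual M A \<equiv> M \<in> mods \<and> mod_iso (op_ring R) (dual A) M"

lemma ex_dual:
  assumes "lmodule R A" "carrier A \<prec> (UNIV :: 'u set)"
  obtains M where "is_dual M A"
  using ex_copy[OF lmodule_dual[OF assms(1)] small_dual[OF universe assms(2)]] by blast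

lemma ex_dual_mods:
  assumes "A \<in> left.mods"
  obtains M where "is_dual M A"
proof -
  have "lmodule R A" "carrier A \<prec> (UNIV :: 'u set)" using assms by (auto simp: Mods_def)
  from ex_dual[OF this that] show thesis .
qed

lemma dual_ses:
  assumes A: "lmodule R A" and B: "lmodule R B" and C: "lmodule R C" and s: "short_exact R A f B g C"
    and MC: "is_dual MC C" and MB: "is_dual MB B" and MA: "is_dual MA A"
  shows "\<exists>u v. ses MC u MB v MA"
proof -
  note D = lmodule_dual[OF A] lmodule_dual[OF B] lmodule_dual[OF C]
  obtain u where "short_exact (op_ring R) MC u (dual B) (dual_map A f) (dual A)"
    using short_exact_iso_left[OF D(3) mods_lmodule _ dual_short_exact[OF A B C s]]
      mod_iso_sym[OF D(3)] MC by blast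
  then obtain v where "short_exact (op_ring R) MC u (dual B) v MA"
    using short_exact_iso_right[OF D(1) mods_lmodule] MA by blast
  then show ?thesis
    using short_exact_iso_mid[OF D(2) mods_lmodule] MB by blast
qed

text \<open>One half of Lambek's criterion. A map A -> F^+ is a character of A \<otimes> F; flatness
  embeds this group into B \<otimes> F, where the character extends, and the extension is a map B ->
  F^+.\<close>

lemma flat_dual_injective:
  assumes F: "F \<in> (Flat_mods R :: ('r, 'u) module set)" and M: "is_dual M F"
  shows "M \<in> injs"
  unfolding Inj_mods_def
proof (intro CollectI conjI ballI impI)
  show Mm: "M \<in> mods" using M by simp
  have Fm: "F \<in> left.mods" using F by (simp add: Flat_mods_def)
  have Fl: "lmodule R F" by (rule left.mods_lmodule[OF Fm])
  have D: "lmodule (op_ring R) (dual F)" by (rule lmodule_dual[OF Fl])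
  obtain \<theta> where \<theta>: "\<theta> \<in> mod_hom (op_ring R) (dual F) M" "bij_betw \<theta> (carrier (dual F)) (carrier M)"
    using M by (auto simp: mod_iso_def)
  fix A B i f assume A: "A \<in> mods" and B: "B \<in> mods" and i: "i \<in> mod_hom (op_ring R) A B"
    and f: "f \<in> mod_hom (op_ring R) A M" and inj: "inj_on i (carrier A)"
  interpret TA: tensor_product R A F by (intro tensor_product.intro mods_lmodule A Fl)
  interpret TB: tensor_product R B F by (intro tensor_product.intro mods_lmodule B Fl)
  have "\<exists>\<phi>\<in>mod_hom (op_ring R) A (dual F). \<forall>x\<in>carrier A. \<theta> (\<phi> x) = f x"
    by (rule factor_mono[OF mods_lmodule[OF A] D \<theta>(1) _ f])
      (use \<theta>(2) mod_hom_closed[OF f] in \<open>auto simp: bij_betw_def\<close>)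
  then obtain \<phi> where \<phi>: "\<phi> \<in> mod_hom (op_ring R) A (dual F)" "\<And>x. x \<in> carrier A \<Longrightarrow> \<theta> (\<phi> x) = f x"
    by blast
  obtain \<chi> where \<chi>: "\<chi> \<in> hom (tensor R A F) QmodZ"
    "\<And>a x. \<lbrakk>a \<in> carrier A; x \<in> carrier F\<rbrakk> \<Longrightarrow> \<chi> (tens R A F a x) = \<phi> a x"
    using TA.hom_to_dual_character[OF \<phi>(1)] by blast
  let ?t = "tensor_map R B F i id"
  have id: "id \<in> mod_hom R F F" by (auto simp: mod_hom_def)
  note t = tensor_map_class[OF TA.tensor_product_axioms TB.tensor_product_axioms i id]
  have tinj: "inj_on ?t (carrier (tensor R A F))"
    using F A B i inj unfolding Flat_mods_def by blast
  interpret GA: comm_group "tensor R A F" by (rule TA.comm_group_tensor)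
  interpret GB: comm_group "tensor R B F" by (rule TB.comm_group_tensor)
  have "\<exists>\<omega>\<in>hom (tensor R B F) QmodZ. \<forall>x\<in>carrier (tensor R A F). \<omega> (?t x) = \<chi> x"
  proof (rule GB.character_factor[OF GA.is_group t(1) \<chi>(1)])
    fix x assume x: "x \<in> carrier (tensor R A F)" "?t x = \<one>\<^bsub>tensor R B F\<^esub>"
    then have "x = \<one>\<^bsub>tensor R A F\<^esub>"
      using inj_onD[OF tinj, of x "\<one>\<^bsub>tensor R A F\<^esub>"] hom_one[OF t(1) GA.is_group GB.is_group] by simp
    then show "\<chi> x = \<one>\<^bsub>QmodZ\<^esub>" using hom_one[OF \<chi>(1) GA.is_group QmodZ.is_group] by simp
  qed
  then obtain \<omega> where \<omega>: "\<omega> \<in> hom (tensor R B F) QmodZ"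
    "\<And>x. x \<in> carrier (tensor R A F) \<Longrightarrow> \<omega> (?t x) = \<chi> x" by blast
  let ?g = "\<lambda>b. \<lambda>x\<in>carrier F. \<omega> (tens R B F b x)"
  have g: "?g \<in> mod_hom (op_ring R) B (dual F)" by (rule TB.character_hom_to_dual[OF \<omega>(1)])
  have "?g (i a) = \<phi> a" if a: "a \<in> carrier A" for a
  proof (rule dual_eqI[OF mod_hom_closed[OF g mod_hom_closed[OF i a]] mod_hom_closed[OF \<phi>(1) a]])
    fix x assume x: "x \<in> carrier F"
    have "?g (i a) x = \<omega> (?t (tens R A F a x))" using t(2)[OF a x] x by simp
    also have "\<dots> = \<phi> a x" using \<omega>(2)[OF TA.tens_closed[OF a x]] \<chi>(2)[OF a x] by simp
    finally show "?g (i a) x = \<phi> a x" .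
  qed
  then have "\<forall>a\<in>carrier A. \<theta> (?g (i a)) = f a" using \<phi>(2) by simp
  then show "\<exists>g\<in>mod_hom (op_ring R) B M. \<forall>x\<in>carrier A. g (i x) = f x"
    by (intro bexI[OF _ mod_hom_comp[OF g \<theta>(1)]])
qed

section \<open>Duals of Gorenstein flat modules\<close>

definition gf_complex :: "(int \<Rightarrow> ('r, 'u) module) \<Rightarrow> (int \<Rightarrow> 'u \<Rightarrow> 'u) \<Rightarrow> bool" where
  "gf_complex F d \<longleftrightarrow> (\<forall>i. F i \<in> (Flat_mods R :: ('r, 'u) module set)) \<and> exact_complex R F d \<and>
       (\<forall>E\<in>injs. \<forall>i. group_exact_at
            (tensor R E (F (i + 1))) (tensor_map R E (F i) id (d (i + 1)))
            (tensor R E (F i)) (tensor_map R E (F (i - 1)) id (d i))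
            (tensor R E (F (i - 1))))"

text \<open>Exactness of \<open>E \<otimes> F\<close> at \<open>F (j + 1)\<close> says that \<open>E \<otimes> Z\<^sub>j \<rightarrow> E \<otimes> F j\<close> is injective;
  so characters of \<open>E \<otimes> Z\<^sub>j\<close> extend to \<open>E \<otimes> F j\<close>.\<close>

lemma gf_complex_lift:
  assumes c: "gf_complex F d" and E: "E \<in> injs"
    and \<phi>: "\<phi> \<in> mod_hom (op_ring R) E (dual (cycle_module F d j))"
  shows "\<exists>\<psi>\<in>mod_hom (op_ring R) E (dual (F j)). \<forall>e\<in>carrier E.
    dual_map (cycle_module F d j) (\<lambda>x. x) (\<psi> e) = \<phi> e"
proof -
  let ?Z = "cycle_module F d j"
  have Fm: "F i \<in> left.mods" for i using c by (simp add: gf_complex_def Flat_mods_def)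
  have Fl: "lmodule R (F i)" for i by (rule left.mods_lmodule[OF Fm])
  have El: "lmodule (op_ring R) E" by (intro mods_lmodule injs_mods E)
  interpret T: tensor_product R E "F i" for i by (intro tensor_product.intro El Fl)
  interpret G: comm_group "tensor R E (F i)" for i by (rule T.comm_group_tensor)
  have ex: "exact_complex R F d" using c by (simp add: gf_complex_def)
  have d: "d i \<in> mod_hom R (F i) (F (i - 1))" for i
    using ex by (auto simp: exact_complex_def exact_at_def)
  have d1: "d (i + 1) \<in> mod_hom R (F (i + 1)) (F i)" for i using d[of "i + 1"] by simp
  have Zl: "lmodule R ?Z" unfolding cycle_module_def by (rule lmodule_kernel[OF Fl Fl d])
  interpret Z: lmodule R ?Z by (rule Zl)
  note sZ = short_exactD[OF left.cycle_ses[OF ex Fl, of j]]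
  have id: "id \<in> mod_hom (op_ring R) E E" by (auto simp: mod_hom_def)
  note t = tensor_map_class[OF T.tensor_product_axioms T.tensor_product_axioms id d1]
  let ?t = "\<lambda>i. tensor_map R E (F i) id (d (i + 1))"
  \<comment> \<open>\<phi> is pulled back along d to maps into the dual of \<open>F (j + 1)\<close>,
    that is, to a character \<chi> of E \<otimes> F (j + 1). It remains to factor \<chi> through E
    \<otimes> F j.\<close>
  have "(\<lambda>e. dual_map (F (j + 1)) (d (j + 1)) (\<phi> e)) \<in> mod_hom (op_ring R) E (dual (F (j + 1)))"
    by (rule mod_hom_comp[OF \<phi> dual_map_hom[OF Fl Zl sZ(2)]])
  from T.hom_to_dual_character[OF this]
  obtain \<chi> where \<chi>: "\<chi> \<in> hom (tensor R E (F (j + 1))) QmodZ"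
    "\<And>e x. \<lbrakk>e \<in> carrier E; x \<in> carrier (F (j + 1))\<rbrakk> \<Longrightarrow> \<chi> (tens R E (F (j + 1)) e x) = \<phi> e (d (j + 1) x)"
    by (auto simp: dual_map_def)
  have "\<exists>\<omega>\<in>hom (tensor R E (F j)) QmodZ. \<forall>x\<in>carrier (tensor R E (F (j + 1))). \<omega> (?t j x) = \<chi> x"
  proof (rule G.character_factor[OF G.is_group t(1) \<chi>(1)])
    fix x assume x: "x \<in> carrier (tensor R E (F (j + 1)))" "?t j x = \<one>\<^bsub>tensor R E (F j)\<^esub>"
    have "group_exact_at
            (tensor R E (F (j + 1 + 1))) (tensor_map R E (F (j + 1)) id (d (j + 1 + 1)))
            (tensor R E (F (j + 1))) (tensor_map R E (F (j + 1 - 1)) id (d (j + 1)))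
            (tensor R E (F (j + 1 - 1)))"
      using c E unfolding gf_complex_def by blast
    then have "?t (j + 1) ` carrier (tensor R E (F (j + 1 + 1)))
        = kernel (tensor R E (F (j + 1))) (tensor R E (F j)) (?t j)"
      by (simp add: group_exact_at_def)
    with x have "x \<in> ?t (j + 1) ` carrier (tensor R E (F (j + 1 + 1)))" by (simp add: kernel_def)
    then obtain y where y: "y \<in> carrier (tensor R E (F (j + 1 + 1)))" "x = ?t (j + 1) y" by blast
    \<comment> \<open>By exactness x comes from E \<otimes> F (j + 2), and there \<chi> vanishes on
      elementary tensors since consecutive differentials compose to zero.\<close>
    have "(\<chi> \<circ> ?t (j + 1)) y = \<one>\<^bsub>QmodZ\<^esub>"
    proof (rule T.tensor_hom_trivial[OF QmodZ.is_group hom_compose[OF t(1) \<chi>(1)] _ y(1)])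
      fix e z assume e: "e \<in> carrier E" and z: "z \<in> carrier (F (j + 1 + 1))"
      have dz: "d (j + 1 + 1) z \<in> carrier (F (j + 1))" by (rule mod_hom_closed[OF d1 z])
      have "d (j + 1 + 1) z \<in> a_kernel (F (j + 1)) (F (j + 1 - 1)) (d (j + 1))"
        using ex z unfolding exact_complex_def exact_at_def by blast
      then have "d (j + 1) (d (j + 1 + 1) z) = \<zero>\<^bsub>?Z\<^esub>"
        by (simp add: a_kernel_iff cycle_module_def)
      then have "\<phi> e (d (j + 1) (d (j + 1 + 1) z)) = \<one>\<^bsub>QmodZ\<^esub>"
        using hom_one[OF dual_memD(1)[OF mod_hom_closed[OF \<phi> e]] Z.M.a_group QmodZ.is_group] by simp
      then show "(\<chi> \<circ> ?t (j + 1)) (tens R E (F (j + 1 + 1)) e z) = \<one>\<^bsub>QmodZ\<^esub>"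
        using t(2)[OF e z] \<chi>(2)[OF e dz] by simp
    qed
    with y(2) show "\<chi> x = \<one>\<^bsub>QmodZ\<^esub>" by simp
  qed
  then obtain \<omega> where \<omega>: "\<omega> \<in> hom (tensor R E (F j)) QmodZ"
    "\<And>x. x \<in> carrier (tensor R E (F (j + 1))) \<Longrightarrow> \<omega> (?t j x) = \<chi> x" by blast
  let ?\<psi> = "\<lambda>e. \<lambda>x\<in>carrier (F j). \<omega> (tens R E (F j) e x)"
  have \<psi>: "?\<psi> \<in> mod_hom (op_ring R) E (dual (F j))" by (rule T.character_hom_to_dual[OF \<omega>(1)])
  have "dual_map ?Z (\<lambda>x. x) (?\<psi> e) = \<phi> e" if e: "e \<in> carrier E" for e
  proof (rule dual_eqI[OF mod_hom_closed[OF dual_map_hom[OF Zl Fl] mod_hom_closed[OF \<psi> e]]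
        mod_hom_closed[OF \<phi> e]])
    show "(\<lambda>x. x) \<in> mod_hom R ?Z (F j)"
      by (auto simp: mod_hom_def cycle_module_def a_kernel_iff)
    fix z assume z: "z \<in> carrier ?Z"
    then have zF: "z \<in> carrier (F j)" by (simp add: cycle_module_def a_kernel_iff)
    obtain y where y: "y \<in> carrier (F (j + 1))" "z = d (j + 1) y" using sZ(6)[OF z] by blast
    have "dual_map ?Z (\<lambda>x. x) (?\<psi> e) z = \<omega> (?t j (tens R E (F (j + 1)) e y))"
      using z zF y(2) t(2)[OF e y(1)] by (simp add: dual_map_def)
    also have "\<dots> = \<phi> e z" using \<omega>(2)[OF T.tens_closed[OF e y(1)]] \<chi>(2)[OF e y(1)] y(2) by simp
    finally show "dual_map ?Z (\<lambda>x. x) (?\<psi> e) z = \<phi> e z" .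
  qed
  with \<psi> show ?thesis by (intro bexI[of _ ?\<psi>]) auto
qed

text \<open>Coinduction for the duals of all cycle modules of such complexes. Duality reverses the
  sequences: for degree i, the kernel comes from the cycles of degree i - 1 and the cokernel from
  those of degree i + 1. Acyclicity is \<open>gf_complex_lift\<close> in degree i + 1.\<close>

lemma gflat_dual_gi:
  assumes A: "A \<in> (GFlat_mods R :: ('r, 'u) module set)" and N: "is_dual N A"
  shows "N \<in> gis"
proof -
  let ?G = "{N\<in>mods. \<exists>F d i. gf_complex F d \<and> is_dual N (cycle_module F d i)}"
  have "gi_coclosed ?G"
    unfolding gi_coclosed_def
  proof (intro conjI ballI)
    fix N assume "N \<in> ?G"
    then obtain F d i where c: "gf_complex F d" and N: "is_dual N (cycle_module F d i)" by blast
    have Ff: "F i \<in> (Flat_mods R :: ('r, 'u) module set)" for i using c by (simp add: gf_complex_def)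
    have Fm: "F i \<in> left.mods" for i using Ff by (simp add: Flat_mods_def)
    have Fl: "lmodule R (F i)" for i by (rule left.mods_lmodule[OF Fm])
    have ex: "exact_complex R F d" using c by (simp add: gf_complex_def)
    have d: "d i \<in> mod_hom R (F i) (F (i - 1))" for i
      using ex by (auto simp: exact_complex_def exact_at_def)
    have Zm: "cycle_module F d i \<in> left.mods" for i
      unfolding cycle_module_def by (rule left.kernel_mods[OF Fm Fm d])
    have Zl: "lmodule R (cycle_module F d i)" for i by (rule left.mods_lmodule[OF Zm])
    note s = left.cycle_ses[OF ex Fl]
    obtain J0 where J0: "is_dual J0 (F i)" by (rule ex_dual_mods[OF Fm])
    obtain J1 where J1: "is_dual J1 (F (i + 1))" by (rule ex_dual_mods[OF Fm])
    obtain K where K: "is_dual K (cycle_module F d (i - 1))" by (rule ex_dual_mods[OF Zm])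
    obtain L where L: "is_dual L (cycle_module F d (i + 1))" by (rule ex_dual_mods[OF Zm])
    have J: "J0 \<in> injs" "J1 \<in> injs" using flat_dual_injective Ff J0 J1 by blast+
    have G: "K \<in> ?G" "L \<in> ?G" using c K L by blast+
    obtain u v where "ses K u J0 v N"
      using dual_ses[OF Zl Fl Zl s[of "i - 1"]] K J0 N by fastforce
    with J G show "\<exists>I\<in>injs. \<exists>K\<in>?G. \<exists>f g. ses K f I g N" by blast
    obtain \<beta> where \<beta>: "\<beta> \<in> mod_hom (op_ring R) (dual (F (i + 1))) J1"
      "bij_betw \<beta> (carrier (dual (F (i + 1)))) (carrier J1)" using J1 by (auto simp: mod_iso_def)
    obtain \<gamma> where \<gamma>: "\<gamma> \<in> mod_hom (op_ring R) (dual (cycle_module F d (i + 1))) L"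
      "bij_betw \<gamma> (carrier (dual (cycle_module F d (i + 1)))) (carrier L)" using L by (auto simp: mod_iso_def)
    have NDm: "N \<in> mods" "J1 \<in> mods" "L \<in> mods" using N J1 L by auto
    have iso: "mod_iso (op_ring R) N (dual (cycle_module F d i))"
      using mod_iso_sym[OF lmodule_dual[OF Zl]] N by blast
    \<comment> \<open>The lift will be found between the duals themselves, whereas acyclicity
      concerns the copies J1 and L; the compatibility of g' with the restriction of characters
      connects the two.\<close>
    obtain f' g' where s': "ses N f' J1 g' L" and g': "\<And>y. y \<in> carrier (dual (F (i + 1))) \<Longrightarrow>
        g' (\<beta> y) = \<gamma> (dual_map (cycle_module F d (i + 1)) (\<lambda>x. x) y)"
      using short_exact_iso[OF lmodule_dual[OF Fl] mods_lmodule[OF NDm(2)] lmodule_dual[OF Zl]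
          mods_lmodule[OF NDm(3)] lmodule_dual[OF Zl] mods_lmodule[OF NDm(1)] iso
          dual_short_exact[OF Zl Fl Zl s] \<beta> \<gamma>] by blast
    show "\<exists>J\<in>injs. \<exists>M'\<in>?G. \<exists>f g. ses N f J g M'" using s' J G by blast
    show "inj_acyclic N"
    proof (rule inj_acyclic_from_injective[OF NDm(1) J(2) NDm(3) s'])
      fix E \<phi> assume E: "E \<in> injs" and \<phi>: "\<phi> \<in> mod_hom (op_ring R) E L"
      have El: "lmodule (op_ring R) E" by (intro mods_lmodule injs_mods E)
      have "\<exists>\<phi>'\<in>mod_hom (op_ring R) E (dual (cycle_module F d (i + 1))). \<forall>e\<in>carrier E. \<gamma> (\<phi>' e) = \<phi> e"
        by (rule factor_mono[OF El lmodule_dual[OF Zl] \<gamma>(1) _ \<phi>])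
          (use \<gamma>(2) mod_hom_closed[OF \<phi>] in \<open>auto simp: bij_betw_def\<close>)
      then obtain \<phi>' where \<phi>': "\<phi>' \<in> mod_hom (op_ring R) E (dual (cycle_module F d (i + 1)))"
        "\<And>e. e \<in> carrier E \<Longrightarrow> \<gamma> (\<phi>' e) = \<phi> e" by blast
      obtain \<psi> where \<psi>: "\<psi> \<in> mod_hom (op_ring R) E (dual (F (i + 1)))"
        "\<And>e. e \<in> carrier E \<Longrightarrow> dual_map (cycle_module F d (i + 1)) (\<lambda>x. x) (\<psi> e) = \<phi>' e"
        using gf_complex_lift[OF c E \<phi>'(1)] by blast
      have "\<forall>e\<in>carrier E. g' (\<beta> (\<psi> e)) = \<phi> e"
        using g' mod_hom_closed[OF \<psi>(1)] \<psi>(2) \<phi>'(2) by simp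
      then show "\<exists>\<psi>\<in>mod_hom (op_ring R) E J1. \<forall>x\<in>carrier E. g' (\<psi> x) = \<phi> x"
        by (intro bexI[OF _ mod_hom_comp[OF \<psi>(1) \<beta>(1)]])
    qed
  qed blast
  moreover have "N \<in> ?G"
  proof -
    obtain F d where c: "gf_complex F d" and iso: "mod_iso R A (cycle_module F d 0)"
      using A by (auto simp: GFlat_mods_def gf_complex_def)
    have Fm: "F i \<in> left.mods" for i using c by (simp add: gf_complex_def Flat_mods_def)
    have d: "d i \<in> mod_hom R (F i) (F (i - 1))" for i
      using c by (auto simp: gf_complex_def exact_complex_def exact_at_def)
    have Zl: "lmodule R (cycle_module F d 0)"
      unfolding cycle_module_def by (intro lmodule_kernel left.mods_lmodule Fm d)
    have Am: "A \<in> left.mods" using A by (simp add: GFlat_mods_def)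
    have Al: "lmodule R A" by (rule left.mods_lmodule[OF Am])
    have "mod_iso (op_ring R) (dual A) N" using N by blast
    from mod_iso_trans[OF mod_iso_dual[OF Al Zl iso] this]
    have "mod_iso (op_ring R) (dual (cycle_module F d 0)) N" .
    with N c show ?thesis by blast
  qed
  ultimately show ?thesis using gi_coinduct by blast
qed

section \<open>Duals of flat resolutions\<close>

lemma is_dual_zero:
  assumes "is_dual M Z" "carrier Z = {\<zero>\<^bsub>Z\<^esub>}" "lmodule R Z"
  shows "M \<in> zeros"
proof -
  interpret D: lmodule "op_ring R" "dual Z" by (rule lmodule_dual[OF assms(3)])
  interpret Z: lmodule R Z by fact
  have "\<phi> = \<zero>\<^bsub>dual Z\<^esub>" if \<phi>: "\<phi> \<in> carrier (dual Z)" for \<phi>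
  proof (rule dual_eqI[OF \<phi> D.M.zero_closed])
    fix x assume "x \<in> carrier Z"
    then show "\<phi> x = \<zero>\<^bsub>dual Z\<^esub> x"
      using assms(2) hom_one[OF dual_memD(1)[OF \<phi>] Z.M.a_group QmodZ.is_group] by (simp add: dual_simps)
  qed
  then have D0: "carrier (dual Z) = {\<zero>\<^bsub>dual Z\<^esub>}" using D.M.zero_closed by blast
  obtain \<theta> where \<theta>: "\<theta> \<in> mod_hom (op_ring R) (dual Z) M" "bij_betw \<theta> (carrier (dual Z)) (carrier M)"
    using assms(1) by (auto simp: mod_iso_def)
  have "carrier M = {\<theta> \<zero>\<^bsub>dual Z\<^esub>}" using \<theta>(2) D0 by (auto simp: bij_betw_def)
  then show ?thesis
    using assms(1) mods_zero_closed[of M] by (auto simp: zeros_def)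
qed

text \<open>Dualizing each syzygy sequence gives an embedding into an injective module. The j + 1
  flat terms become j + 1 injective ones, hence \<open>Suc j\<close>.\<close>

lemma flat_resolution_dual:
  "\<lbrakk>K \<in> left.mods; is_dual N K; \<forall>i\<le>j. Y i \<in> (Flat_mods R :: ('r, 'u) module set);
    Y (j + 1) \<in> left.mods; carrier (Y (j + 1)) = {\<zero>\<^bsub>Y (j + 1)\<^esub>};
    \<epsilon> ` carrier (Y 0) = carrier K; exact_at R (Y 1) (d 0) (Y 0) \<epsilon> K;
    \<forall>i<j. exact_at R (Y (i + 2)) (d (i + 1)) (Y (i + 1)) (d i) (Y i)\<rbrakk> \<Longrightarrow> N \<in> cosyz zeros (Suc j)"
proof (induction j arbitrary: K N Y \<epsilon> d)
  case 0
  have Y0: "Y 0 \<in> (Flat_mods R :: ('r, 'u) module set)" using 0 by simp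
  then have Ym: "Y 0 \<in> left.mods" "Y 1 \<in> left.mods" using 0 by (simp_all add: Flat_mods_def)
  have "inj_on (d 0) (carrier (Y 1))" using 0(5) by (simp add: inj_on_def)
  then have s: "short_exact R (Y 1) (d 0) (Y 0) \<epsilon> K" using 0 by (simp add: short_exact_def)
  obtain J where J: "is_dual J (Y 0)" by (rule ex_dual_mods[OF Ym(1)])
  obtain Z where Z: "is_dual Z (Y 1)" by (rule ex_dual_mods[OF Ym(2)])
  have Zz: "Z \<in> zeros" by (rule is_dual_zero[OF Z _ left.mods_lmodule[OF Ym(2)]]) (use 0 in simp)
  obtain u v where "ses N u J v Z"
    using dual_ses[OF left.mods_lmodule[OF Ym(2)] left.mods_lmodule[OF Ym(1)] left.mods_lmodule[OF 0(1)] s 0(2) J Z]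
    by blast
  with Zz flat_dual_injective[OF Y0 J] 0(2) show ?case by auto
next
  case (Suc j)
  have Y0: "Y 0 \<in> (Flat_mods R :: ('r, 'u) module set)" and Y1: "Y 1 \<in> (Flat_mods R :: ('r, 'u) module set)"
    using Suc.prems by simp_all
  then have Ym: "Y 0 \<in> left.mods" "Y 1 \<in> left.mods" by (simp_all add: Flat_mods_def)
  have e0: "exact_at R (Y 2) (d 1) (Y 1) (d 0) (Y 0)"
    using spec[OF Suc.prems(8), of 0] by (simp add: numeral_2_eq_2)
  have \<epsilon>: "\<epsilon> \<in> mod_hom R (Y 0) K" and d0: "d 0 \<in> mod_hom R (Y 1) (Y 0)"
    and im: "d 0 ` carrier (Y 1) = a_kernel (Y 0) K \<epsilon>"
    using Suc.prems(7) by (auto simp: exact_at_def)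
  let ?K = "(Y 0)\<lparr>carrier := a_kernel (Y 0) K \<epsilon>\<rparr>"
  have K: "?K \<in> left.mods" by (rule left.kernel_mods[OF Ym(1) Suc.prems(1) \<epsilon>])
  have s: "short_exact R ?K (\<lambda>x. x) (Y 0) \<epsilon> K"
    by (rule short_exact_kernel[OF \<epsilon>]) (use Suc.prems(6) in blast)
  obtain J where J: "is_dual J (Y 0)" by (rule ex_dual_mods[OF Ym(1)])
  obtain N' where N': "is_dual N' ?K" by (rule ex_dual_mods[OF K])
  have d0': "d 0 \<in> mod_hom R (Y 1) ?K"
    using d0 im by (auto simp: mod_hom_def)
  have "a_kernel (Y 1) ?K (d 0) = a_kernel (Y 1) (Y 0) (d 0)"
    by (auto simp: a_kernel_iff)
  then have e0': "exact_at R (Y 2) (d 1) (Y 1) (d 0) ?K"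
    using e0 d0' by (simp add: exact_at_def)
  have "N' \<in> cosyz zeros (Suc j)"
  proof (rule Suc.IH[of ?K N' "\<lambda>i. Y (Suc i)" "d 0" "\<lambda>i. d (Suc i)", OF K N'])
    show "exact_at R (Y (Suc 1)) (d (Suc 0)) (Y (Suc 0)) (d 0) ?K"
      using e0' by (simp add: numeral_2_eq_2)
    show "\<forall>i<j. exact_at R (Y (Suc (i + 2))) (d (Suc (i + 1))) (Y (Suc (i + 1))) (d (Suc i)) (Y (Suc i))"
      using Suc.prems(8) by auto
    show "d 0 ` carrier (Y (Suc 0)) = carrier ?K" using im by simp
  qed (use Suc.prems(3-5) in auto)
  moreover obtain u v where "ses N u J v N'"
    using dual_ses[OF left.mods_lmodule[OF K] left.mods_lmodule[OF Ym(1)] left.mods_lmodule[OF Suc.prems(1)]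
        s Suc.prems(2) J N'] by blast
  ultimately show ?case
    unfolding cosyz.simps(2)[of zeros "Suc j"] using flat_dual_injective[OF Y0 J] Suc.prems(2) by blast
qed

lemma resolved_by_flat_dual:
  assumes K: "K \<in> left.mods" and N: "is_dual N K"
    and r: "resolved_by R (Flat_mods R :: ('r, 'u) module set) k K"
  shows "N \<in> cosyz zeros (Suc k)"
proof -
  obtain j Y d \<epsilon> where j: "j \<le> k" and *: "\<forall>i\<le>j. Y i \<in> (Flat_mods R :: ('r, 'u) module set)"
    "Y (j + 1) \<in> left.mods" "carrier (Y (j + 1)) = {\<zero>\<^bsub>Y (j + 1)\<^esub>}"
    "\<epsilon> ` carrier (Y 0) = carrier K" "exact_at R (Y 1) (d 0) (Y 0) \<epsilon> K"
    "\<forall>i<j. exact_at R (Y (i + 2)) (d (i + 1)) (Y (i + 1)) (d i) (Y i)"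
    using r unfolding resolved_by_def by blast
  from j have "Suc j \<le> Suc k" by simp
  from subsetD[OF cosyz_zeros_le[OF this] flat_resolution_dual[OF K N *]] show ?thesis .
qed

section \<open>Bidual quotients and right cotorsion pairs\<close>

text \<open>The sequence of C, its bidual and their quotient, with copies in \<open>'u\<close> to
  which the results on \<open>cosyz\<close> apply.\<close>

lemma bidual_copies:
  assumes C: "C \<in> mods"
  obtains M Q a b where "M \<in> mods" "mod_iso (op_ring R) (dual (dual C)) M"
    "Q \<in> mods" "mod_iso (op_ring R) (bidual_quotient C) Q" "ses C a M b Q"
proof -
  have Cl: "lmodule (op_ring R) C" and Cs: "carrier C \<prec> (UNIV :: 'u set)"
    using C by (auto simp: Mods_def)
  have D: "lmodule R (dual C)" using lmodule_dual[OF Cl] by simp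
  have DD: "lmodule (op_ring R) (dual (dual C))" by (rule lmodule_dual[OF D])
  have DDs: "carrier (dual (dual C)) \<prec> (UNIV :: 'u set)"
    by (intro small_dual universe Cs)
  note bq = bidual_short_exact[OF Cl]
  obtain M where M: "M \<in> mods" "mod_iso (op_ring R) (dual (dual C)) M"
    by (rule ex_copy[OF DD DDs])
  obtain Q where Q: "Q \<in> mods" "mod_iso (op_ring R) (bidual_quotient C) Q"
    by (rule ex_copy[OF bq(1) lesspoll_trans1[OF bq(3) DDs]])
  obtain g where s: "short_exact (op_ring R) C (bidual_eval C) (dual (dual C)) g (bidual_quotient C)"
    using bq(2) by blast
  obtain f' g' where "short_exact (op_ring R) C f' M g' (bidual_quotient C)"
    using short_exact_iso_mid[OF DD mods_lmodule[OF M(1)] M(2) s] by blast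
  then obtain g'' where "ses C f' M g'' Q"
    using short_exact_iso_right[OF bq(1) mods_lmodule[OF Q(1)] Q(2)] by blast
  with M Q that show thesis by blast
qed

text \<open>The bound m belongs to this single C; uniformity enters only in the final proof. The
  left cotorsion pair is applied to a copy of \<open>dual C\<close>, and its approximation is
  transported back before being dualized.\<close>

lemma cosyz_gis_bound:
  assumes n: "n \<ge> 1"
    and lcp: "left_cotorsion_pair R n (GFlat_mods R :: ('r, 'u) module set) (Flat_mods R)"
    and C: "C \<in> mods" and m: "coresolved_by (op_ring R) gis m (bidual_quotient C)"
  shows "C \<in> cosyz gis (Suc (max n m))"
proof -
  obtain M Q a b where M: "M \<in> mods" "mod_iso (op_ring R) (dual (dual C)) M"
    and Q: "Q \<in> mods" "mod_iso (op_ring R) (bidual_quotient C) Q" and s: "ses C a M b Q"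
    by (rule bidual_copies[OF C])
  have Cl: "lmodule (op_ring R) C" and Cs: "carrier C \<prec> (UNIV :: 'u set)"
    using C by (auto simp: Mods_def)
  have D: "lmodule R (dual C)" using lmodule_dual[OF Cl] by simp
  have BQ: "lmodule (op_ring R) (bidual_quotient C)" using m by (simp add: coresolved_by_def)
  have "coresolved_by (op_ring R) gis m Q"
    by (rule coresolved_by_iso[OF BQ mods_lmodule[OF Q(1)] mod_iso_sym[OF BQ Q(2)] m])
  then have Qm: "Q \<in> cosyz gis m" by (rule coresolved_by_gis_cosyz[OF Q(1)])
  obtain D0 where D0: "D0 \<in> left.mods" "mod_iso R (dual C) D0"
    by (rule left.ex_copy[OF D small_dual[OF universe Cs]])
  obtain A K f g where A: "A \<in> (GFlat_mods R :: ('r, 'u) module set)" and K: "K \<in> left.mods"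
    and r: "resolved_by R (Flat_mods R :: ('r, 'u) module set) (n - 1) K" and sA: "short_exact R K f A g D0"
    using lcp D0(1) unfolding left_cotorsion_pair_def by blast
  have Am: "A \<in> left.mods" using A by (simp add: GFlat_mods_def)
  obtain g' where sA': "short_exact R K f A g' (dual C)"
    using short_exact_iso_right[OF left.mods_lmodule[OF D0(1)] D mod_iso_sym[OF D D0(2)] sA] by blast
  obtain MA where MA: "is_dual MA A" by (rule ex_dual_mods[OF Am])
  obtain MK where MK: "is_dual MK K" by (rule ex_dual_mods[OF K])
  obtain u v where sM: "ses M u MA v MK"
    using dual_ses[OF left.mods_lmodule[OF K] left.mods_lmodule[OF Am] D sA' _ MA MK, of M] M by blast
  \<comment> \<open>K has a flat resolution with at most (n - 1) + 1 terms, which is n since n is at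
    least 1.\<close>
  have "MK \<in> cosyz zeros n" using resolved_by_flat_dual[OF K MK r] n by simp
  from cosyz_gis_from_extension[OF C M(1) s sM gflat_dual_gi[OF A MA] this Qm] show ?thesis .
qed

text \<open>A right (k + 1)-pair asks for cokernels with an injective coresolution of length at most
  k, hence with k + 1 terms; \<open>cosyz_gis_approx\<close> provides these at level
  \<open>Suc k\<close>.\<close>

lemma right_cotorsion_pairI:
  assumes "\<And>C. C \<in> mods \<Longrightarrow> C \<in> cosyz gis (Suc k)"
  shows "right_cotorsion_pair (op_ring R) (k + 1) injs gis"
  unfolding right_cotorsion_pair_def
proof (intro conjI ballI allI impI summand_closed_gis)
  show "trivial_group (Ext (op_ring R) i A B)" if "A \<in> injs" "B \<in> gis" "1 \<le> i \<and> i \<le> k + 1" for A B i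
    using that by (intro trivial_Ext_injs_gis) auto
  fix C assume "C \<in> mods"
  from cosyz_gis_approx[OF assms[OF this]]
  obtain B L f g where *: "B \<in> gis" "L \<in> cosyz zeros (Suc k)" "ses C f B g L" by blast
  then show "\<exists>B\<in>gis. \<exists>L\<in>mods. \<exists>f g. coresolved_by (op_ring R) injs (k + 1 - 1) L \<and> ses C f B g L"
    using cosyz_zeros_coresolved[OF *(2)] cosyz_zeros_mods[OF *(2)] by auto
qed

text \<open>The pair embeds the copy Q into a Gorenstein injective module with cokernel coresolved
  by injectives in length at most k. Injectives are Gorenstein injective, so splicing gives k + 1,
  uniformly in C.\<close>

lemma Gid_bidual_quotient_le:
  assumes rcp: "right_cotorsion_pair (op_ring R) (k + 1) injs gis" and C: "C \<in> mods"
  shows "Gid U (op_ring R) (bidual_quotient C) \<le> enat (Suc k)"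
proof -
  obtain M Q a b where Q: "Q \<in> mods" "mod_iso (op_ring R) (bidual_quotient C) Q"
    by (rule bidual_copies[OF C])
  have BQ: "lmodule (op_ring R) (bidual_quotient C)" 
    by (rule bidual_short_exact[OF mods_lmodule[OF C]])
  obtain B L f g where B: "B \<in> gis" and L: "L \<in> mods" "coresolved_by (op_ring R) injs k L"
    and s: "ses Q f B g L"
    using rcp Q(1) unfolding right_cotorsion_pair_def by auto
  have "coresolved_by (op_ring R) gis (Suc k) Q"
    by (rule coresolved_by_splice[OF mods_lmodule[OF Q(1)] s B _ coresolved_by_mono[OF L(2) injs_gis]])
      (use gis_mods in blast)
  then have "coresolved_by (op_ring R) gis (Suc k) (bidual_quotient C)"
    by (rule coresolved_by_iso[OF mods_lmodule[OF Q(1)] BQ Q(2)])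
  then show ?thesis
    unfolding Gid_def by (intro Inf_lower) blast
qed

text \<open>A finite infimum in \<open>enat\<close> is attained, as \<open>enat\<close> is
  well-ordered.\<close>

lemma Gid_le_enatD:
  fixes N :: "('r, 'c) module"
  assumes "Gid U S N \<le> enat m"
  shows "\<exists>k\<le>m. coresolved_by S (GInj_mods S :: ('r, 'u) module set) k N"
proof -
  let ?X = "{enat k | k. coresolved_by S (GInj_mods S :: ('r, 'u) module set) k N}"
  have "?X \<noteq> {}"
  proof
    assume "?X = {}"
    then have "Gid U S N = \<infinity>" by (simp add: Gid_def Inf_enat_def)
    with assms show False by simp
  qed
  then have "Inf ?X \<in> ?X" unfolding Inf_enat_def by (auto intro: LeastI)
  with assms show ?thesis unfolding Gid_def by auto
qed

end

theorem theorem5p21: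
  fixes R :: "('r, 'x) ring_scheme" and n :: nat and m :: enat
  assumes "universe_type TYPE('u)"
    and "ring R" and "carrier R \<prec> (UNIV :: 'u set)"
    and "n \<ge> 1"
    and "left_cotorsion_pair R n (GFlat_mods R :: ('r, 'u) module set) (Flat_mods R)"
    and "m = sup_Gid_bidual_quotient TYPE('u) R"
  shows "(m < \<infinity> \<longleftrightarrow>
           (\<exists>k\<ge>1. right_cotorsion_pair (op_ring R) (k + 1)
              (Inj_mods (op_ring R) :: ('r, 'u) module set) (GInj_mods (op_ring R)))) \<and>
         (m < \<infinity> \<or>
           (\<exists>k\<ge>1. right_cotorsion_pair (op_ring R) (k + 1)
              (Inj_mods (op_ring R) :: ('r, 'u) module set) (GInj_mods (op_ring R))) \<longrightarrow>
          right_cotorsion_pair (op_ring R) (max n (the_enat m) + 1)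
            (Inj_mods (op_ring R) :: ('r, 'u) module set) (GInj_mods (op_ring R)))"
proof -
  interpret small_bimodules R "TYPE('u)"
    by (rule small_bimodules.intro) fact+
  have 1: "right_cotorsion_pair (op_ring R) (max n (the_enat m) + 1) injs gis" if fin: "m < \<infinity>"
  proof (rule right_cotorsion_pairI)
    fix C assume C: "C \<in> mods"
    \<comment> \<open>Finiteness of m is what makes \<open>the_enat m\<close> its actual
      value.\<close>
    have "Gid TYPE('u) (op_ring R) (bidual_quotient C) \<le> m"
      using C unfolding assms(6) sup_Gid_bidual_quotient_def by (rule SUP_upper)
    then have "Gid TYPE('u) (op_ring R) (bidual_quotient C) \<le> enat (the_enat m)"
      using fin by (cases m) auto
    then obtain l where l: "l \<le> the_enat m" "coresolved_by (op_ring R) gis l (bidual_quotient C)"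
      using Gid_le_enatD by blast
    \<comment> \<open>The length l varies with C; monotonicity of the levels gives one bound for all
      C.\<close>
    from l(1) have "Suc (max n l) \<le> Suc (max n (the_enat m))" by simp
    from subsetD[OF cosyz_gis_le[OF this] cosyz_gis_bound[OF assms(4,5) C l(2)]]
    show "C \<in> cosyz gis (Suc (max n (the_enat m)))" .
  qed
  have 2: "m < \<infinity>" if "right_cotorsion_pair (op_ring R) (k + 1) injs gis" for k
  proof -
    have "m \<le> enat (Suc k)"
      unfolding assms(6) sup_Gid_bidual_quotient_def
      by (rule SUP_least) (rule Gid_bidual_quotient_le[OF that])
    then show ?thesis by (cases m) auto
  qed
  \<comment> \<open>This admits max n m as a witness in (b), also when m = 0. From (b), fact 2 gives
    (a), and then fact 1 yields the pair for max n m in either case.\<close>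
  have "1 \<le> max n (the_enat m)" using assms(4) by simp
  with 1 2 show ?thesis by blast
qed

end
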